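(* Let $G$ be a basic CUH graph that omits $D$ or omits $\widetilde{D}$, and in which not both color classes are independent sets. Then each of the classes of finite 2-colored graphs listed below is an amalgamation class, and, up to interchanging the two colors, one of the following holds: (i) If $\alpha_R$ is finite, then $G$ is isomorphic to (a) $F_{\aleph_0,1}^{\alpha_R}$, the Fraïssé limit of the class of graphs in $\mathcal{C}$ that omit the red $\overline{K}_{\alpha_R+1}$ and the blue $K_2$; or (b) $F_{\aleph_0,2}^{\alpha_R}$, the Fraïssé limit of the class of graphs in $\mathcal{C}$ that omit the red $\overline{K}_{\alpha_R+1}$, the blue $K_3$, $T_b$ and $\widetilde{T}_b$. (ii) Otherwise ($\alpha_R=\aleph_0$), $G$ is isomorphic to one of: (a) $F_{2,1}$, the Fraïssé limit of the class of graphs in $\mathcal{C}$ that omit the red $K_3$, the blue $K_2$, $T_r$ and $\widetilde{T}_r$; (b) $F_{\aleph_0,1}$, the Fraïssé limit of the class of graphs in $\mathcal{C}$ that omit the blue $K_2$; (c) $F_{2,2}$, the Fraïssé limit of the class of graphs in $\mathcal{C}$ that omit the red $K_3$, the blue $K_3$, and all of $T_r,\widetilde{T}_r,T_b,\widetilde{T}_b$; (d) $F_{\aleph_0,2}$, the Fraïssé limit of the class of graphs in $\mathcal{C}$ that omit the blue $K_3$, $T_b$ and $\widetilde{T}_b$; (e) $F_{\aleph_0,\aleph_0}$, the Fraïssé limit of the class of graphs in $\mathcal{C}$ that omit $D$ and $\widetilde{D}$.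
   Context: All graphs are simple. A 2-colored graph is a graph $G$ with a map $\chi\colon V(G)\to\{\text{red},\text{blue}\}$; $R,B$ are the red and blue vertex sets. Induced subgraphs inherit colors; isomorphisms are color-preserving. $G$ is ultrahomogeneous if every isomorphism between finite induced subgraphs extends to an automorphism. Cross edges join vertices of different colors. A CUH graph is a countably infinite ultrahomogeneous 2-colored graph in which $G[R]$ and $G[B]$ are disjoint unions of cliques; $\alpha_R,\alpha_B$ are the independence numbers of $G[R],G[B]$ (in $\mathbb{N}\cup\{\aleph_0\}$). $G$ is a blow-up if for one color $c$ (other color $c'$) there are a 2-colored graph $H$ whose $c$-colored vertices form an independent set and $i\in\mathbb{N}_{\ge2}\cup\{\aleph_0\}$ such that $G$ arises from $H$ by replacing each $c$-colored vertex $u$ by a $c$-colored $i$-clique whose vertices are adjacent exactly to the other vertices of that clique and to the $c'$-colored neighbors of $u$ in $H$. A CUH graph is basic if it is not a blow-up and $\min\{\alpha_R,\alpha_B\}\ge2$. A finite 2-colored graph is realized in $G$ if isomorphic to an induced subgraph of $G$, and omitted otherwise; a graph "omits" $X$ if it has no induced subgraph isomorphic to $X$. $\mathcal{C}$ is the class of finite 2-colored graphs whose two color classes each induce a disjoint union of cliques. An amalgamation class is a class of finite 2-colored graphs closed under isomorphism and induced subgraphs with the amalgamation property; its Fraïssé limit is the unique (up to isomorphism) countable ultrahomogeneous 2-colored graph whose finite induced subgraphs are, up to isomorphism, exactly the members of the class. "Red $K_n$"/"red $\overline{K}_n$" denote a red clique/independent set on $n$ vertices, similarly for blue. $T_r$: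 triangle with two red and one blue vertex. $T_b$: triangle with one red and two blue vertices. $\widetilde{T}_r$: two adjacent red vertices and one blue vertex, no cross edges. $\widetilde{T}_b$: two adjacent blue vertices and one red vertex, no cross edges. $D$: red $r_1,r_2$, blue $b_1,b_2$, edges $r_1r_2,b_1b_2,r_1b_1,r_1b_2,r_2b_1$. $\widetilde{D}$: red $r_1,r_2$, blue $b_1,b_2$, edges $r_1r_2,b_1b_2,r_2b_2$. *)

theory Defs
  imports Main "HOL-Library.Disjoint_Sets" "HOL-Library.Extended_Nat" "HOL-Library.Countable_Set"
begin

datatype color = Red | Blue

fun other :: "color \<Rightarrow> color" where
  "other Red = Blue"
| "other Blue = Red"

text \<open>The values of \<open>col\<close> outside \<open>verts\<close> carry no meaning; every notion below ignores them.\<close>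

record 'a cgraph =
  verts :: "'a set"
  adj :: "'a \<Rightarrow> 'a \<Rightarrow> bool"
  col :: "'a \<Rightarrow> color"

definition simple_cgraph :: "'a cgraph \<Rightarrow> bool" where
  "simple_cgraph G \<longleftrightarrow>
     (\<forall>x y. adj G x y \<longrightarrow> x \<in> verts G \<and> y \<in> verts G \<and> x \<noteq> y \<and> adj G y x)"

definition color_class :: "'a cgraph \<Rightarrow> color \<Rightarrow> 'a set" where
  "color_class G c = {x \<in> verts G. col G x = c}"

definition induced :: "'a cgraph \<Rightarrow> 'a set \<Rightarrow> 'a cgraph" where
  "induced G S =
     \<lparr>verts = verts G \<inter> S, adj = (\<lambda>x y. x \<in> S \<and> y \<in> S \<and> adj G x y), col = col G\<rparr>"

definition swap_colors :: "'a cgraph \<Rightarrow> 'a cgraph" where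
  "swap_colors G = \<lparr>verts = verts G, adj = adj G, col = (\<lambda>x. other (col G x))\<rparr>"

definition is_iso :: "('a \<Rightarrow> 'b) \<Rightarrow> 'a cgraph \<Rightarrow> 'b cgraph \<Rightarrow> bool" where
  "is_iso f G H \<longleftrightarrow>
     bij_betw f (verts G) (verts H) \<and>
     (\<forall>x\<in>verts G. \<forall>y\<in>verts G. adj H (f x) (f y) \<longleftrightarrow> adj G x y) \<and>
     (\<forall>x\<in>verts G. col H (f x) = col G x)"

definition isomorphic :: "'a cgraph \<Rightarrow> 'b cgraph \<Rightarrow> bool" where
  "isomorphic G H \<longleftrightarrow> (\<exists>f. is_iso f G H)"

definition is_embedding :: "('a \<Rightarrow> 'b) \<Rightarrow> 'a cgraph \<Rightarrow> 'b cgraph \<Rightarrow> bool" where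
  "is_embedding f G H \<longleftrightarrow> f ` verts G \<subseteq> verts H \<and> is_iso f G (induced H (f ` verts G))"

definition realized :: "'b cgraph \<Rightarrow> 'a cgraph \<Rightarrow> bool" where
  "realized X G \<longleftrightarrow> (\<exists>S\<subseteq>verts G. isomorphic X (induced G S))"

definition omits :: "'a cgraph \<Rightarrow> 'b cgraph \<Rightarrow> bool" where
  "omits G X \<longleftrightarrow> \<not> realized X G"

definition ultrahomogeneous :: "'a cgraph \<Rightarrow> bool" where
  "ultrahomogeneous G \<longleftrightarrow>
     (\<forall>S T f. finite S \<and> S \<subseteq> verts G \<and> finite T \<and> T \<subseteq> verts G \<and>
              is_iso f (induced G S) (induced G T) \<longrightarrow>
        (\<exists>g. is_iso g G G \<and> (\<forall>x\<in>S. g x = f x)))"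

definition independent_set :: "'a cgraph \<Rightarrow> 'a set \<Rightarrow> bool" where
  "independent_set G S \<longleftrightarrow> S \<subseteq> verts G \<and> (\<forall>x\<in>S. \<forall>y\<in>S. \<not> adj G x y)"

definition disjoint_union_of_cliques :: "'a cgraph \<Rightarrow> bool" where
  "disjoint_union_of_cliques G \<longleftrightarrow>
     (\<exists>P. partition_on (verts G) P \<and>
        (\<forall>x\<in>verts G. \<forall>y\<in>verts G. adj G x y \<longleftrightarrow> x \<noteq> y \<and> (\<exists>p\<in>P. x \<in> p \<and> y \<in> p)))"

text \<open>Only countable graphs are considered, so \<open>\<infinity>\<close> plays the role of \<open>\<aleph>\<^sub>0\<close>.\<close>

definition independence_number :: "'a cgraph \<Rightarrow> enat" where
  "independence_number G =
     (SUP S\<in>{S. independent_set G S}. if finite S then enat (card S) else \<infinity>)"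

definition alpha :: "color \<Rightarrow> 'a cgraph \<Rightarrow> enat" where
  "alpha c G = independence_number (induced G (color_class G c))"

definition CUH :: "'a cgraph \<Rightarrow> bool" where
  "CUH G \<longleftrightarrow>
     simple_cgraph G \<and> countable (verts G) \<and> infinite (verts G) \<and> ultrahomogeneous G \<and>
     disjoint_union_of_cliques (induced G (color_class G Red)) \<and>
     disjoint_union_of_cliques (induced G (color_class G Blue))"

text \<open>A \<open>c\<close>-colored vertex \<open>u\<close> of \<open>H\<close> is replaced by the clique of all \<open>(u, k)\<close> with \<open>k < i\<close>;
  a vertex \<open>u\<close> of the other color is kept as \<open>(u, 0)\<close>.\<close>

definition blow_up :: "color \<Rightarrow> enat \<Rightarrow> 'a cgraph \<Rightarrow> ('a \<times> nat) cgraph" where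
  "blow_up c i H =
     (let V = {(u, k). u \<in> verts H \<and> (if col H u = c then enat k < i else k = 0)} in
      \<lparr>verts = V,
       adj = (\<lambda>x y. x \<in> V \<and> y \<in> V \<and> (fst x = fst y \<and> snd x \<noteq> snd y \<or> adj H (fst x) (fst y))),
       col = (\<lambda>x. col H (fst x))\<rparr>)"

text \<open>Any such \<open>H\<close> is isomorphic to an induced subgraph of \<open>G\<close>, so it may be taken to live on the
  same vertex type.\<close>

definition is_blow_up :: "'a cgraph \<Rightarrow> bool" where
  "is_blow_up G \<longleftrightarrow>
     (\<exists>c (H :: 'a cgraph) i. simple_cgraph H \<and> independent_set H (color_class H c) \<and> 2 \<le> i \<and>
        isomorphic G (blow_up c i H))"

definition basic_CUH :: "'a cgraph \<Rightarrow> bool" where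
  "basic_CUH G \<longleftrightarrow> CUH G \<and> \<not> is_blow_up G \<and> 2 \<le> min (alpha Red G) (alpha Blue G)"

text \<open>Classes of finite graphs are represented by their members on natural-number vertices; every
  finite graph is isomorphic to one of these.\<close>

definition finite_cgraph :: "nat cgraph \<Rightarrow> bool" where
  "finite_cgraph A \<longleftrightarrow> simple_cgraph A \<and> finite (verts A)"

definition amalgamation_property :: "nat cgraph set \<Rightarrow> bool" where
  "amalgamation_property K \<longleftrightarrow>
     (\<forall>A\<in>K. \<forall>B1\<in>K. \<forall>B2\<in>K. \<forall>f1 f2. is_embedding f1 A B1 \<and> is_embedding f2 A B2 \<longrightarrow>
        (\<exists>C\<in>K. \<exists>g1 g2. is_embedding g1 B1 C \<and> is_embedding g2 B2 C \<and>
           (\<forall>x\<in>verts A. g1 (f1 x) = g2 (f2 x))))"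

definition amalgamation_class :: "nat cgraph set \<Rightarrow> bool" where
  "amalgamation_class K \<longleftrightarrow>
     (\<forall>A\<in>K. finite_cgraph A) \<and>
     (\<forall>A\<in>K. \<forall>B. finite_cgraph B \<and> isomorphic A B \<longrightarrow> B \<in> K) \<and>
     (\<forall>A\<in>K. \<forall>S\<subseteq>verts A. induced A S \<in> K) \<and>
     amalgamation_property K"

definition is_fraisse_limit :: "nat cgraph set \<Rightarrow> 'a cgraph \<Rightarrow> bool" where
  "is_fraisse_limit K F \<longleftrightarrow>
     simple_cgraph F \<and> countable (verts F) \<and> ultrahomogeneous F \<and>
     {A. finite_cgraph A \<and> realized A F} = K"

text \<open>By Fraisse's theorem such a graph exists for every nonempty amalgamation class and is unique
  up to isomorphism; a representative on natural-number vertices is chosen.\<close>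

definition fraisse_limit :: "nat cgraph set \<Rightarrow> nat cgraph" where
  "fraisse_limit K = (SOME F. is_fraisse_limit K F)"

definition mono_clique :: "color \<Rightarrow> nat \<Rightarrow> nat cgraph" where
  "mono_clique c n = \<lparr>verts = {..<n}, adj = (\<lambda>x y. x < n \<and> y < n \<and> x \<noteq> y), col = (\<lambda>_. c)\<rparr>"

definition mono_indep :: "color \<Rightarrow> nat \<Rightarrow> nat cgraph" where
  "mono_indep c n = \<lparr>verts = {..<n}, adj = (\<lambda>_ _. False), col = (\<lambda>_. c)\<rparr>"

definition mk_cgraph :: "nat set \<Rightarrow> nat set \<Rightarrow> nat set set \<Rightarrow> nat cgraph" where
  "mk_cgraph R B E =
     \<lparr>verts = R \<union> B, adj = (\<lambda>x y. x \<noteq> y \<and> {x, y} \<in> E),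
      col = (\<lambda>x. if x \<in> R then Red else Blue)\<rparr>"

definition T_r :: "nat cgraph" where
  "T_r = mk_cgraph {1, 2} {3} {{1, 2}, {1, 3}, {2, 3}}"

definition T_b :: "nat cgraph" where
  "T_b = mk_cgraph {1} {2, 3} {{1, 2}, {1, 3}, {2, 3}}"

definition T_r_tilde :: "nat cgraph" where
  "T_r_tilde = mk_cgraph {1, 2} {3} {{1, 2}}"

definition T_b_tilde :: "nat cgraph" where
  "T_b_tilde = mk_cgraph {1} {2, 3} {{2, 3}}"

text \<open>In the next two graphs \<open>r\<^sub>1, r\<^sub>2, b\<^sub>1, b\<^sub>2\<close> are 1, 2, 3, 4.\<close>

definition D_graph :: "nat cgraph" where
  "D_graph = mk_cgraph {1, 2} {3, 4} {{1, 2}, {3, 4}, {1, 3}, {1, 4}, {2, 3}}"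

definition D_tilde :: "nat cgraph" where
  "D_tilde = mk_cgraph {1, 2} {3, 4} {{1, 2}, {3, 4}, {2, 4}}"

definition class_C :: "nat cgraph set" where
  "class_C = {A. finite_cgraph A \<and>
     disjoint_union_of_cliques (induced A (color_class A Red)) \<and>
     disjoint_union_of_cliques (induced A (color_class A Blue))}"

definition omitting :: "nat cgraph set \<Rightarrow> nat cgraph set" where
  "omitting \<X> = {A \<in> class_C. \<forall>X\<in>\<X>. omits A X}"

text \<open>In \<open>K_q_p\<close> the suffixes are the bounds on the sizes of red and of blue cliques (\<open>w\<close> standing
  for \<open>\<aleph>\<^sub>0\<close>); the variants with argument \<open>n\<close> allow at most \<open>n\<close> red cliques.\<close>

definition K_w_1_fin :: "nat \<Rightarrow> nat cgraph set" where
  "K_w_1_fin n = omitting {mono_indep Red (n + 1), mono_clique Blue 2}"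

definition K_w_2_fin :: "nat \<Rightarrow> nat cgraph set" where
  "K_w_2_fin n = omitting {mono_indep Red (n + 1), mono_clique Blue 3, T_b, T_b_tilde}"

definition K_2_1 :: "nat cgraph set" where
  "K_2_1 = omitting {mono_clique Red 3, mono_clique Blue 2, T_r, T_r_tilde}"

definition K_w_1 :: "nat cgraph set" where
  "K_w_1 = omitting {mono_clique Blue 2}"

definition K_2_2 :: "nat cgraph set" where
  "K_2_2 = omitting {mono_clique Red 3, mono_clique Blue 3, T_r, T_r_tilde, T_b, T_b_tilde}"

definition K_w_2 :: "nat cgraph set" where
  "K_w_2 = omitting {mono_clique Blue 3, T_b, T_b_tilde}"

definition K_w_w :: "nat cgraph set" where
  "K_w_w = omitting {D_graph, D_tilde}"

end

theory Submission
  imports Defs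
begin

text \<open>Since \<open>G\<close> is not a blow-up and is homogeneous, any two
  adjacent vertices of one color are separated by a vertex of the other color.

  If the blue class is independent, moving a red neighbor of \<open>s\<close> by automorphisms that fix \<open>s\<close> and a
  red edge of another clique shows that adjacent red vertices either have complementary blue
  neighborhoods, or realize each of the four patterns on infinitely many blue vertices.

  If both classes have edges, every vertex splits every clique of the other color. Up to
  complementing the cross edges \<open>D\<close> is omitted, so between two cliques the cross edges form disjoint
  bicliques; three or more of them would force perfect matchings between all cliques, which
  contradicts homogeneity. So \<open>D_tilde\<close> is omitted too and any two adjacent red vertices are, on each
  blue clique, either equal or opposite. If some red clique has three vertices, then both the set of
  cliques where they are equal and the set where they are opposite are infinite: otherwise the latter
  set could be moved to any set of the same size while an edge of another red clique is fixed.

  These dichotomies show that \<open>G\<close> realizes every finite graph in the class it should be the limit of,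
  placing the blue vertices first. Isomorphism with the limit is then a back-and-forth argument.
  All seven kinds of classes are instances of one family, whose amalgamation is done one vertex at a
  time.\<close>

section \<open>Homogeneous pairs of unions of cliques\<close>

text \<open>The extension properties are obtained by moving backwards. A red vertex with a
  prescribed trace on given blue vertices is hard to build directly. For a given red vertex,
  however, it is easy to find other blue vertices on which it already shows that trace, once each
  pattern occurs on infinitely many cliques. Homogeneity carries these to the given ones, and the
  image of the red vertex is the one wanted. The main obstacle is that the number of red cliques may
  be finite, so a new red vertex cannot always open a clique of its own. Amalgamation is not free
  either: when cliques have at most two vertices, the missing vertex may be present already and must
  then be identified. This is why one vertex at a time is treated, with identification as one of the
  possible outcomes.\<close>

text \<open>\<open>A\<close> is adjacency within a color and \<open>E\<close> the cross relation. They are kept apart because the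
  arguments are symmetric under complementing \<open>E\<close> and under exchanging \<open>R\<close> and \<open>B\<close>.\<close>

locale bicol =
  fixes R B :: "'a set" and A E :: "'a \<Rightarrow> 'a \<Rightarrow> bool"
  assumes disj: "R \<inter> B = {}"
    and A_sym: "A x y \<Longrightarrow> A y x"
    and A_irr: "\<not> A x x"
    and A_trans: "A x y \<Longrightarrow> A y z \<Longrightarrow> x \<noteq> z \<Longrightarrow> A x z"
    and A_col: "A x y \<Longrightarrow> x \<in> R \<and> y \<in> R \<or> x \<in> B \<and> y \<in> B"
    and hom: "finite p \<Longrightarrow> p \<subseteq> R \<times> R \<union> B \<times> B \<Longrightarrow>
      (\<And>x y x' y'. (x, y) \<in> p \<Longrightarrow> (x', y') \<in> p \<Longrightarrow>
         (x = x' \<longleftrightarrow> y = y') \<and> (A x x' \<longleftrightarrow> A y y') \<and> (x \<in> R \<longrightarrow> x' \<in> B \<longrightarrow> (E x x' \<longleftrightarrow> E y y'))) \<Longrightarrow>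
      \<exists>g. bij_betw g R R \<and> bij_betw g B B \<and> (\<forall>x\<in>R \<union> B. \<forall>y\<in>R \<union> B. A (g x) (g y) \<longleftrightarrow> A x y) \<and>
          (\<forall>r\<in>R. \<forall>b\<in>B. E (g r) (g b) \<longleftrightarrow> E r b) \<and> (\<forall>(x, y)\<in>p. g x = y)"
    and infinite_verts: "infinite (R \<union> B)"
    and two_red: "\<exists>x\<in>R. \<exists>y\<in>R. x \<noteq> y \<and> \<not> A x y"
    and two_blue: "\<exists>x\<in>B. \<exists>y\<in>B. x \<noteq> y \<and> \<not> A x y"
    and red_split: "x \<in> R \<Longrightarrow> y \<in> R \<Longrightarrow> A x y \<Longrightarrow> \<exists>x\<in>R. \<exists>y\<in>R. \<exists>b\<in>B. A x y \<and> E x b \<noteq> E y b"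
    and blue_split: "x \<in> B \<Longrightarrow> y \<in> B \<Longrightarrow> A x y \<Longrightarrow> \<exists>x\<in>B. \<exists>y\<in>B. \<exists>r\<in>R. A x y \<and> E r x \<noteq> E r y"
begin

text \<open>Homogeneity tests \<open>E\<close> only on pairs of entries listed red first, so
  exchanging the colors amounts to reading the two entries in the other order.\<close>

lemma flip: "bicol B R A (\<lambda>b r. E r b)"
proof (unfold_locales, goal_cases)
  case (6 p)
  have "\<exists>g. bij_betw g R R \<and> bij_betw g B B \<and> (\<forall>x\<in>R \<union> B. \<forall>y\<in>R \<union> B. A (g x) (g y) \<longleftrightarrow> A x y) \<and>
          (\<forall>r\<in>R. \<forall>b\<in>B. E (g r) (g b) \<longleftrightarrow> E r b) \<and> (\<forall>(x, y)\<in>p. g x = y)"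
  proof (rule hom)
    show "finite p" "p \<subseteq> R \<times> R \<union> B \<times> B" using 6 by auto
    fix x y x' y' assume "(x,y) \<in> p" "(x',y') \<in> p"
    then show "(x = x' \<longleftrightarrow> y = y') \<and> (A x x' \<longleftrightarrow> A y y') \<and> (x \<in> R \<longrightarrow> x' \<in> B \<longrightarrow> (E x x' \<longleftrightarrow> E y y'))"
      using 6(3)[of x y x' y'] 6(3)[of x' y' x y] by blast
  qed
  then show ?case by (simp add: Un_commute) blast
next
  case 7 then show ?case using infinite_verts by (simp add: Un_commute)
qed (use disj in blast, fact A_sym, fact A_irr, fact A_trans, use A_col in blast, fact two_blue, fact two_red,
     fact blue_split, fact red_split)

lemma complement: "bicol R B A (\<lambda>r b. \<not> E r b)"
proof (unfold_locales, goal_cases)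
  case (6 p)
  show ?case using hom[of p] 6 by simp
qed (fact disj, fact A_sym, fact A_irr, fact A_trans, fact A_col, fact infinite_verts, fact two_red,
     fact two_blue, use red_split in simp, use blue_split in simp)

section \<open>Automorphisms and transfer by homogeneity\<close>

definition aut :: "('a \<Rightarrow> 'a) \<Rightarrow> bool" where
  "aut g \<longleftrightarrow> bij_betw g R R \<and> bij_betw g B B \<and> (\<forall>x\<in>R \<union> B. \<forall>y\<in>R \<union> B. A (g x) (g y) \<longleftrightarrow> A x y) \<and>
     (\<forall>r\<in>R. \<forall>b\<in>B. E (g r) (g b) \<longleftrightarrow> E r b)"

lemma aut_R: "aut g \<Longrightarrow> r \<in> R \<Longrightarrow> g r \<in> R"
  and aut_B: "aut g \<Longrightarrow> b \<in> B \<Longrightarrow> g b \<in> B"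
  and aut_E: "aut g \<Longrightarrow> r \<in> R \<Longrightarrow> b \<in> B \<Longrightarrow> E (g r) (g b) = E r b"
  and aut_AR: "aut g \<Longrightarrow> r \<in> R \<Longrightarrow> r' \<in> R \<Longrightarrow> A (g r) (g r') = A r r'"
  and aut_AB: "aut g \<Longrightarrow> b \<in> B \<Longrightarrow> b' \<in> B \<Longrightarrow> A (g b) (g b') = A b b'"
  and aut_eqR: "aut g \<Longrightarrow> r \<in> R \<Longrightarrow> r' \<in> R \<Longrightarrow> g r = g r' \<longleftrightarrow> r = r'"
  and aut_eqB: "aut g \<Longrightarrow> b \<in> B \<Longrightarrow> b' \<in> B \<Longrightarrow> g b = g b' \<longleftrightarrow> b = b'"
  by (auto simp: aut_def bij_betw_def inj_on_eq_iff)

lemmas aut_simps = aut_R aut_B aut_E aut_AR aut_AB aut_eqR aut_eqB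

lemma aut_surjB: "aut g \<Longrightarrow> b \<in> B \<Longrightarrow> \<exists>b0\<in>B. b = g b0"
  by (auto simp: aut_def bij_betw_def)

text \<open>A predicate of two truth values lets one transfer serve neighborhoods, differences and
  intersections alike; a single neighborhood is the case \<open>r' = r\<close>.\<close>

lemma aut_image_B:
  assumes "aut g" "r \<in> R" "r' \<in> R"
  shows "{b \<in> B. P (E (g r) b) (E (g r') b)} = g ` {b \<in> B. P (E r b) (E r' b)}"
proof (intro set_eqI iffI)
  fix b assume b: "b \<in> {b \<in> B. P (E (g r) b) (E (g r') b)}"
  then obtain b0 where "b0 \<in> B" "b = g b0" using aut_surjB[OF assms(1)] by blast
  then show "b \<in> g ` {b \<in> B. P (E r b) (E r' b)}" using b assms by (auto simp: aut_simps)
qed (use assms in \<open>auto simp: aut_simps\<close>)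

lemma aut_card_B:
  assumes "aut g" "r \<in> R" "r' \<in> R"
  shows "card {b \<in> B. P (E (g r) b) (E (g r') b)} = card {b \<in> B. P (E r b) (E r' b)}"
    and "finite {b \<in> B. P (E (g r) b) (E (g r') b)} = finite {b \<in> B. P (E r b) (E r' b)}"
proof -
  have "inj_on g {b \<in> B. P (E r b) (E r' b)}"
    using assms by (auto simp: inj_on_def aut_simps)
  then show "card {b \<in> B. P (E (g r) b) (E (g r') b)} = card {b \<in> B. P (E r b) (E r' b)}"
    "finite {b \<in> B. P (E (g r) b) (E (g r') b)} = finite {b \<in> B. P (E r b) (E r' b)}"
    by (simp_all add: aut_image_B[OF assms] card_image finite_image_iff)
qed

lemma hom_pairs:
  assumes "finite p" "p \<subseteq> R \<times> R \<union> B \<times> B"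
    "\<And>x y x' y'. (x, y) \<in> p \<Longrightarrow> (x', y') \<in> p \<Longrightarrow> (x = x' \<longleftrightarrow> y = y') \<and> (A x x' \<longleftrightarrow> A y y') \<and> (x \<in> R \<longrightarrow> x' \<in> B \<longrightarrow> (E x x' \<longleftrightarrow> E y y'))"
  shows "\<exists>g. aut g \<and> (\<forall>(x, y)\<in>p. g x = y)"
proof -
  have "\<exists>g. bij_betw g R R \<and> bij_betw g B B \<and> (\<forall>x\<in>R \<union> B. \<forall>y\<in>R \<union> B. A (g x) (g y) \<longleftrightarrow> A x y) \<and>
          (\<forall>r\<in>R. \<forall>b\<in>B. E (g r) (g b) \<longleftrightarrow> E r b) \<and> (\<forall>(x, y)\<in>p. g x = y)"
    by (rule hom[OF assms])
  then show ?thesis unfolding aut_def by (elim exE, intro exI) (simp only: conj_assoc)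
qed

lemma not_both: "x \<in> R \<Longrightarrow> x \<in> B \<Longrightarrow> False"
  using disj by blast

lemma A_cross: "x \<in> R \<Longrightarrow> y \<in> B \<Longrightarrow> \<not> A x y" "x \<in> R \<Longrightarrow> y \<in> B \<Longrightarrow> \<not> A y x"
  using A_col disj by blast+

lemma A_memR: "A x y \<Longrightarrow> x \<in> R \<Longrightarrow> y \<in> R" "A x y \<Longrightarrow> y \<in> R \<Longrightarrow> x \<in> R"
  and A_memB: "A x y \<Longrightarrow> x \<in> B \<Longrightarrow> y \<in> B" "A x y \<Longrightarrow> y \<in> B \<Longrightarrow> x \<in> B"
  using A_col disj by blast+

lemma hom_red_tuple:
  assumes "finite p" "p \<subseteq> R \<times> R"
    "\<And>x y x' y'. (x, y) \<in> p \<Longrightarrow> (x', y') \<in> p \<Longrightarrow> (x = x' \<longleftrightarrow> y = y') \<and> (A x x' \<longleftrightarrow> A y y')"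
  shows "\<exists>g. aut g \<and> (\<forall>(x, y)\<in>p. g x = y)"
proof (rule hom_pairs)
  show "p \<subseteq> R \<times> R \<union> B \<times> B" using assms by blast
  fix x y x' y' assume p: "(x, y) \<in> p" "(x', y') \<in> p"
  then have "x' \<notin> B" using assms(2) disj by blast
  then show "(x = x' \<longleftrightarrow> y = y') \<and> (A x x' \<longleftrightarrow> A y y') \<and> (x \<in> R \<longrightarrow> x' \<in> B \<longrightarrow> (E x x' \<longleftrightarrow> E y y'))"
    using assms(3)[OF p] by simp
qed (fact assms(1))

text \<open>All entries but one are blue, so the cross conditions reduce to those with the single
  red vertex.\<close>

lemma hom_red_blues:
  assumes "r \<in> R" "r' \<in> R" "finite Y" "Y \<subseteq> B" "h ` Y \<subseteq> B" "inj_on h Y"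
    "\<And>x y. x \<in> Y \<Longrightarrow> y \<in> Y \<Longrightarrow> A (h x) (h y) = A x y"
    "\<And>y. y \<in> Y \<Longrightarrow> E r' (h y) = E r y"
  obtains g where "aut g" "g r = r'" "\<And>y. y \<in> Y \<Longrightarrow> g y = h y"
proof -
  let ?p = "insert (r, r') ((\<lambda>y. (y, h y)) ` Y)"
  have "\<exists>g. aut g \<and> (\<forall>(x, y)\<in>?p. g x = y)"
  proof (rule hom_pairs)
    show "finite ?p" "?p \<subseteq> R \<times> R \<union> B \<times> B" using assms by auto
    have *: "\<And>y. y \<in> Y \<Longrightarrow> y \<in> B \<and> h y \<in> B \<and> y \<notin> R \<and> h y \<notin> R"
      using assms(4,5) disj by blast
    show "(x = x' \<longleftrightarrow> y = y') \<and> (A x x' \<longleftrightarrow> A y y') \<and> (x \<in> R \<longrightarrow> x' \<in> B \<longrightarrow> (E x x' \<longleftrightarrow> E y y'))" if "(x, y) \<in> ?p" "(x', y') \<in> ?p" for x y x' y'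
      using that assms(1,2,6,7,8) * not_both[of r] by (auto simp: A_cross A_irr inj_on_eq_iff)
  qed
  then show ?thesis using that by auto
qed

lemma hom_blues:
  assumes "finite Y" "Y \<subseteq> B" "h ` Y \<subseteq> B" "inj_on h Y"
    "\<And>x y. x \<in> Y \<Longrightarrow> y \<in> Y \<Longrightarrow> A (h x) (h y) = A x y"
  obtains g where "aut g" "\<And>y. y \<in> Y \<Longrightarrow> g y = h y"
proof -
  let ?p = "(\<lambda>y. (y, h y)) ` Y"
  have "\<exists>g. aut g \<and> (\<forall>(x, y)\<in>?p. g x = y)"
  proof (rule hom_pairs)
    show "finite ?p" "?p \<subseteq> R \<times> R \<union> B \<times> B" using assms by auto
    have *: "\<And>y. y \<in> Y \<Longrightarrow> y \<in> B \<and> h y \<in> B \<and> y \<notin> R \<and> h y \<notin> R"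
      using assms(2,3) disj by blast
    show "(x = x' \<longleftrightarrow> y = y') \<and> (A x x' \<longleftrightarrow> A y y') \<and> (x \<in> R \<longrightarrow> x' \<in> B \<longrightarrow> (E x x' \<longleftrightarrow> E y y'))" if "(x, y) \<in> ?p" "(x', y') \<in> ?p" for x y x' y'
      using that assms(4,5) * by (auto simp: A_cross A_irr inj_on_eq_iff)
  qed
  then show ?thesis using that by auto
qed

text \<open>This turns a property of one ordered red edge into a property of all of them.\<close>

lemma edge_transfer:
  assumes "A r r'" "A s s'" "r \<in> R" "s \<in> R"
  obtains g where "aut g" "g r = s" "g r' = s'"
proof -
  have "\<exists>g. aut g \<and> (\<forall>(x, y)\<in>{(r,s),(r',s')}. g x = y)"
    by (rule hom_red_tuple)
      (use assms A_memR(1)[OF assms(1,3)] A_memR(1)[OF assms(2,4)] A_irr A_sym[OF assms(1)] A_sym[OF assms(2)] in auto)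
  then show ?thesis using that by auto
qed

lemma nonadjacent_exists: "r \<in> R \<Longrightarrow> \<exists>s\<in>R. s \<noteq> r \<and> \<not> A r s \<and> \<not> A s r"
  using two_red A_trans A_sym by metis

lemma mate_exists:
  assumes "A x y" "x \<in> R" "r \<in> R" shows "\<exists>s\<in>R. A r s"
proof -
  have "\<exists>g. aut g \<and> (\<forall>(x, y)\<in>{(x,r)}. g x = y)"
    by (rule hom_red_tuple) (use assms A_irr in auto)
  then show ?thesis using assms aut_AR A_memR aut_R by fastforce
qed

text \<open>The hypothesis \<open>red_split\<close> supplies only some separated red edge.
  Transitivity on ordered edges carries it to every red edge, and reversing the edge supplies the
  wanted direction.\<close>

lemma edge_split:
  assumes "A r r'" "r \<in> R"
  shows "\<exists>b\<in>B. E r b \<and> \<not> E r' b"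
proof -
  obtain x y b where xy: "x \<in> R" "y \<in> R" "b \<in> B" "A x y" "E x b \<noteq> E y b"
    using red_split[OF assms(2) A_memR(1)[OF assms] assms(1)] by blast
  have *: "\<exists>b\<in>B. E r b \<and> \<not> E r' b" if uv: "A u v" "u \<in> R" "E u b" "\<not> E v b" for u v
  proof -
    obtain g where g: "aut g" "g u = r" "g v = r'" using edge_transfer[OF uv(1) assms(1) uv(2) assms(2)] .
    have "E r (g b)" "\<not> E r' (g b)"
      using uv xy(3) aut_E[OF g(1), of u b] aut_E[OF g(1), of v b] A_memR(1)[OF uv(1,2)] g by auto
    then show ?thesis using aut_B[OF g(1) xy(3)] by blast
  qed
  show ?thesis using *[of x y] *[of y x] xy A_sym[of x y] by blast
qed

text \<open>If \<open>r\<close> and \<open>s\<close> had the same blue neighbors, moving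
  \<open>r\<close> to a clique mate \<open>t\<close> with \<open>s\<close> fixed would give
  \<open>t\<close> the same neighbors as \<open>s\<close>, hence as \<open>r\<close>, against
  \<open>edge_split\<close>. Exchanging \<open>r\<close> and \<open>s\<close> then yields the
  required direction.\<close>

lemma nonedge_split:
  assumes "A x y" "x \<in> R" and rs: "r \<in> R" "s \<in> R" "r \<noteq> s" "\<not> A r s"
  shows "\<exists>b\<in>B. E r b \<and> \<not> E s b"
proof -
  have neq: "\<exists>b\<in>B. E r b \<noteq> E s b"
  proof (rule ccontr)
    assume c: "\<not> ?thesis"
    obtain t where t: "t \<in> R" "A r t" using mate_exists[OF assms(1,2) rs(1)] by blast
    have nt: "t \<noteq> s" "\<not> A t s" "\<not> A s t" "\<not> A s r"
      using t rs A_sym A_trans by metis+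
    have "\<exists>g. aut g \<and> (\<forall>(x, y)\<in>{(r,t),(s,s)}. g x = y)"
      by (rule hom_red_tuple) (use nt rs t A_irr in auto)
    then obtain g where g: "aut g" "g r = t" "g s = s" by auto
    have "E t b = E s b" if b: "b \<in> B" for b
    proof -
      obtain b0 where b0: "b0 \<in> B" "b = g b0" using aut_surjB[OF g(1) b] by blast
      then show ?thesis using c aut_E[OF g(1), of r b0] aut_E[OF g(1), of s b0] rs g by auto
    qed
    then show False using c edge_split[OF t(2) rs(1)] by metis
  qed
  then obtain b where b: "b \<in> B" "E r b \<noteq> E s b" by blast
  have "\<exists>g. aut g \<and> (\<forall>(x, y)\<in>{(r,s),(s,r)}. g x = y)"
    by (rule hom_red_tuple) (use rs A_irr A_sym[of s r] in auto)
  then obtain g where g: "aut g" "g r = s" "g s = r" by auto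
  have "E s (g b) = E r b" "E r (g b) = E s b" "g b \<in> B"
    using b aut_E[OF g(1), of r b] aut_E[OF g(1), of s b] rs g aut_B[OF g(1)] by auto
  then show ?thesis using b by blast
qed

text \<open>Red vertices have pairwise distinct blue neighborhoods, so a finite \<open>B\<close>
  would leave only finitely many of them.\<close>

lemma infinite_B:
  assumes "A x y" "x \<in> R"
  shows "infinite B"
proof
  assume f: "finite B"
  have "inj_on (\<lambda>r. {b \<in> B. E r b}) R"
  proof (rule inj_onI, rule ccontr)
    fix r s assume rs: "r \<in> R" "s \<in> R" "{b \<in> B. E r b} = {b \<in> B. E s b}" "r \<noteq> s"
    then show False using edge_split[of r s] nonedge_split[OF assms, of r s] by blast
  qed
  moreover have "(\<lambda>r. {b \<in> B. E r b}) ` R \<subseteq> Pow B" by auto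
  ultimately have "finite R" using f by (meson finite_Pow_iff finite_imageD finite_subset)
  then show False using f infinite_verts by simp
qed

section \<open>Prescribed traces on finitely many cliques\<close>

text \<open>\<open>X\<close> meets infinitely many cliques.\<close>

definition spread :: "'a set \<Rightarrow> bool" where
  "spread X \<longleftrightarrow> (\<forall>F. finite F \<longrightarrow> (\<exists>b\<in>X. b \<notin> F \<and> (\<forall>d\<in>F. \<not> A b d)))"

lemma spreadD: "spread X \<Longrightarrow> finite F \<Longrightarrow> \<exists>b\<in>X. b \<notin> F \<and> (\<forall>d\<in>F. \<not> A b d)"
  unfolding spread_def by blast

lemma spread_mono: "spread X \<Longrightarrow> X \<subseteq> Y \<Longrightarrow> spread Y"
  unfolding spread_def by blast

text \<open>The choice is greedy: at each stage only finitely many vertices and their cliques are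
  forbidden, and a spread set leaves them.\<close>

lemma choose_spread:
  assumes "finite C" "\<And>c. c \<in> C \<Longrightarrow> spread (X c)" "finite F"
  shows "\<exists>h. (\<forall>c\<in>C. h c \<in> X c \<and> h c \<notin> F \<and> (\<forall>d\<in>F. \<not> A (h c) d)) \<and>
    (\<forall>c\<in>C. \<forall>d\<in>C. \<not> A (h c) (h d)) \<and> inj_on h C"
  using assms(1,2)
proof (induction C)
  case empty
  then show ?case by simp
next
  case (insert c C)
  then obtain h where h: "\<forall>c\<in>C. h c \<in> X c \<and> h c \<notin> F \<and> (\<forall>d\<in>F. \<not> A (h c) d)"
    "\<forall>c\<in>C. \<forall>d\<in>C. \<not> A (h c) (h d)" "inj_on h C" by auto
  have "finite (F \<union> h ` C)" using assms insert by simp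
  then obtain b where b: "b \<in> X c" "b \<notin> F \<union> h ` C" "\<And>d. d\<in>F \<union> h ` C \<Longrightarrow> \<not> A b d"
    using insert.prems[of c] unfolding spread_def by (metis insertI1)
  have *: "\<And>d. d \<in> C \<Longrightarrow> d \<noteq> c" using insert by auto
  have **: "\<And>d. d \<in> C \<Longrightarrow> \<not> A (h d) b \<and> \<not> A b (h d) \<and> h d \<noteq> b"
    using b A_sym by blast
  show ?case
    by (rule exI[of _ "h(c := b)"])
      (use h b A_irr insert.hyps * ** in \<open>auto simp: inj_on_def\<close>)
qed

text \<open>The set \<open>C\<close> has at most one vertex per clique because, when both classes
  have edges, two red mates that are compared on one vertex of a blue clique turn out to be
  determined relative to each other on all of it.\<close>

definition ext_same :: bool where
  "ext_same \<longleftrightarrow> (\<forall>r0\<in>R. \<forall>C U. finite C \<and> C \<subseteq> B \<and> (\<forall>c\<in>C. \<forall>d\<in>C. \<not> A c d) \<longrightarrow>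
     (\<exists>r\<in>R. A r0 r \<and> (\<forall>c\<in>C. E r c \<longleftrightarrow> c \<in> U)))"

text \<open>For a mate \<open>r\<close> of \<open>r0\<close>, every \<open>c\<close> in
  \<open>C\<close> gets a stand-in to which \<open>r0\<close> relates as to \<open>c\<close>, and
  \<open>r\<close> as prescribed for \<open>c\<close>. An automorphism fixing \<open>r0\<close>
  moves the stand-ins to \<open>C\<close>, and \<open>r\<close> to the wanted vertex.\<close>

lemma ext_sameI:
  assumes e: "A x y" "x \<in> R"
    and sp: "\<And>r r' t u. r \<in> R \<Longrightarrow> A r r' \<Longrightarrow> spread {b \<in> B. E r b = t \<and> E r' b = u}"
  shows ext_same
  unfolding ext_same_def
proof (intro ballI allI impI)
  fix r0 C U assume r0: "r0 \<in> R" and C: "finite C \<and> C \<subseteq> B \<and> (\<forall>c\<in>C. \<forall>d\<in>C. \<not> A c d)"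
  obtain r where r: "r \<in> R" "A r0 r" using mate_exists[OF e r0] by blast
  obtain h where h: "\<forall>c\<in>C. h c \<in> B \<and> E r0 (h c) = E r0 c \<and> E r (h c) = (c \<in> U)"
    "\<forall>c\<in>C. \<forall>d\<in>C. \<not> A (h c) (h d)" "inj_on h C"
    using choose_spread[of C "\<lambda>c. {b \<in> B. E r0 b = E r0 c \<and> E r b = (c \<in> U)}" "{}"]
      C sp[OF r0 r(2)] by auto
  define k where "k = inv_into C h"
  have k: "k (h c) = c" if "c \<in> C" for c using h(3) that by (simp add: k_def)
  obtain g where g: "aut g" "g r0 = r0" "\<And>y. y \<in> h ` C \<Longrightarrow> g y = k y"
    apply (rule hom_red_blues[of r0 r0 "h ` C" k])
    using r0 C h k by (auto simp: inj_on_def)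
  have gc: "g (h c) = c" if "c \<in> C" for c using g(3) k that by auto
  show "\<exists>r\<in>R. A r0 r \<and> (\<forall>c\<in>C. E r c \<longleftrightarrow> c \<in> U)"
  proof (intro bexI conjI ballI)
    show "g r \<in> R" using g r aut_R by blast
    show "A r0 (g r)" using g r r0 aut_AR[OF g(1), of r0 r] by simp
    fix c assume c: "c \<in> C"
    show "E (g r) c = (c \<in> U)" using aut_E[OF g(1) r(1), of "h c"] bspec[OF h(1) c] gc[OF c] by simp
  qed
qed

text \<open>As in \<open>ext_sameI\<close>, but no red vertex stays fixed, so the stand-ins only
  have to relate correctly to one red vertex.\<close>

lemma generic_red:
  assumes sp: "\<And>r t. r \<in> R \<Longrightarrow> spread {b \<in> B. E r b = t}"
    and C: "finite C" "C \<subseteq> B" "\<forall>c\<in>C. \<forall>d\<in>C. \<not> A c d"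
  shows "\<exists>r\<in>R. \<forall>c\<in>C. E r c \<longleftrightarrow> c \<in> U"
proof -
  obtain r where r: "r \<in> R" using two_red by blast
  obtain h where h: "\<forall>c\<in>C. h c \<in> B \<and> E r (h c) = (c \<in> U)"
    "\<forall>c\<in>C. \<forall>d\<in>C. \<not> A (h c) (h d)" "inj_on h C"
    using choose_spread[of C "\<lambda>c. {b \<in> B. E r b = (c \<in> U)}" "{}"]
      C sp[OF r] by auto
  define k where "k = inv_into C h"
  have k: "k (h c) = c" if "c \<in> C" for c using h(3) that by (simp add: k_def)
  obtain g where g: "aut g" "\<And>y. y \<in> h ` C \<Longrightarrow> g y = k y"
    apply (rule hom_blues[of "h ` C" k])
    using C h k by (auto simp: inj_on_def)
  have gc: "g (h c) = c" if "c \<in> C" for c using g(2) k that by auto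
  show ?thesis
  proof (intro bexI ballI)
    show "g r \<in> R" using g r aut_R by blast
    fix c assume c: "c \<in> C"
    show "E (g r) c = (c \<in> U)" using aut_E[OF g(1) r(1), of "h c"] bspec[OF h(1) c] gc[OF c] by simp
  qed
qed

text \<open>Each vertex to be avoided costs one more blue vertex, taken from a clique away from
  \<open>C\<close>, on which the new vertex is required to differ from it.\<close>

lemma generic_red_avoid:
  assumes sp: "\<And>r t. r \<in> R \<Longrightarrow> spread {b \<in> B. E r b = t}"
    and C: "finite C" "C \<subseteq> B" "\<forall>c\<in>C. \<forall>d\<in>C. \<not> A c d" and X: "finite X"
  shows "\<exists>r\<in>R. r \<notin> X \<and> (\<forall>c\<in>C. E r c \<longleftrightarrow> c \<in> U)"
  using X C
proof (induction X arbitrary: C U)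
  case empty
  then show ?case using generic_red[OF sp] by auto
next
  case (insert s X)
  obtain r0 where "r0 \<in> R" using two_red by blast
  then have "spread B" using sp[of r0 True] spread_mono by blast
  then obtain c where c: "c \<in> B" "c \<notin> C" "\<forall>d\<in>C. \<not> A c d"
    using spreadD[OF _ insert.prems(1)] by blast
  have "\<exists>r\<in>R. r \<notin> X \<and> (\<forall>d\<in>insert c C. E r d \<longleftrightarrow> d \<in> (if E s c then U - {c} else insert c U))"
  proof (rule insert.IH)
    show "\<forall>x\<in>insert c C. \<forall>d\<in>insert c C. \<not> A x d"
      using insert.prems(3) c(3) A_irr A_sym[of _ c] by blast
  qed (use insert.prems c in auto)
  then show ?case using c by (auto split: if_splits)
qed

text \<open>The device of \<open>generic_red_avoid\<close>, carried out inside the clique of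
  \<open>r0\<close>.\<close>

lemma ext_same_avoid:
  assumes ext_same "spread B" "r0 \<in> R"
    and C: "finite C" "C \<subseteq> B" "\<forall>c\<in>C. \<forall>d\<in>C. \<not> A c d" and X: "finite X"
  shows "\<exists>r\<in>R. A r0 r \<and> r \<notin> X \<and> (\<forall>c\<in>C. E r c \<longleftrightarrow> c \<in> U)"
  using X C
proof (induction X arbitrary: C U)
  case empty
  then show ?case using assms(1,3) unfolding ext_same_def by auto
next
  case (insert s X)
  obtain c where c: "c \<in> B" "c \<notin> C" "\<forall>d\<in>C. \<not> A c d"
    using spreadD[OF assms(2) insert.prems(1)] by blast
  have "\<exists>r\<in>R. A r0 r \<and> r \<notin> X \<and> (\<forall>d\<in>insert c C. E r d \<longleftrightarrow> d \<in> (if E s c then U - {c} else insert c U))"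
  proof (rule insert.IH)
    show "\<forall>x\<in>insert c C. \<forall>d\<in>insert c C. \<not> A x d"
      using insert.prems(3) c(3) A_irr A_sym[of _ c] by blast
  qed (use insert.prems c in auto)
  then show ?case using c by (auto split: if_splits)
qed

end

section \<open>One color class independent\<close>

locale bicol_one = bicol +
  assumes red_edge: "\<exists>x\<in>R. \<exists>y\<in>R. A x y"
    and blue_indep: "b \<in> B \<Longrightarrow> b' \<in> B \<Longrightarrow> \<not> A b b'"
begin

lemma complement_one: "bicol_one R B A (\<lambda>r b. \<not> E r b)"
proof -
  interpret c: bicol R B A "\<lambda>r b. \<not> E r b" by (rule complement)
  show ?thesis by unfold_locales (use red_edge blue_indep in blast)+
qed

lemma spread_iff_infinite: "X \<subseteq> B \<Longrightarrow> spread X \<longleftrightarrow> infinite X"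
proof
  assume X: "X \<subseteq> B" "infinite X"
  show "spread X" unfolding spread_def
  proof (intro allI impI)
    fix F :: "'a set" assume "finite F"
    then obtain b where b: "b \<in> X" "b \<notin> F" using X(2) by (meson finite_subset subsetI)
    then have "\<forall>d\<in>F. \<not> A b d" using blue_indep A_memB X(1) by blast
    then show "\<exists>b\<in>X. b \<notin> F \<and> (\<forall>d\<in>F. \<not> A b d)" using b by blast
  qed
next
  assume "spread X" then show "infinite X" unfolding spread_def by blast
qed

lemma infinite_blue: "infinite B"
  using infinite_B red_edge by blast

lemma edge_at: "r \<in> R \<Longrightarrow> \<exists>s\<in>R. A r s"
  using mate_exists red_edge by blast

text \<open>Suppose one red vertex, hence every one, has finitely many neighbors, and let
  \<open>r\<close> lie outside the clique of \<open>s\<close>. Some mate of \<open>s\<close> meets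
  the set of neighbors of \<open>r\<close> that are not neighbors of \<open>s\<close>, and another
  mate avoids this set. Over \<open>r\<close> and \<open>s\<close> both mates have the same type, so
  an automorphism takes one to the other, a contradiction.\<close>

lemma infinite_nbrs:
  assumes s: "s \<in> R"
  shows "infinite {b \<in> B. E s b}"
proof
  assume fin: "finite {b \<in> B. E s b}"
  have fin': "finite {b \<in> B. E t b}" if t: "t \<in> R" for t
  proof -
    have "\<exists>g. aut g \<and> (\<forall>(x, y)\<in>{(s,t)}. g x = y)"
      by (rule hom_red_tuple) (use s t A_irr in auto)
    then obtain g where "aut g" "g s = t" by auto
    then show ?thesis using aut_card_B(2)[of g s s "\<lambda>a b. a"] s fin by simp
  qed
  obtain r where r: "r \<in> R" "r \<noteq> s" "\<not> A r s" "\<not> A s r" using nonadjacent_exists[OF s] by blast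
  obtain s' where s': "s' \<in> R" "A s s'" using edge_at[OF s] by blast
  obtain e1 e2 where e: "e1 \<in> R" "A e1 e2" using red_edge by blast
  obtain x where x: "x \<in> B" "E r x" "\<not> E s x" using nonedge_split[OF e(2,1) r(1) s r(2,3)] by blast
  obtain y where y: "y \<in> B" "E s' y" "\<not> E s y" using edge_split[OF A_sym[OF s'(2)] s'(1)] by blast
  have neR: "r \<noteq> t \<and> \<not> A r t \<and> \<not> A t r" if "A s t" for t
    using that r A_sym A_trans by metis
  \<comment> \<open>First mate: \<open>y\<close> and \<open>x\<close> are both non-neighbors of
    \<open>s\<close>, so \<open>s\<close> can stay fixed while \<open>g s'\<close> becomes adjacent
    to \<open>x\<close>.\<close>
  obtain g where g: "aut g" "g s = s" "g y = x"
    using hom_red_blues[of s s "{y}" "\<lambda>_. x"] s x y A_irr by auto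
  let ?s2 = "g s'"
  have s2: "?s2 \<in> R" "A s ?s2" "E ?s2 x"
    using aut_R[OF g(1) s'(1)] aut_AR[OF g(1) s s'(1)] aut_E[OF g(1) s'(1) y(1)] g s' y by auto
  \<comment> \<open>Second mate: neighbors of \<open>s'\<close> shared with \<open>s\<close> stay in
    place. The finitely many others are sent off the neighborhoods of \<open>s\<close> and
    \<open>r\<close>, which leave infinitely many blue vertices.\<close>
  obtain h where h: "\<forall>c\<in>{b \<in> B. E s' b}. h c \<in> (if E s c then {c} else B - {b \<in> B. E s b} - {b \<in> B. E r b})"
    "inj_on h {b \<in> B. E s' b}"
  proof -
    have "infinite (B - {b \<in> B. E s b} - {b \<in> B. E r b})"
      using infinite_blue fin'[OF r(1)] fin by simp
    then have "spread (B - {b \<in> B. E s b} - {b \<in> B. E r b})" by (subst spread_iff_infinite) auto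
    then obtain h where h: "\<forall>c\<in>{b \<in> B. E s' b}. h c \<in> B - {b \<in> B. E s b} - {b \<in> B. E r b}" "inj_on h {b \<in> B. E s' b}"
      using choose_spread[of "{b \<in> B. E s' b}" "\<lambda>_. B - {b \<in> B. E s b} - {b \<in> B. E r b}" "{}"] fin'[OF s'(1)] by auto
    show ?thesis
      by (rule that[of "\<lambda>c. if E s c then c else h c"]) (use h in \<open>auto simp: inj_on_def\<close>)
  qed
  have h': "h c \<in> B \<and> (E s (h c) \<longleftrightarrow> E s c)" if "c \<in> B" "E s' c" for c
    using bspec[OF h(1), of c] that by (auto split: if_splits)
  obtain g' where g': "aut g'" "g' s = s" "\<And>c. c \<in> {b \<in> B. E s' b} \<Longrightarrow> g' c = h c"
    by (rule hom_red_blues[of s s "{b \<in> B. E s' b}" h]) (use s h h' fin'[OF s'(1)] blue_indep in auto)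
  let ?s1 = "g' s'"
  have s1: "?s1 \<in> R" "A s ?s1"
    using aut_R[OF g'(1) s'(1)] aut_AR[OF g'(1) s s'(1)] g' s' by auto
  \<comment> \<open>The tuple is entirely red, so only equality and adjacency within red have to
    match.\<close>
  have "\<exists>k. aut k \<and> (\<forall>(x, y)\<in>{(r,r),(s,s),(?s2,?s1)}. k x = y)"
    by (rule hom_red_tuple)
      (use r s s1 s2 A_irr A_sym[OF s1(2)] A_sym[OF s2(2)] neR[OF s1(2)] neR[OF s2(2)] in auto)
  then obtain k where k: "aut k" "k r = r" "k s = s" "k ?s2 = ?s1" by auto
  have kx: "k x \<in> B" "E r (k x)" "\<not> E s (k x)" "E ?s1 (k x)"
    using aut_B[OF k(1) x(1)] aut_E[OF k(1) r(1) x(1)] aut_E[OF k(1) s x(1)] aut_E[OF k(1) s2(1) x(1)] k x s2 by auto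
  obtain c where c: "c \<in> B" "k x = g' c" using aut_surjB[OF g'(1) kx(1)] by blast
  have "E s' c" using aut_E[OF g'(1) s'(1) c(1)] kx c by simp
  then show False using bspec[OF h(1), of c] g'(3)[of c] c kx by (auto split: if_splits)
qed

lemma infinite_non_nbrs: "s \<in> R \<Longrightarrow> infinite {b \<in> B. \<not> E s b}"
  using bicol_one.infinite_nbrs[OF complement_one] by simp

lemma infinite_half: "s \<in> R \<Longrightarrow> infinite {b \<in> B. E s b = t}"
  using infinite_nbrs[of s] infinite_non_nbrs[of s] by (cases t) auto

text \<open>The argument of \<open>infinite_nbrs\<close> again. The set on which \<open>s\<close>
  and \<open>s'\<close> differ takes the place of a neighborhood, and the same set for an edge
  \<open>r r'\<close> of another red clique is the one to be met or avoided.\<close>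

lemma infinite_split:
  assumes s: "s \<in> R" "A s s'"
  shows "infinite {b \<in> B. E s b \<noteq> E s' b}"
proof
  assume fin: "finite {b \<in> B. E s b \<noteq> E s' b}" (is "finite ?D")
  have fin': "finite {b \<in> B. E t b \<noteq> E t' b}" if t: "t \<in> R" "A t t'" for t t'
  proof -
    obtain g where "aut g" "g s = t" "g s' = t'" using edge_transfer[OF s(2) t(2) s(1) t(1)] .
    then show ?thesis using aut_card_B(2)[of g s s' "\<lambda>a b. a \<noteq> b"] s A_memR fin by simp
  qed
  have s'R: "s' \<in> R" using s A_memR by blast
  obtain r where r: "r \<in> R" "r \<noteq> s" "\<not> A r s" "\<not> A s r" using nonadjacent_exists[OF s(1)] by blast
  obtain r' where r': "r' \<in> R" "A r r'" using edge_at[OF r(1)] by blast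
  let ?F = "{b \<in> B. E r b \<noteq> E r' b}"
  obtain x where x: "x \<in> ?F" using edge_split[OF r'(2) r(1)] by blast
  \<comment> \<open>Both directions of the difference occur, so \<open>y\<close> can be chosen to
    relate to \<open>s\<close> as \<open>x\<close> does; then \<open>y\<close> can be moved to
    \<open>x\<close> with \<open>s\<close> fixed.\<close>
  obtain y where y: "y \<in> ?D" "E s y = E s x"
    using edge_split[OF s(2,1)] edge_split[OF A_sym[OF s(2)] s'R] by blast
  obtain g where g: "aut g" "g s = s" "g y = x"
    using hom_red_blues[of s s "{y}" "\<lambda>_. x"] s x y A_irr by auto
  let ?s2 = "g s'"
  have s2: "?s2 \<in> R" "A s ?s2" "E ?s2 x \<noteq> E s x"
    using aut_R[OF g(1) s'R] aut_AR[OF g(1) s(1) s'R] aut_E[OF g(1) s'R, of y] g s y by auto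
  \<comment> \<open>The differences are moved off \<open>?F\<close> while their relation to
    \<open>s\<close> is kept, for which \<open>infinite_half\<close> provides enough room.\<close>
  obtain h where h: "\<forall>c\<in>?D. h c \<in> {b \<in> B. E s b = E s c} \<and> h c \<notin> ?F" "inj_on h ?D"
  proof -
    have "spread {b \<in> B. E s b = t}" for t
      by (subst spread_iff_infinite) (use infinite_half[OF s(1)] in auto)
    then show ?thesis using that
        choose_spread[of ?D "\<lambda>c. {b \<in> B. E s b = E s c}" ?F] fin fin'[OF r(1) r'(2)] by blast
  qed
  obtain g' where g': "aut g'" "g' s = s" "\<And>c. c \<in> ?D \<Longrightarrow> g' c = h c"
    by (rule hom_red_blues[of s s ?D h]) (use s h fin blue_indep in auto)
  let ?s1 = "g' s'"
  have s1: "?s1 \<in> R" "A s ?s1"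
    using aut_R[OF g'(1) s'R] aut_AR[OF g'(1) s(1) s'R] g' s by auto
  have neR: "u \<noteq> t \<and> \<not> A u t \<and> \<not> A t u" if "A s t" "u = r \<or> u = r'" for t u
    using that r r' A_sym A_trans by metis
  have nes: "r' \<noteq> s" "\<not> A r' s" "\<not> A s r'" using r r' A_sym A_trans by metis+
  have "\<exists>k. aut k \<and> (\<forall>(x, y)\<in>{(r,r),(r',r'),(s,s),(?s2,?s1)}. k x = y)"
    by (rule hom_red_tuple)
      (use r r' s s1 s2 A_irr A_sym[OF s1(2)] A_sym[OF s2(2)] neR[OF s1(2)] neR[OF s2(2)] nes in auto)
  then obtain k where k: "aut k" "k r = r" "k r' = r'" "k s = s" "k ?s2 = ?s1" by auto
  have xB: "x \<in> B" using x by simp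
  have kx: "k x \<in> B" "E r (k x) \<noteq> E r' (k x)" "E ?s1 (k x) \<noteq> E s (k x)"
    using aut_B[OF k(1) xB] aut_E[OF k(1) r(1) xB] aut_E[OF k(1) r'(1) xB] aut_E[OF k(1) s(1) xB]
      aut_E[OF k(1) s2(1) xB] k x s2 by auto
  obtain c where c: "c \<in> B" "k x = g' c" using aut_surjB[OF g'(1) kx(1)] by blast
  have "E s' c \<noteq> E s c" using aut_E[OF g'(1) s'R c(1)] aut_E[OF g'(1) s(1) c(1)] g' kx c by simp
  then show False using bspec[OF h(1), of c] g'(3)[of c] c kx by auto
qed

text \<open>Reversing the edge exchanges the two halves of the difference set, so if one were finite
  both would be.\<close>

lemma infinite_only:
  assumes s: "s \<in> R" "A s s'"
  shows "infinite {b \<in> B. E s b \<and> \<not> E s' b}" (is "infinite ?X")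
proof
  assume fin: "finite ?X"
  have s'R: "s' \<in> R" using s A_memR by blast
  obtain g where g: "aut g" "g s = s'" "g s' = s" using edge_transfer[OF s(2) A_sym[OF s(2)] s(1) s'R] .
  have "finite {b \<in> B. E s' b \<and> \<not> E s b}"
    using aut_card_B(2)[OF g(1) s(1) s'R, of "\<lambda>a b. a \<and> \<not> b"] fin g by simp
  moreover have "{b \<in> B. E s b \<noteq> E s' b} = ?X \<union> {b \<in> B. E s' b \<and> \<not> E s b}" by auto
  ultimately show False using fin infinite_split[OF s] by simp
qed

text \<open>If the number of common neighbors is finite, it is the same for all red edges. Fix
  \<open>r\<close> and a large set \<open>L\<close> of neighbors of \<open>r'\<close> outside those
  of \<open>r\<close>, and move one further such neighbor \<open>c\<close> to \<open>d\<close>. Then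
  \<open>r'\<close> goes to another mate \<open>?t\<close> of \<open>r\<close>, and the edge between
  \<open>r'\<close> and \<open>?t\<close> has all of \<open>L\<close> as common neighbors, which is
  too many.\<close>

lemma infinite_common_nbrs:
  assumes s: "r \<in> R" "A r r'" and d: "d \<in> B" "\<not> E r d" "\<not> E r' d"
  shows "infinite {b \<in> B. E r b \<and> E r' b}"
proof
  assume fin: "finite {b \<in> B. E r b \<and> E r' b}" (is "finite ?X")
  have r'R: "r' \<in> R" using s A_memR by blast
  have tr: "finite {b \<in> B. E t b \<and> E t' b} \<and> card {b \<in> B. E t b \<and> E t' b} = card ?X"
    if t: "t \<in> R" "A t t'" for t t'
  proof -
    obtain g where "aut g" "g r = t" "g r' = t'" using edge_transfer[OF s(2) t(2) s(1) t(1)] .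
    then show ?thesis
      using aut_card_B[of g r r' "\<lambda>a b. a \<and> b"] s A_memR fin by simp
  qed
  have "infinite {b \<in> B. E r' b \<and> \<not> E r b}" using infinite_only[OF r'R A_sym[OF s(2)]] .
  \<comment> \<open>One vertex is spent as \<open>c\<close>; the remaining \<open>L\<close> must
    still exceed the common count by one.\<close>
  then obtain L0 where L0: "L0 \<subseteq> {b \<in> B. E r' b \<and> \<not> E r b}" "card L0 = Suc (Suc (card ?X))" "finite L0"
    using infinite_arbitrarily_large by blast
  then obtain c where c: "c \<in> L0" by fastforce
  define L where "L = L0 - {c}"
  have L: "L \<subseteq> {b \<in> B. E r' b \<and> \<not> E r b}" "card L = Suc (card ?X)" "finite L" "c \<notin> L"
    using L0 c by (auto simp: L_def)
  have dL: "d \<notin> L" "d \<noteq> c" using d L c L0 by auto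
  have LB: "\<And>x. x \<in> L \<Longrightarrow> x \<in> B" "c \<in> B" using L L0 c by auto
  obtain g where g: "aut g" "g r = r" "\<And>y. y \<in> insert c L \<Longrightarrow> g y = (if y = c then d else y)"
    by (rule hom_red_blues[of r r "insert c L" "\<lambda>y. if y = c then d else y"])
      (use s L L0 c d dL LB blue_indep in \<open>auto simp: inj_on_def\<close>)
  let ?t = "g r'"
  have t: "?t \<in> R" "A r ?t" using aut_R[OF g(1) r'R] aut_AR[OF g(1) s(1) r'R] g s by auto
  have cB: "c \<in> B" "E r' c" using c L0 by auto
  have "E ?t d" using aut_E[OF g(1) r'R cB(1)] g(3)[of c] cB by simp
  then have "?t \<noteq> r'" using d by auto
  then have At: "A r' ?t" using A_trans[OF A_sym[OF s(2)] t(2)] by simp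
  have "L \<subseteq> {b \<in> B. E r' b \<and> E ?t b}"
  proof
    fix l assume l: "l \<in> L"
    then have "l \<in> B" "E r' l" "l \<noteq> c" using L by auto
    then show "l \<in> {b \<in> B. E r' b \<and> E ?t b}" using aut_E[OF g(1) r'R, of l] g(3)[of l] l by simp
  qed
  then have "card L \<le> card {b \<in> B. E r' b \<and> E ?t b}" using tr[OF r'R At] card_mono by blast
  then show False using tr[OF r'R At] L by simp
qed

text \<open>One blue vertex on which some red edge agrees is enough:
  \<open>infinite_common_nbrs\<close> and its complement turn an agreement of one kind into
  infinitely many of the other kind, and these back into infinitely many of the first. Together with
  \<open>infinite_only\<close> all four patterns are infinite.\<close>

theorem dichotomy_one:
  "(\<forall>r\<in>R. \<forall>r'. A r r' \<longrightarrow> (\<forall>b\<in>B. E r b \<noteq> E r' b)) \<or> ext_same"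
proof (cases "\<forall>r\<in>R. \<forall>r'. A r r' \<longrightarrow> (\<forall>b\<in>B. E r b \<noteq> E r' b)")
  case False
  interpret c: bicol_one R B A "\<lambda>r b. \<not> E r b" by (rule complement_one)
  obtain r r' b where r: "r \<in> R" "A r r'" "b \<in> B" "E r b = E r' b" using False by blast
  have r'R: "r' \<in> R" using r A_memR by blast
  have i: "infinite {b \<in> B. E r b \<and> E r' b} \<and> infinite {b \<in> B. \<not> E r b \<and> \<not> E r' b}"
  proof (cases "E r b")
    case True
    then have "infinite {b \<in> B. \<not> E r b \<and> \<not> E r' b}"
      using c.infinite_common_nbrs[OF r(1,2,3)] r(4) by simp
    moreover from this obtain d where "d \<in> B" "\<not> E r d" "\<not> E r' d"
      using not_finite_existsD by force
    ultimately show ?thesis using infinite_common_nbrs[OF r(1,2)] by simp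
  next
    case False
    then have "infinite {b \<in> B. E r b \<and> E r' b}"
      using infinite_common_nbrs[OF r(1,2,3)] r(4) by simp
    moreover from this obtain d where "d \<in> B" "E r d" "E r' d"
      using not_finite_existsD by force
    ultimately show ?thesis using c.infinite_common_nbrs[OF r(1,2)] by simp
  qed
  have i2: "infinite {b \<in> B. E r b \<and> \<not> E r' b} \<and> infinite {b \<in> B. \<not> E r b \<and> E r' b}"
    using infinite_only[OF r(1,2)] c.infinite_only[OF r(1,2)] by simp
  have i3: "infinite {b \<in> B. E r b = t \<and> E r' b = u}" for t u
    using i i2 by (cases t; cases u) auto
  obtain e1 e2 where e: "e1 \<in> R" "A e1 e2" using red_edge by blast
  have ext_same
  proof (rule ext_sameI[OF e(2,1)])
    fix s s' t u assume s: "s \<in> R" "A s s'"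
    obtain g where "aut g" "g r = s" "g r' = s'" using edge_transfer[OF r(2) s(2) r(1) s(1)] .
    then have "infinite {b \<in> B. E s b = t \<and> E s' b = u}"
      using aut_card_B(2)[of g r r' "\<lambda>a b. a = t \<and> b = u"] r(1) r'R i3[of t u] by simp
    then show "spread {b \<in> B. E s b = t \<and> E s' b = u}" by (subst spread_iff_infinite) auto
  qed
  then show ?thesis ..
qed simp

lemma spread_half: "r \<in> R \<Longrightarrow> spread {b \<in> B. E r b = t}"
  using spread_iff_infinite[of "{b \<in> B. E r b = t}"] infinite_half by auto

lemma spread_blue: "spread B"
  using spread_iff_infinite[of B] infinite_blue by auto

end

section \<open>Both color classes with edges\<close>

locale bicol_edges = bicol +
  assumes red_edge: "\<exists>x\<in>R. \<exists>y\<in>R. A x y"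
    and blue_edge: "\<exists>x\<in>B. \<exists>y\<in>B. A x y"
begin

lemma flip_edges: "bicol_edges B R A (\<lambda>b r. E r b)"
proof -
  interpret f: bicol B R A "\<lambda>b r. E r b" by (rule flip)
  show ?thesis by unfold_locales (fact blue_edge, fact red_edge)
qed

lemma complement_edges: "bicol_edges R B A (\<lambda>r b. \<not> E r b)"
proof -
  interpret c: bicol R B A "\<lambda>r b. \<not> E r b" by (rule complement)
  show ?thesis by unfold_locales (fact red_edge, fact blue_edge)
qed

text \<open>Some blue edge is separated by some \<open>q\<close>. One of its ends relates to
  \<open>q\<close> as \<open>b\<close> does to \<open>r\<close>, so it can be moved to
  \<open>b\<close> together with \<open>q\<close> to \<open>r\<close>. The other end then lands in
  the clique of \<open>b\<close> on the opposite side of \<open>r\<close>.\<close>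

lemma blue_other_side:
  assumes r: "r \<in> R" and b: "b \<in> B"
  shows "\<exists>b'\<in>B. A b b' \<and> E r b \<noteq> E r b'"
proof -
  obtain x0 y0 where "x0 \<in> B" "y0 \<in> B" "A x0 y0" using blue_edge by blast
  then obtain x y q where xy: "x \<in> B" "y \<in> B" "q \<in> R" "A x y" "E q x \<noteq> E q y"
    using blue_split by blast
  have *: "\<exists>b'\<in>B. A b b' \<and> E r b \<noteq> E r b'" if uv: "u \<in> B" "v \<in> B" "A u v" "E q u \<noteq> E q v" "E q u = E r b" for u v
  proof -
    obtain g where g: "aut g" "g q = r" "g u = b"
      using hom_red_blues[of q r "{u}" "\<lambda>_. b"] r b xy uv A_irr by auto
    have "A b (g v)" "E r (g v) = E q v" "g v \<in> B"
      using aut_AB[OF g(1) uv(1,2)] aut_E[OF g(1) xy(3) uv(2)] aut_B[OF g(1) uv(2)] g uv by auto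
    then show ?thesis using uv by blast
  qed
  show ?thesis
  proof (cases "E q x = E r b")
    case True then show ?thesis using *[of x y] xy by blast
  next
    case False then show ?thesis using *[of y x] xy A_sym[OF xy(4)] by blast
  qed
qed

lemma red_other_side: "r \<in> R \<Longrightarrow> b \<in> B \<Longrightarrow> \<exists>r'\<in>R. A r r' \<and> E r b \<noteq> E r' b"
  using bicol_edges.blue_other_side[OF flip_edges] by blast

end

section \<open>From omitting \<open>D_graph\<close> to parity of the cross edges\<close>

locale bicol_no_D = bicol_edges +
  assumes no_D: "r \<in> R \<Longrightarrow> b \<in> B \<Longrightarrow> A r r' \<Longrightarrow> A b b' \<Longrightarrow> E r b \<Longrightarrow> E r b' \<Longrightarrow> E r' b \<Longrightarrow> E r' b'"
begin

lemma flip_no_D: "bicol_no_D B R A (\<lambda>b r. E r b)"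
proof -
  interpret f: bicol_edges B R A "\<lambda>b r. E r b" by (rule flip_edges)
  show ?thesis by unfold_locales (use no_D in blast)
qed

text \<open>Let \<open>b\<close> be a common neighbor of \<open>r\<close> and \<open>r'\<close>, and
  \<open>b'\<close> a mate of \<open>b\<close> off \<open>r\<close>. By \<open>no_D\<close> it is
  also off \<open>r'\<close>, so \<open>r\<close>, \<open>r'\<close>, \<open>b'\<close> look like
  \<open>r1\<close>, \<open>r2\<close>, \<open>b1\<close>. The vertex corresponding to
  \<open>b2\<close> is a mate of \<open>b\<close> adjacent to \<open>r'\<close> but not to
  \<open>r\<close>, and together with \<open>b\<close> it contradicts \<open>no_D\<close>.\<close>

lemma unique_nbr:
  assumes D: "r1 \<in> R" "b1 \<in> B" "A r1 r2" "A b1 b2" "\<not> E r1 b1" "\<not> E r1 b2" "\<not> E r2 b1" "E r2 b2"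
    and r: "r \<in> R" "A r r'" "b \<in> B" "E r b"
  shows "\<not> E r' b"
proof
  assume e: "E r' b"
  have mem: "r2 \<in> R" "b2 \<in> B" "r' \<in> R" using D r A_memR A_memB by blast+
  obtain b' where b': "b' \<in> B" "A b b'" "\<not> E r b'" using blue_other_side[OF r(1,3)] r(4) by blast
  show False
  proof (cases "E r' b'")
    case True
    then show ?thesis using no_D[OF mem(3) r(3) A_sym[OF r(2)] b'(2) e] r b' by blast
  next
    case False
    have "\<exists>g. aut g \<and> (\<forall>(x, y)\<in>{(r1,r),(r2,r'),(b1,b')}. g x = y)"
      by (rule hom_pairs)
        (use D mem r b' False A_irr A_cross A_sym[OF r(2)] A_sym[OF D(3)] not_both in auto)
    then obtain g where g: "aut g" "g r1 = r" "g r2 = r'" "g b1 = b'" by auto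
    have gb: "g b2 \<in> B" "A b' (g b2)" "\<not> E r (g b2)" "E r' (g b2)"
      using aut_B[OF g(1) mem(2)] aut_AB[OF g(1) D(2) mem(2)] aut_E[OF g(1) D(1) mem(2)]
        aut_E[OF g(1) mem(1) mem(2)] g D by auto
    then have "A b (g b2)" using A_trans[OF b'(2) gb(2)] r(4) by auto
    then show ?thesis using no_D[OF mem(3) r(3) A_sym[OF r(2)] _ e gb(4) r(4)] gb by blast
  qed
qed

text \<open>Otherwise the cross edges between any two cliques form a perfect matching, by
  \<open>unique_nbr\<close> in both colors and the splitting of cliques. Then \<open>b2\<close> is
  the partner of \<open>r2\<close> in the clique of \<open>b3\<close>, so an automorphism fixing
  \<open>r2\<close> and \<open>b3\<close> fixes \<open>b2\<close>. Homogeneity nevertheless provides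
  one that moves the partner \<open>s2\<close> of \<open>b2\<close> in another red clique to the
  partner \<open>s3\<close> of the different vertex \<open>b1\<close>.\<close>

lemma no_D_tilde:
  assumes D: "r1 \<in> R" "b1 \<in> B" "A r1 r2" "A b1 b2" "\<not> E r1 b1" "\<not> E r1 b2" "\<not> E r2 b1"
  shows "\<not> E r2 b2"
proof
  assume e: "E r2 b2"
  interpret f: bicol_no_D B R A "\<lambda>b r. E r b" by (rule flip_no_D)
  have uR: "\<not> E r' b" if "r \<in> R" "A r r'" "b \<in> B" "E r b" for r r' b
    using unique_nbr[OF D e that] .
  have uB: "\<not> E r b'" if "b \<in> B" "A b b'" "r \<in> R" "E r b" for r b b'
    by (rule f.unique_nbr[OF D(2,1,4,3,5,7,6) e that])
  have mem: "r2 \<in> R" "b2 \<in> B" using D A_memR A_memB by blast+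
  obtain b3 where b3: "b3 \<in> B" "A b1 b3" "E r1 b3" using blue_other_side[OF D(1,2)] D by blast
  have b32: "A b3 b2" using A_trans[OF A_sym[OF b3(2)] D(4)] b3 D by auto
  obtain s where s: "s \<in> R" "s \<noteq> r1" "\<not> A r1 s" using nonadjacent_exists[OF D(1)] by blast
  \<comment> \<open>If \<open>s\<close> itself is not adjacent to \<open>b\<close>, then
    \<open>red_other_side\<close> yields a mate of \<open>s\<close> that is.\<close>
  have hit: "\<exists>t\<in>R. (t = s \<or> A s t) \<and> E t b" if "b \<in> B" for b
    using red_other_side[OF s(1) that] s by metis
  obtain s2 where s2: "s2 \<in> R" "s2 = s \<or> A s s2" "E s2 b2" using hit[OF mem(2)] by blast
  obtain s3 where s3: "s3 \<in> R" "s3 = s \<or> A s s3" "E s3 b1" using hit[OF D(2)] by blast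
  have non: "t \<noteq> r1 \<and> t \<noteq> r2 \<and> \<not> A r1 t \<and> \<not> A r2 t \<and> \<not> A t r1 \<and> \<not> A t r2" if "t = s \<or> A s t" for t
    using that s D(3) A_sym A_trans by metis
  have nb3: "\<not> E s2 b3" "\<not> E s3 b3" "\<not> E r2 b3" "\<not> E s3 b2"
    using uB[OF mem(2) A_sym[OF b32] s2(1,3)] uB[OF D(2) b3(2) s3(1,3)] uB[OF mem(2) A_sym[OF b32] mem(1) e]
      uB[OF D(2) D(4) s3(1,3)] by auto
  \<comment> \<open>Neither \<open>s2\<close> nor \<open>s3\<close> is adjacent to
    \<open>b3\<close>, as each has only one neighbor in that blue clique, namely \<open>b2\<close>
    and \<open>b1\<close>. Hence they look alike over \<open>r1\<close>, \<open>r2\<close> and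
    \<open>b3\<close>.\<close>
  have "\<exists>g. aut g \<and> (\<forall>(x, y)\<in>{(r1,r1),(r2,r2),(s2,s3),(b3,b3)}. g x = y)"
  proof (rule hom_pairs)
    have nB: "r1 \<notin> B" "r2 \<notin> B" "s2 \<notin> B" "s3 \<notin> B" "b3 \<notin> R"
      using D(1) mem s2(1) s3(1) b3(1) disj by blast+
    note nA = A_cross[OF D(1) b3(1)] A_cross[OF mem(1) b3(1)] A_cross[OF s2(1) b3(1)] A_cross[OF s3(1) b3(1)]
    have ne: "r1 \<noteq> b3" "r2 \<noteq> b3" "s2 \<noteq> b3" "s3 \<noteq> b3" using b3(1) nB by auto
    note non' = non[OF s2(2)] non[OF s3(2)]
    show "(x = x' \<longleftrightarrow> y = y') \<and> (A x x' \<longleftrightarrow> A y y') \<and> (x \<in> R \<longrightarrow> x' \<in> B \<longrightarrow> (E x x' \<longleftrightarrow> E y y'))"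
      if "(x, y) \<in> {(r1,r1),(r2,r2),(s2,s3),(b3,b3)}" "(x', y') \<in> {(r1,r1),(r2,r2),(s2,s3),(b3,b3)}" for x y x' y'
      using that nB nA ne ne[symmetric] non' nb3(1,2) A_irr
      by (elim insertE emptyE) auto
  qed (use D(1) mem s2(1) s3(1) b3(1) in auto)
  then obtain g where g: "aut g" "g r1 = r1" "g r2 = r2" "g s2 = s3" "g b3 = b3" by auto
  have gb: "g b2 \<in> B" "A b3 (g b2)" "E r2 (g b2)" "E s3 (g b2)"
    using aut_B[OF g(1) mem(2)] aut_AB[OF g(1) b3(1) mem(2)] aut_E[OF g(1) mem(1) mem(2)]
      aut_E[OF g(1) s2(1) mem(2)] g b32 e s2 by auto
  have "g b2 = b2"
  proof (rule ccontr)
    assume "g b2 \<noteq> b2"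
    then have "A b2 (g b2)" using A_trans[OF A_sym[OF b32] gb(2)] by simp
    then show False using uB[OF mem(2) _ mem(1) e] gb by blast
  qed
  then show False using gb nb3 by simp
qed

end

text \<open>In contrast to \<open>no_D\<close>, this condition is also invariant under complementing
  \<open>E\<close>, which later makes the cases of \<open>D_graph\<close> and \<open>D_tilde\<close>
  meet.\<close>

locale bicol_par = bicol_edges +
  assumes parity: "r \<in> R \<Longrightarrow> b \<in> B \<Longrightarrow> A r r' \<Longrightarrow> A b b' \<Longrightarrow> (E r b = E r' b) = (E r b' = E r' b')"

lemma (in bicol_no_D) par: "bicol_par R B A E"
proof unfold_locales
  fix r b r' b' assume *: "r \<in> R" "b \<in> B" "A r r'" "A b b'"
  have m: "r' \<in> R" "b' \<in> B" using * A_memR A_memB by blast+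
  note s = A_sym[OF *(3)] A_sym[OF *(4)]
  show "(E r b = E r' b) = (E r b' = E r' b')"
    \<comment> \<open>A failure of parity means one or three cross edges between two red and two
      blue mates; the four relabellings bring each of the four pairs into the exceptional
      place.\<close>
    using no_D[OF *] no_D[OF *(1) m(2) *(3) s(2)] no_D[OF m(1) *(2) s(1) *(4)] no_D[OF m(1) m(2) s(1) s(2)]
     no_D_tilde[OF *] no_D_tilde[OF *(1) m(2) *(3) s(2)] no_D_tilde[OF m(1) *(2) s(1) *(4)] no_D_tilde[OF m(1) m(2) s(1) s(2)]
    by argo
qed

context bicol_par
begin

lemma flip_par: "bicol_par B R A (\<lambda>b r. E r b)"
proof -
  interpret f: bicol_edges B R A "\<lambda>b r. E r b" by (rule flip_edges)
  show ?thesis by unfold_locales (use parity in blast)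
qed

lemma complement_par: "bicol_par R B A (\<lambda>r b. \<not> E r b)"
proof -
  interpret f: bicol_edges R B A "\<lambda>r b. \<not> E r b" by (rule complement_edges)
  show ?thesis by unfold_locales (use parity in simp)
qed

section \<open>Red cliques of size two and larger ones\<close>

definition red_triangle :: bool where
  "red_triangle \<longleftrightarrow> (\<exists>x\<in>R. \<exists>y z. A x y \<and> A y z \<and> A x z)"

text \<open>Some mate of \<open>r\<close> is on the other side of \<open>b\<close> by
  \<open>red_other_side\<close>, and without triangles \<open>r'\<close> is the only mate.\<close>

lemma complementary_pairs:
  assumes "\<not> red_triangle" "r \<in> R" "A r r'" "b \<in> B"
  shows "E r b \<noteq> E r' b"
proof -
  obtain r'' where r'': "A r r''" "E r b \<noteq> E r'' b" using red_other_side[OF assms(2,4)] by blast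
  have "r'' = r'"
    using assms(1,2,3) r'' A_trans[OF A_sym[OF assms(3)] r''(1)] unfolding red_triangle_def by blast
  then show ?thesis using r'' by simp
qed

text \<open>Of three mutually adjacent red vertices, two agree on any given blue vertex; this
  supplies the case of equality, and \<open>edge_split\<close> the other one.\<close>

lemma both_kinds:
  assumes T: red_triangle and r: "r \<in> R" "A r r'"
  shows "\<exists>b\<in>B. (E r b \<noteq> E r' b) = t"
proof (cases t)
  case True
  then show ?thesis using edge_split[OF r(2,1)] by auto
next
  case False
  obtain x y z where T: "x \<in> R" "A x y" "A y z" "A x z" using T unfolding red_triangle_def by blast
  then have m: "y \<in> R" "z \<in> R" using A_memR by blast+
  obtain b where b: "b \<in> B" using blue_edge by blast
  have "\<exists>u v. u \<in> R \<and> v \<in> R \<and> A u v \<and> E u b = E v b"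
    using T m by (cases "E x b = E y b"; cases "E y b = E z b") auto
  then obtain u v where uv: "u \<in> R" "v \<in> R" "A u v" "E u b = E v b" by blast
  obtain g where g: "aut g" "g u = r" "g v = r'" using edge_transfer[OF uv(3) r(2) uv(1) r(1)] .
  then have "E r (g b) = E r' (g b)" "g b \<in> B"
    using aut_E[OF g(1) uv(1) b] aut_E[OF g(1) uv(2) b] aut_B[OF g(1) b] uv by auto
  then show ?thesis using False by blast
qed

definition cl :: "'a \<Rightarrow> 'a set" where "cl b = {b'. b' = b \<or> A b b'}"

lemma cl_eq: "cl b = cl b' \<longleftrightarrow> b = b' \<or> A b b'"
proof
  assume "cl b = cl b'"
  moreover have "b' \<in> cl b'" unfolding cl_def by simp
  ultimately have "b' \<in> cl b" by simp
  then show "b = b' \<or> A b b'" unfolding cl_def by auto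
next
  have *: "cl u \<subseteq> cl v" if "A v u" for u v
    using that A_trans[OF that] unfolding cl_def by auto
  assume "b = b' \<or> A b b'"
  then show "cl b = cl b'" using *[of b b'] *[of b' b] A_sym[of b b'] by auto
qed

lemma aut_cl:
  assumes g: "aut g" and b: "b \<in> B" shows "cl (g b) = g ` cl b"
proof (intro set_eqI iffI)
  fix x assume x: "x \<in> cl (g b)"
  then have "x \<in> B" using aut_B[OF g b] A_memB unfolding cl_def by blast
  then obtain x0 where "x0 \<in> B" "x = g x0" using aut_surjB[OF g] by blast
  then show "x \<in> g ` cl b" using x aut_AB[OF g b] aut_eqB[OF g] b unfolding cl_def by auto
next
  fix x assume "x \<in> g ` cl b"
  then show "x \<in> cl (g b)" using aut_AB[OF g b] A_memB b unfolding cl_def by blast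
qed

text \<open>By parity a blue clique as a whole has a kind with respect to a red edge:
  \<open>True\<close> for opposite, \<open>False\<close> for equal. Collecting cliques instead of
  vertices allows finite sets to be considered even where cliques are infinite.\<close>

definition kind :: "bool \<Rightarrow> 'a \<Rightarrow> 'a \<Rightarrow> 'a set set" where
  "kind t r r' = cl ` {b \<in> B. (E r b \<noteq> E r' b) = t}"

lemma kind_iff:
  assumes "r \<in> R" "A r r'" "b \<in> B"
  shows "cl b \<in> kind t r r' \<longleftrightarrow> (E r b \<noteq> E r' b) = t"
proof
  assume "cl b \<in> kind t r r'"
  then obtain b' where "b' \<in> B" "(E r b' \<noteq> E r' b') = t" "b = b' \<or> A b b'"
    unfolding kind_def using cl_eq by blast
  then show "(E r b \<noteq> E r' b) = t" using parity[OF assms(1,3,2)] by blast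
next
  assume "(E r b \<noteq> E r' b) = t"
  then show "cl b \<in> kind t r r'" unfolding kind_def using assms(3) by blast
qed

lemma aut_kind:
  assumes "aut g" "r \<in> R" "r' \<in> R"
  shows "kind t (g r) (g r') = (\<lambda>K. g ` K) ` kind t r r'"
  unfolding kind_def aut_image_B[OF assms, of "\<lambda>x y. (x \<noteq> y) = t"]
  using aut_cl[OF assms(1)] by (auto simp: image_image image_iff)

lemma finite_kind_transfer:
  assumes "r \<in> R" "A r r'" "s \<in> R" "A s s'" "finite (kind t r r')"
  shows "finite (kind t s s') \<and> card (kind t s s') = card (kind t r r')"
proof -
  have m: "r' \<in> R" "s' \<in> R" using assms A_memR by blast+
  obtain g where g: "aut g" "g r = s" "g r' = s'" using edge_transfer[OF assms(2,4,1,3)] .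
  obtain k where k: "aut k" "k s = r" "k s' = r'" using edge_transfer[OF assms(4,2,3,1)] .
  have 1: "kind t s s' = (\<lambda>K. g ` K) ` kind t r r'" using aut_kind[OF g(1) assms(1) m(1)] g by simp
  have 2: "kind t r r' = (\<lambda>K. k ` K) ` kind t s s'" using aut_kind[OF k(1) assms(3) m(2)] k by simp
  have f: "finite (kind t s s')" using 1 assms(5) by simp
  have "card (kind t s s') \<le> card (kind t r r')" using 1 card_image_le[OF assms(5)] by metis
  moreover have "card (kind t r r') \<le> card (kind t s s')" using 2 card_image_le[OF f] by metis
  ultimately show ?thesis using f by simp
qed

text \<open>Since \<open>s\<close> has a neighbor in every blue clique, finitely many of these
  neighbors can be moved to any others with \<open>s\<close> fixed. Sending those in the cliques of
  \<open>kind t s s'\<close> to those in the cliques of \<open>M\<close> takes \<open>s'\<close> to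
  the required mate.\<close>

lemma kind_arbitrary:
  assumes s: "s \<in> R" "A s s'" "finite (kind t s s')"
    and M: "M \<subseteq> cl ` B" "finite M" "card M = card (kind t s s')"
  shows "\<exists>s''\<in>R. A s s'' \<and> kind t s s'' = M"
proof -
  have m: "s' \<in> R" using s A_memR by blast
  have "\<exists>b\<in>B. cl b = K \<and> E s b" if "K \<in> cl ` B" for K
  proof -
    obtain b where b: "b \<in> B" "K = cl b" using \<open>K \<in> cl ` B\<close> by blast
    then show ?thesis using blue_other_side[OF s(1) b(1)] cl_eq by (cases "E s b") metis+
  qed
  then obtain \<rho> where \<rho>: "\<And>K. K \<in> cl ` B \<Longrightarrow> \<rho> K \<in> B \<and> cl (\<rho> K) = K \<and> E s (\<rho> K)" by metis
  have kB: "kind t s s' \<subseteq> cl ` B" unfolding kind_def by auto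
  obtain \<beta> where \<beta>: "bij_betw \<beta> (kind t s s') M"
    using finite_same_card_bij[OF s(3) M(2)] M(3) by auto
  have \<beta>B: "\<beta> K \<in> cl ` B" if "K \<in> kind t s s'" for K using \<beta> M(1) that by (auto simp: bij_betw_def)
  let ?Y = "\<rho> ` kind t s s'"
  let ?h = "\<lambda>b. \<rho> (\<beta> (cl b))"
  have hY: "?h (\<rho> K) = \<rho> (\<beta> K)" if "K \<in> kind t s s'" for K using \<rho> kB that by auto
  have inj\<rho>: "\<rho> K = \<rho> K' \<longleftrightarrow> K = K'" "\<not> A (\<rho> K) (\<rho> K')" if "K \<in> cl ` B" "K' \<in> cl ` B" for K K'
    using \<rho>[OF that(1)] \<rho>[OF that(2)] cl_eq A_irr by metis+
  obtain g where g: "aut g" "g s = s" "\<And>y. y \<in> ?Y \<Longrightarrow> g y = ?h y"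
  proof (rule hom_red_blues[of s s ?Y ?h])
    show "?Y \<subseteq> B" using \<rho> kB by auto
    show "?h ` ?Y \<subseteq> B" using hY \<rho> \<beta>B by auto
    show "inj_on ?h ?Y"
    proof (rule inj_onI)
      fix x y assume "x \<in> ?Y" "y \<in> ?Y" "?h x = ?h y"
      moreover obtain K K' where K: "x = \<rho> K" "y = \<rho> K'" "K \<in> kind t s s'" "K' \<in> kind t s s'"
        using \<open>x \<in> ?Y\<close> \<open>y \<in> ?Y\<close> by blast
      ultimately have "\<rho> (\<beta> K) = \<rho> (\<beta> K')" using hY[OF K(3)] hY[OF K(4)] by simp
      then have "\<beta> K = \<beta> K'" using inj\<rho>(1)[OF \<beta>B[OF K(3)] \<beta>B[OF K(4)]] by simp
      then have "K = K'" using inj_onD[OF bij_betw_imp_inj_on[OF \<beta>]] K(3,4) by blast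
      then show "x = y" using K by simp
    qed
    show "A (?h x) (?h y) = A x y" if "x \<in> ?Y" "y \<in> ?Y" for x y
    proof -
      obtain K K' where K: "x = \<rho> K" "y = \<rho> K'" "K \<in> kind t s s'" "K' \<in> kind t s s'" using \<open>x \<in> ?Y\<close> \<open>y \<in> ?Y\<close> by blast
      have "\<not> A x y" using inj\<rho>(2)[OF subsetD[OF kB K(3)] subsetD[OF kB K(4)]] K(1,2) by simp
      moreover have "\<not> A (\<rho> (\<beta> K)) (\<rho> (\<beta> K'))" using inj\<rho>(2)[OF \<beta>B[OF K(3)] \<beta>B[OF K(4)]] .
      ultimately show ?thesis using K hY[OF K(3)] hY[OF K(4)] by simp
    qed
    show "E s (?h y) = E s y" if "y \<in> ?Y" for y
    proof -
      obtain K where K: "y = \<rho> K" "K \<in> kind t s s'" using \<open>y \<in> ?Y\<close> by blast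
      then show ?thesis using hY[OF K(2)] \<rho>[OF \<beta>B[OF K(2)]] \<rho> kB by auto
    qed
  qed (use s in auto)
  have gK: "g ` K = \<beta> K" if K: "K \<in> kind t s s'" for K
  proof -
    have "g ` K = cl (g (\<rho> K))" using aut_cl[OF g(1)] \<rho> kB K by auto
    also have "\<dots> = \<beta> K" using g(3)[of "\<rho> K"] K hY[OF K] \<rho>[OF \<beta>B[OF K]] by auto
    finally show ?thesis .
  qed
  have "kind t s (g s') = (\<lambda>K. g ` K) ` kind t s s'" using aut_kind[OF g(1) s(1) m] g by simp
  also have "\<dots> = M" using gK \<beta> by (auto simp: bij_betw_def)
  finally have "kind t s (g s') = M" .
  then show ?thesis using aut_R[OF g(1) m] aut_AR[OF g(1) s(1) m] g s by auto
qed

text \<open>If the set \<open>?M\<close> were finite, a vertex \<open>s\<close> of another red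
  clique would have mates \<open>s1\<close> and \<open>s2\<close> of kinds \<open>?M\<close> and
  \<open>?M'\<close>, with \<open>?M'\<close> a different set of equal size. An automorphism fixing
  \<open>r\<close>, \<open>r'\<close>, \<open>s\<close> and taking \<open>s1\<close> to
  \<open>s2\<close> would both preserve \<open>?M\<close> and send it to \<open>?M'\<close>.\<close>

lemma infinite_kind:
  assumes T: red_triangle and r: "r \<in> R" "A r r'"
  shows "infinite (kind t r r')"
proof
  assume fin: "finite (kind t r r')"
  obtain s where s: "s \<in> R" "s \<noteq> r" "\<not> A r s" "\<not> A s r" using nonadjacent_exists[OF r(1)] by blast
  obtain s' where s': "s' \<in> R" "A s s'" using mate_exists[OF r(2,1) s(1)] by blast
  have r'R: "r' \<in> R" using r A_memR by blast
  let ?M = "kind t r r'"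
  obtain b where b: "b \<in> B" "(E r b \<noteq> E r' b) = t" using both_kinds[OF T r] by blast
  obtain d where d: "d \<in> B" "(E r d \<noteq> E r' d) = (\<not> t)" using both_kinds[OF T r] by blast
  have bM: "cl b \<in> ?M" and dM: "cl d \<notin> ?M" using kind_iff[OF r] b d by auto
  \<comment> \<open>One clique of \<open>?M\<close> is traded for one outside it;
    \<open>both_kinds\<close> provides both.\<close>
  let ?M' = "insert (cl d) (?M - {cl b})"
  have MB: "?M \<subseteq> cl ` B" "?M' \<subseteq> cl ` B" using d unfolding kind_def by auto
  have card: "card ?M' = card ?M" using card_Suc_Diff1[OF fin bM] fin dM by simp
  have fs: "finite (kind t s s')" "card (kind t s s') = card ?M"
    using finite_kind_transfer[OF r s(1) s'(2) fin] by auto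
  obtain s1 where s1: "s1 \<in> R" "A s s1" "kind t s s1 = ?M"
    using kind_arbitrary[OF s(1) s'(2) fs(1) MB(1) fin] fs by auto
  obtain s2 where s2: "s2 \<in> R" "A s s2" "kind t s s2 = ?M'"
    using kind_arbitrary[OF s(1) s'(2) fs(1) MB(2)] fin fs card by auto
  have non: "u \<noteq> v \<and> \<not> A u v \<and> \<not> A v u" if "v = s \<or> A s v" "u = r \<or> u = r'" for u v
    using that s r A_sym A_trans by metis
  have "\<exists>g. aut g \<and> (\<forall>(x, y)\<in>{(r,r),(r',r'),(s,s),(s1,s2)}. g x = y)"
    by (rule hom_red_tuple)
      (use r r'R s s1 s2 non[of s] non[of s1] non[of s2] A_irr A_sym[OF s1(2)] A_sym[OF s2(2)] in auto)
  then obtain g where g: "aut g" "g r = r" "g r' = r'" "g s = s" "g s1 = s2" by auto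
  have "?M = (\<lambda>K. g ` K) ` ?M" using aut_kind[OF g(1) r(1) r'R] g by simp
  moreover have "?M' = (\<lambda>K. g ` K) ` ?M" using aut_kind[OF g(1) s(1) s1(1)] g s1 s2 by simp
  ultimately show False using dM by auto
qed

lemma spread_kind:
  assumes T: red_triangle and r: "r \<in> R" "A r r'"
  shows "spread {b \<in> B. (E r b \<noteq> E r' b) = t}"
proof (rule ccontr)
  assume "\<not> ?thesis"
  then obtain F where F: "finite F" "\<And>b. b \<in> {b \<in> B. (E r b \<noteq> E r' b) = t} \<Longrightarrow> b \<in> F \<or> (\<exists>d\<in>F. A b d)"
    unfolding spread_def by blast
  have "kind t r r' \<subseteq> cl ` F"
  proof
    fix K assume "K \<in> kind t r r'"
    then obtain b where b: "b \<in> {b \<in> B. (E r b \<noteq> E r' b) = t}" "K = cl b" unfolding kind_def by blast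
    then show "K \<in> cl ` F" using F(2)[OF b(1)] cl_eq by blast
  qed
  then show False using infinite_kind[OF assms] F(1) finite_surj by blast
qed

lemma move_in_clique:
  assumes "r \<in> R" "b \<in> B" "b \<notin> F" "\<forall>d\<in>F. \<not> A b d"
  shows "\<exists>b'\<in>B. (b' = b \<or> A b b') \<and> E r b' = t \<and> b' \<notin> F \<and> (\<forall>d\<in>F. \<not> A b' d)"
proof (cases "E r b = t")
  case True then show ?thesis using assms by blast
next
  case False
  obtain b' where b': "b' \<in> B" "A b b'" "E r b \<noteq> E r b'" using blue_other_side[OF assms(1,2)] by blast
  then have "b' \<notin> F" "\<forall>d\<in>F. \<not> A b' d" using assms A_trans[OF b'(2)] by auto
  then show ?thesis using b' False by blast
qed

text \<open>Parity splits the search in two: first a distant clique of the kind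
  \<open>t \<noteq> u\<close>, then a vertex in it on the side \<open>t\<close> of \<open>r\<close>.
  The value at \<open>r'\<close> follows.\<close>

lemma spread_four:
  assumes T: red_triangle and r: "r \<in> R" "A r r'"
  shows "spread {b \<in> B. E r b = t \<and> E r' b = u}"
  unfolding spread_def
proof (intro allI impI)
  fix F :: "'a set" assume "finite F"
  then obtain b where b: "b \<in> B" "(E r b \<noteq> E r' b) = (t \<noteq> u)" "b \<notin> F" "\<forall>d\<in>F. \<not> A b d"
    using spreadD[OF spread_kind[OF assms, of "t \<noteq> u"]] by blast
  obtain b' where b': "b' \<in> B" "b' = b \<or> A b b'" "E r b' = t" "b' \<notin> F" "\<forall>d\<in>F. \<not> A b' d"
    using move_in_clique[OF r(1) b(1,3,4)] by blast
  have "(E r b' \<noteq> E r' b') = (t \<noteq> u)" using b'(2) b(2) parity[OF r(1) b(1) r(2)] by blast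
  then have "E r' b' = u" using b' by blast
  then show "\<exists>b\<in>{b \<in> B. E r b = t \<and> E r' b = u}. b \<notin> F \<and> (\<forall>d\<in>F. \<not> A b d)" using b' by blast
qed

lemma triangle_ext_same: "red_triangle \<Longrightarrow> ext_same"
  using ext_sameI spread_four red_edge by blast

lemma triangle_spread_blue: assumes red_triangle shows "spread B"
proof -
  obtain x y where "x \<in> R" "A x y" using red_edge by blast
  then show ?thesis using spread_four[OF assms, of x y True True] spread_mono by blast
qed

lemma spread_half:
  assumes "spread B" "r \<in> R" shows "spread {b \<in> B. E r b = t}"
  unfolding spread_def
proof (intro allI impI)
  fix F :: "'a set" assume "finite F"
  then obtain b where "b \<in> B" "b \<notin> F" "\<forall>d\<in>F. \<not> A b d" using spreadD[OF assms(1)] by blast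
  then show "\<exists>b\<in>{b \<in> B. E r b = t}. b \<notin> F \<and> (\<forall>d\<in>F. \<not> A b d)"
    using move_in_clique[OF assms(2)] by blast
qed

text \<open>Blue cliques have at most two vertices here, so the infinite set \<open>B\<close>
  consists of infinitely many of them.\<close>

lemma pairs_spread_blue:
  assumes "\<not> bicol_par.red_triangle B A"
  shows "spread B"
  unfolding spread_def
proof (intro allI impI)
  fix F :: "'a set" assume F: "finite F"
  interpret f: bicol_par B R A "\<lambda>b r. E r b" by (rule flip_par)
  have "finite {b \<in> B. A b d}" for d
  proof (rule ccontr)
    assume i: "infinite {b \<in> B. A b d}"
    then obtain b where b: "b \<in> B" "A b d" using not_finite_existsD by force
    have "infinite ({b \<in> B. A b d} - {b})" using i by simp
    then have "{b \<in> B. A b d} - {b} \<noteq> {}" by (metis finite.emptyI)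
    then obtain b' where "b' \<in> B" "A b' d" "b' \<noteq> b" by blast
    then have "A b d" "A d b'" "A b b'" using b A_sym[of b' d] A_trans[of b d b'] by auto
    then show False using assms b unfolding f.red_triangle_def by blast
  qed
  then have "finite (F \<union> (\<Union>d\<in>F. {b \<in> B. A b d}))" using F by simp
  moreover have "infinite B" using infinite_B red_edge by blast
  ultimately obtain b where "b \<in> B" "b \<notin> F \<union> (\<Union>d\<in>F. {b \<in> B. A b d})" by (meson finite_subset subsetI)
  then show "\<exists>b\<in>B. b \<notin> F \<and> (\<forall>d\<in>F. \<not> A b d)" by auto
qed

text \<open>This is \<open>ext_same_avoid\<close> with the colors exchanged, prescribing only the
  relation to \<open>r\<close>.\<close>

lemma infinite_blue_half:
  assumes "bicol.ext_same B R A (\<lambda>b r. E r b)" "spread R" "r \<in> R" "b \<in> B" "finite F"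
  shows "\<exists>b'\<in>B. A b b' \<and> b' \<notin> F \<and> E r b' = t"
proof -
  interpret f: bicol_par B R A "\<lambda>b r. E r b" by (rule flip_par)
  show ?thesis
    using f.ext_same_avoid[OF assms(1,2,4), of "{r}" F "if t then {r} else {}"] assms(3,5) A_irr
    by (auto split: if_splits)
qed

text \<open>Vertices are placed one after another: one whose clique has been started is found by
  \<open>infinite_blue_half\<close>, one that starts a clique by \<open>spread_half\<close>. So
  every finite pattern of blue cliques occurs with every trace of \<open>r\<close> on it.\<close>

lemma blue_config:
  assumes B: "bicol.ext_same B R A (\<lambda>b r. E r b)" "spread R" "spread B"
    and r: "r \<in> R" and C: "finite C"
  shows "\<exists>h. inj_on h C \<and> h ` C \<subseteq> B \<and> (\<forall>c\<in>C. \<forall>d\<in>C. A (h c) (h d) = A c d) \<and> (\<forall>c\<in>C. E r (h c) = (c \<in> U))"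
  using C
proof (induction C)
  case (insert c C)
  then obtain h where h: "inj_on h C" "h ` C \<subseteq> B" "\<forall>c\<in>C. \<forall>d\<in>C. A (h c) (h d) = A c d" "\<forall>c\<in>C. E r (h c) = (c \<in> U)"
    by blast
  have "\<exists>b\<in>B. b \<notin> h ` C \<and> E r b = (c \<in> U) \<and> (\<forall>e\<in>C. A b (h e) = A c e)"
  proof (cases "\<exists>d\<in>C. A c d")
    case True
    then obtain d where d: "d \<in> C" "A c d" by blast
    then have hd: "h d \<in> B" using h by blast
    obtain b where b: "b \<in> B" "A (h d) b" "b \<notin> h ` C" "E r b = (c \<in> U)"
      using infinite_blue_half[OF B(1,2) r hd, of "h ` C"] insert(1) by blast
    have "A b (h e) = A c e" if e: "e \<in> C" for e
    proof -
      have "A b (h e) \<longleftrightarrow> h e = h d \<or> A (h d) (h e)"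
        using b e A_sym[OF b(2)] A_trans[OF b(2), of "h e"] A_trans[of b "h d" "h e"] by (metis imageI)
      moreover have "A c e \<longleftrightarrow> e = d \<or> A d e"
        using d e insert(2) A_sym[OF d(2)] A_trans[OF d(2), of e] A_trans[of d c e] by blast
      ultimately show ?thesis using h e d by (auto simp: inj_on_eq_iff)
    qed
    then show ?thesis using b by blast
  next
    case False
    obtain b where "b \<in> {b \<in> B. E r b = (c \<in> U)}" "b \<notin> h ` C" "\<forall>d\<in>h ` C. \<not> A b d"
      using spreadD[OF spread_half[OF B(3) r], of "h ` C"] insert(1) by blast
    then show ?thesis using False by auto
  qed
  then obtain b where b: "b \<in> B" "b \<notin> h ` C" "E r b = (c \<in> U)" "\<And>e. e\<in>C \<Longrightarrow> A b (h e) = A c e" by blast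
  have b': "A (h e) b = A e c" if "e \<in> C" for e using b(4)[OF that] A_sym by metis
  have ne: "\<And>e. e \<in> C \<Longrightarrow> e \<noteq> c" using insert by auto
  show ?case
    by (rule exI[of _ "h(c := b)"]) (use h b b' ne insert.hyps A_irr in \<open>auto simp: inj_on_def\<close>)
qed simp

text \<open>A vertex \<open>s\<close> is avoided together with its whole clique by means of two
  adjacent blue neighbors \<open>c\<close>, \<open>c'\<close> of \<open>s\<close> in a fresh clique.
  The new vertex is asked to be adjacent to \<open>c\<close> but not to \<open>c'\<close>, so there
  it is neither equal nor opposite to \<open>s\<close>, which parity forbids for mates.\<close>

lemma generic_red_new:
  assumes B: "bicol.ext_same B R A (\<lambda>b r. E r b)" "spread R" "spread B"
    and X: "finite X" "X \<subseteq> R" and C: "finite C" "C \<subseteq> B"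
  shows "\<exists>r\<in>R. r \<notin> X \<and> (\<forall>s\<in>X. \<not> A s r) \<and> (\<forall>c\<in>C. E r c \<longleftrightarrow> c \<in> U)"
  using X C
proof (induction X arbitrary: C U)
  case empty
  obtain r where r: "r \<in> R" using two_red by blast
  obtain h where h: "inj_on h C" "h ` C \<subseteq> B" "\<forall>c\<in>C. \<forall>d\<in>C. A (h c) (h d) = A c d" "\<forall>c\<in>C. E r (h c) = (c \<in> U)"
    using blue_config[OF B r empty(2), of U] by (elim exE conjE)
  define k where "k = inv_into C h"
  have k: "k (h c) = c" if "c \<in> C" for c using h(1) that by (simp add: k_def)
  obtain g where g: "aut g" "\<And>y. y \<in> h ` C \<Longrightarrow> g y = k y"
    by (rule hom_blues[of "h ` C" k]) (use empty h k in \<open>auto simp: inj_on_def\<close>)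
  have gc: "g (h c) = c" if "c \<in> C" for c using g(2) k that by auto
  have "E (g r) c = (c \<in> U)" if c: "c \<in> C" for c
    using aut_E[OF g(1) r(1), of "h c"] h c gc[OF c] by auto
  then show ?case using aut_R[OF g(1) r] by blast
next
  case (insert s X)
  have s: "s \<in> R" using insert by simp
  obtain c where c: "c \<in> B" "E s c" "c \<notin> C" "\<forall>d\<in>C. \<not> A c d"
    using spreadD[OF spread_half[OF B(3) s, of True] insert.prems(2)] by blast
  obtain c' where c': "c' \<in> B" "A c c'" "c' \<notin> C" "E s c'"
    using infinite_blue_half[OF B(1,2) s c(1) insert.prems(2), of True] by blast
  have cc: "c \<noteq> c'" using c' A_irr by auto
  have "\<exists>r\<in>R. r \<notin> X \<and> (\<forall>s\<in>X. \<not> A s r) \<and> (\<forall>d\<in>insert c (insert c' C). E r d \<longleftrightarrow> d \<in> insert c (U - {c'}))"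
    by (rule insert.IH) (use insert.prems c c' in auto)
  then obtain r where r: "r \<in> R" "r \<notin> X" "\<forall>s\<in>X. \<not> A s r"
    "\<forall>d\<in>insert c (insert c' C). E r d \<longleftrightarrow> d \<in> insert c (U - {c'})" by blast
  have r': "E r c" "\<not> E r c'" "\<forall>d\<in>C. E r d \<longleftrightarrow> d \<in> U" using r(4) cc c c' by auto
  have "r \<noteq> s" using r' c' by auto
  moreover have "\<not> A s r" using parity[OF s c(1) _ c'(2), of r] r' c c' by blast
  ultimately show ?case using r r' by blast
qed

end

section \<open>Omitted subgraphs and admissible graphs\<close>

text \<open>The form of \<open>is_embedding\<close> as an injective map; composition is immediate
  for it, without passing through induced subgraphs.\<close>

definition emb :: "('a \<Rightarrow> 'b) \<Rightarrow> 'a cgraph \<Rightarrow> 'b cgraph \<Rightarrow> bool" where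
  "emb f G H \<longleftrightarrow> f ` verts G \<subseteq> verts H \<and> inj_on f (verts G) \<and>
     (\<forall>x\<in>verts G. \<forall>y\<in>verts G. adj H (f x) (f y) \<longleftrightarrow> adj G x y) \<and>
     (\<forall>x\<in>verts G. col H (f x) = col G x)"

lemma is_embedding_iff_emb: "is_embedding f G H \<longleftrightarrow> emb f G H"
  by (auto simp: is_embedding_def emb_def is_iso_def induced_def bij_betw_def)

lemma realized_iff_emb: "realized X G \<longleftrightarrow> (\<exists>f. emb f X G)"
proof
  assume "realized X G"
  then obtain S f where Sf: "S \<subseteq> verts G" "is_iso f X (induced G S)"
    by (auto simp: realized_def isomorphic_def)
  then have "f x \<in> S" if "x \<in> verts X" for x using that by (auto simp: is_iso_def induced_def bij_betw_def)
  then have "emb f X G" using Sf by (auto simp: emb_def is_iso_def induced_def bij_betw_def)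
  then show "\<exists>f. emb f X G" by blast
next
  assume "\<exists>f. emb f X G"
  then show "realized X G" unfolding realized_def isomorphic_def
    using is_embedding_iff_emb is_embedding_def by metis
qed

lemma emb_comp: "emb f A B \<Longrightarrow> emb g B C \<Longrightarrow> emb (g \<circ> f) A C"
  by (auto simp: emb_def inj_on_def image_subset_iff)

lemma emb_induced: "S \<subseteq> verts G \<Longrightarrow> emb (\<lambda>x. x) (induced G S) G"
  by (auto simp: emb_def induced_def)

lemma is_iso_emb: "is_iso f G H \<Longrightarrow> emb f G H"
  by (auto simp: is_iso_def emb_def bij_betw_def)

lemma is_iso_inv:
  assumes "is_iso f G H" shows "is_iso (inv_into (verts G) f) H G"
proof -
  let ?g = "inv_into (verts G) f"
  have f: "bij_betw f (verts G) (verts H)" using assms by (simp add: is_iso_def)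
  have g: "?g y \<in> verts G" "f (?g y) = y" if "y \<in> verts H" for y
    using bij_betw_apply[OF bij_betw_inv_into[OF f] that] bij_betw_inv_into_right[OF f that] by auto
  show ?thesis unfolding is_iso_def
  proof (intro conjI ballI)
    show "bij_betw ?g (verts H) (verts G)" by (rule bij_betw_inv_into[OF f])
    fix x assume x: "x \<in> verts H"
    then have "col H (f (?g x)) = col G (?g x)" using assms g(1) unfolding is_iso_def by blast
    then show "col G (?g x) = col H x" using g(2)[OF x] by simp
    fix y assume y: "y \<in> verts H"
    then have "adj H (f (?g x)) (f (?g y)) = adj G (?g x) (?g y)" using assms g(1) x unfolding is_iso_def by blast
    then show "adj G (?g x) (?g y) = adj H x y" using g(2)[OF x] g(2)[OF y] by simp
  qed
qed

text \<open>Transitivity of adjacency within a color replaces the partition, so that subgraphs and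
  one-vertex extensions can be checked on triples.\<close>

definition clq :: "'a cgraph \<Rightarrow> bool" where
  "clq G \<longleftrightarrow> simple_cgraph G \<and>
     (\<forall>x y z. adj G x y \<and> adj G y z \<and> x \<noteq> z \<and> col G x = col G y \<and> col G y = col G z \<longrightarrow> adj G x z)"

lemma disjoint_union_of_cliques_iff:
  assumes G: "simple_cgraph G"
  shows "disjoint_union_of_cliques G \<longleftrightarrow> (\<forall>x y z. adj G x y \<and> adj G y z \<and> x \<noteq> z \<longrightarrow> adj G x z)"
proof
  assume "disjoint_union_of_cliques G"
  then obtain P where P: "partition_on (verts G) P"
    "\<forall>x\<in>verts G. \<forall>y\<in>verts G. adj G x y \<longleftrightarrow> x \<noteq> y \<and> (\<exists>p\<in>P. x \<in> p \<and> y \<in> p)"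
    by (auto simp: disjoint_union_of_cliques_def)
  have P2: "adj G x y \<longleftrightarrow> x \<noteq> y \<and> (\<exists>p\<in>P. x \<in> p \<and> y \<in> p)" if "x \<in> verts G" "y \<in> verts G" for x y
    using P(2) that by blast
  have d: "p = q" if "p \<in> P" "q \<in> P" "x \<in> p" "x \<in> q" for p q x
    using partition_onD2[OF P(1)] that by (auto simp: disjoint_def)
  show "\<forall>x y z. adj G x y \<and> adj G y z \<and> x \<noteq> z \<longrightarrow> adj G x z"
  proof (intro allI impI, elim conjE)
    fix x y z assume *: "adj G x y" "adj G y z" "x \<noteq> z"
    then have v: "x \<in> verts G" "y \<in> verts G" "z \<in> verts G" using G by (auto simp: simple_cgraph_def)
    obtain p where p: "p \<in> P" "x \<in> p" "y \<in> p" using P2[OF v(1,2)] *(1) by blast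
    obtain q where q: "q \<in> P" "y \<in> q" "z \<in> q" using P2[OF v(2,3)] *(2) by blast
    have "p = q" by (rule d[OF p(1) q(1) p(3) q(2)])
    then show "adj G x z" using P2[OF v(1,3)] p q *(3) by blast
  qed
next
  assume t: "\<forall>x y z. adj G x y \<and> adj G y z \<and> x \<noteq> z \<longrightarrow> adj G x z"
  define r where "r = {(x, y). x \<in> verts G \<and> y \<in> verts G \<and> (x = y \<or> adj G x y)}"
  have s: "adj G x y \<Longrightarrow> x \<in> verts G \<and> y \<in> verts G \<and> x \<noteq> y \<and> adj G y x" for x y
    using G by (auto simp: simple_cgraph_def)
  have eq: "equiv (verts G) r"
  proof (rule equivI)
    show "r \<subseteq> verts G \<times> verts G" unfolding r_def by auto
    show "refl_on (verts G) r" unfolding refl_on_def r_def by auto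
    show "sym r" unfolding sym_def r_def using s by auto
    show "trans r" unfolding trans_def r_def using t by blast
  qed
  show "disjoint_union_of_cliques G" unfolding disjoint_union_of_cliques_def
  proof (intro exI conjI ballI)
    show "partition_on (verts G) (verts G // r)" using partition_on_quotient[OF eq] .
    fix x y assume v: "x \<in> verts G" "y \<in> verts G"
    have "(\<exists>p\<in>verts G // r. x \<in> p \<and> y \<in> p) \<longleftrightarrow> (x, y) \<in> r"
      using quotient_eq_iff[OF eq] eq_equiv_class_iff[OF eq] in_quotient_imp_in_rel[OF eq] v
        equiv_class_self[OF eq] quotientI[of _ "verts G" r]
      by (metis Image_singleton_iff empty_subsetI insert_subset)
    then show "adj G x y \<longleftrightarrow> x \<noteq> y \<and> (\<exists>p\<in>verts G // r. x \<in> p \<and> y \<in> p)"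
      using v s unfolding r_def by auto
  qed
qed

lemma simple_induced: "simple_cgraph G \<Longrightarrow> simple_cgraph (induced G S)"
  by (auto simp: simple_cgraph_def induced_def)

lemma clq_iff:
  "clq G \<longleftrightarrow> simple_cgraph G \<and> disjoint_union_of_cliques (induced G (color_class G Red)) \<and>
     disjoint_union_of_cliques (induced G (color_class G Blue))"
proof (cases "simple_cgraph G")
  case True
  then have v: "adj G x y \<Longrightarrow> x \<in> verts G \<and> y \<in> verts G" for x y by (auto simp: simple_cgraph_def)
  have d: "disjoint_union_of_cliques (induced G (color_class G c)) \<longleftrightarrow>
      (\<forall>x y z. adj G x y \<and> adj G y z \<and> x \<noteq> z \<and> col G x = c \<and> col G y = c \<and> col G z = c \<longrightarrow> adj G x z)" for c
  proof -
    have "(\<forall>x y z. adj (induced G (color_class G c)) x y \<and> adj (induced G (color_class G c)) y z \<and> x \<noteq> z \<longrightarrow> adj (induced G (color_class G c)) x z) \<longleftrightarrow>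
      (\<forall>x y z. adj G x y \<and> adj G y z \<and> x \<noteq> z \<and> col G x = c \<and> col G y = c \<and> col G z = c \<longrightarrow> adj G x z)"
      (is "?l \<longleftrightarrow> ?r")
    proof
      assume ?l
      show ?r
      proof (intro allI impI, elim conjE)
        fix x y z assume *: "adj G x y" "adj G y z" "x \<noteq> z" "col G x = c" "col G y = c" "col G z = c"
        have "adj (induced G (color_class G c)) x y" "adj (induced G (color_class G c)) y z"
          using * v[OF *(1)] v[OF *(2)] by (simp_all add: induced_def color_class_def)
        then have "adj (induced G (color_class G c)) x z" using \<open>?l\<close> *(3) by blast
        then show "adj G x z" by (simp add: induced_def)
      qed
    next
      assume ?r
      show ?l
      proof (intro allI impI, elim conjE)
        fix x y z assume *: "adj (induced G (color_class G c)) x y" "adj (induced G (color_class G c)) y z" "x \<noteq> z"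
        then have "adj G x y" "adj G y z" "col G x = c" "col G y = c" "col G z = c"
          by (simp_all add: induced_def color_class_def)
        then have "adj G x z" using \<open>?r\<close> *(3) by blast
        then show "adj (induced G (color_class G c)) x z" using * by (simp add: induced_def)
      qed
    qed
    then show ?thesis unfolding disjoint_union_of_cliques_iff[OF simple_induced[OF True]] .
  qed
  show ?thesis
  proof
    assume q: "clq G"
    have "disjoint_union_of_cliques (induced G (color_class G c))" for c
      unfolding d
    proof (intro allI impI, elim conjE)
      fix x y z assume a: "adj G x y" "adj G y z" "x \<noteq> z" "col G x = c" "col G y = c" "col G z = c"
      then have "col G x = col G y \<and> col G y = col G z" by simp
      then show "adj G x z" using a(1-3) q unfolding clq_def by blast
    qed
    then show "simple_cgraph G \<and> disjoint_union_of_cliques (induced G (color_class G Red)) \<and>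
      disjoint_union_of_cliques (induced G (color_class G Blue))" using True by blast
  next
    assume *: "simple_cgraph G \<and> disjoint_union_of_cliques (induced G (color_class G Red)) \<and>
      disjoint_union_of_cliques (induced G (color_class G Blue))"
    show "clq G" unfolding clq_def
    proof (intro conjI True allI impI, elim conjE)
      fix x y z assume a: "adj G x y" "adj G y z" "x \<noteq> z" "col G x = col G y" "col G y = col G z"
      have "disjoint_union_of_cliques (induced G (color_class G (col G z)))"
        using * by (cases "col G z") simp_all
      moreover have "col G x = col G z" using a by simp
      ultimately show "adj G x z" using a(1-3,5) unfolding d by blast
    qed
  qed
qed (simp add: clq_def)

lemma class_C_iff: "A \<in> class_C \<longleftrightarrow> clq A \<and> finite (verts A)"
  by (auto simp: class_C_def finite_cgraph_def clq_iff)

section \<open>A common description of the classes\<close>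

datatype clique_bound = One | Two | Unbounded

text \<open>Besides limiting the clique size, \<open>Two\<close> asks adjacent vertices to have
  complementary neighborhoods in the other color. By \<open>bound_Two_iff\<close> this is the joint
  omission of a triangle of color \<open>c\<close> and two mixed graphs.\<close>

fun bound :: "clique_bound \<Rightarrow> color \<Rightarrow> 'a cgraph \<Rightarrow> bool" where
  "bound One c G \<longleftrightarrow> (\<forall>x y. adj G x y \<longrightarrow> \<not> (col G x = c \<and> col G y = c))"
| "bound Two c G \<longleftrightarrow> (\<forall>x y. adj G x y \<and> col G x = c \<and> col G y = c \<longrightarrow>
     (\<forall>z\<in>verts G. (col G z = c \<longrightarrow> \<not> (adj G x z \<and> adj G y z)) \<and> (col G z \<noteq> c \<longrightarrow> adj G x z \<noteq> adj G y z)))"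
| "bound Unbounded c G \<longleftrightarrow> True"

definition even_cross :: "'a cgraph \<Rightarrow> bool" where
  "even_cross G \<longleftrightarrow> (\<forall>x y u v. adj G x y \<and> adj G u v \<and> col G x = Red \<and> col G y = Red \<and> col G u = Blue \<and> col G v = Blue \<longrightarrow>
     (adj G x u = adj G y u) = (adj G x v = adj G y v))"

text \<open>The bound is an \<open>enat\<close>, so that one family covers the classes with and
  without a limit on the number of red cliques.\<close>

definition indep_le :: "enat \<Rightarrow> 'a cgraph \<Rightarrow> bool" where
  "indep_le n G \<longleftrightarrow> (\<forall>I. finite I \<and> independent_set G I \<and> I \<subseteq> color_class G Red \<longrightarrow> enat (card I) \<le> n)"

definition admissible :: "clique_bound \<Rightarrow> clique_bound \<Rightarrow> enat \<Rightarrow> 'a cgraph \<Rightarrow> bool" where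
  "admissible kR kB n G \<longleftrightarrow> clq G \<and> even_cross G \<and> bound kR Red G \<and> bound kB Blue G \<and> indep_le n G"

definition adm_class :: "clique_bound \<Rightarrow> clique_bound \<Rightarrow> enat \<Rightarrow> nat cgraph set" where
  "adm_class kR kB n = {A. finite (verts A) \<and> admissible kR kB n A}"

text \<open>This reconciles the family with the classes that do not mention \<open>D_graph\<close>
  and \<open>D_tilde\<close>. Without blue edges there is nothing to check, and along a blue edge
  with complementary neighborhoods both red vertices change their value.\<close>

lemma even_cross_if_bound:
  assumes "simple_cgraph G" "bound kB Blue G" "kB \<noteq> Unbounded"
  shows "even_cross G"
proof -
  have s: "\<And>x y. adj G x y = adj G y x" "\<And>x y. adj G x y \<Longrightarrow> x \<in> verts G"
    using assms(1) by (auto simp: simple_cgraph_def)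
  show ?thesis
    unfolding even_cross_def
  proof (intro allI impI, elim conjE)
    fix x y u v assume *: "adj G x y" "adj G u v" "col G x = Red" "col G y = Red" "col G u = Blue" "col G v = Blue"
    have "kB \<noteq> One" using assms(2) *(2,5,6) by (metis bound.simps(1))
    then have kB: "kB = Two" using assms(3) by (cases kB) blast+
    have "adj G u z \<noteq> adj G v z" if "z \<in> verts G" "col G z = Red" for z
    proof -
      have "col G z \<noteq> Blue" using that by simp
      then show ?thesis using assms(2) *(2,5,6) that(1) unfolding kB bound.simps by blast
    qed
    note n = this
    have "adj G u x \<noteq> adj G v x" "adj G u y \<noteq> adj G v y"
      using n[of x] n[of y] s(2)[OF *(1)] s(2)[of y x] s(1)[of x y] *(1,3,4) by simp_all
    then show "(adj G x u = adj G y u) = (adj G x v = adj G y v)"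
      using s(1)[of u x] s(1)[of u y] s(1)[of v x] s(1)[of v y] by argo
  qed
qed

lemma adj_in_verts:
  assumes "simple_cgraph A" "adj A x y" shows "x \<in> verts A" "y \<in> verts A"
  using assms by (auto simp: simple_cgraph_def)

text \<open>All conditions are universal statements about vertices or finite vertex sets, so they
  can be pulled back along \<open>f\<close>.\<close>

lemma admissible_emb:
  assumes e: "emb f A G" and s: "simple_cgraph A" and G: "admissible kR kB n G"
  shows "admissible kR kB n A"
proof -
  have v: "adj A x y \<Longrightarrow> x \<in> verts A \<and> y \<in> verts A" for x y using adj_in_verts[OF s] by blast
  have a1: "adj G (f x) (f y) \<longleftrightarrow> adj A x y" "f x = f y \<longleftrightarrow> x = y"
    if "x \<in> verts A" "y \<in> verts A" for x y
    using e that by (auto simp: emb_def inj_on_def)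
  have a2: "col G (f x) = col A x" "f x \<in> verts G" if "x \<in> verts A" for x
    using e that by (auto simp: emb_def)
  note a = a1 a2
  have "clq A"
    unfolding clq_def
  proof (intro conjI s allI impI, elim conjE)
    fix x y z assume *: "adj A x y" "adj A y z" "x \<noteq> z" "col A x = col A y" "col A y = col A z"
    note vv = v[OF *(1)] v[OF *(2)]
    have "adj G (f x) (f y) \<and> adj G (f y) (f z) \<and> f x \<noteq> f z \<and> col G (f x) = col G (f y) \<and> col G (f y) = col G (f z)"
      using a vv * by simp
    then have "adj G (f x) (f z)" using G unfolding admissible_def clq_def by blast
    then show "adj A x z" using a vv by simp
  qed
  moreover have "even_cross A"
    unfolding even_cross_def
  proof (intro allI impI, elim conjE)
    fix x y u w assume *: "adj A x y" "adj A u w" "col A x = Red" "col A y = Red" "col A u = Blue" "col A w = Blue"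
    note vv = v[OF *(1)] v[OF *(2)]
    have "adj G (f x) (f y) \<and> adj G (f u) (f w) \<and> col G (f x) = Red \<and> col G (f y) = Red \<and> col G (f u) = Blue \<and> col G (f w) = Blue"
      using a vv * by simp
    then have "(adj G (f x) (f u) = adj G (f y) (f u)) = (adj G (f x) (f w) = adj G (f y) (f w))"
      using G unfolding admissible_def even_cross_def by blast
    then show "(adj A x u = adj A y u) = (adj A x w = adj A y w)" using a vv by simp
  qed
  moreover have "bound k c A" if b: "bound k c G" for k c
  proof (cases k)
    case One
    show ?thesis unfolding One bound.simps
    proof (intro allI impI notI)
      fix x y assume *: "adj A x y" "col A x = c \<and> col A y = c"
      then have "adj G (f x) (f y)" "col G (f x) = c" "col G (f y) = c" using a v[OF *(1)] by auto
      then show False using b One by auto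
    qed
  next
    case Two
    show ?thesis unfolding Two bound.simps
    proof (intro allI impI ballI)
      fix x y z assume *: "adj A x y \<and> col A x = c \<and> col A y = c" "z \<in> verts A"
      then have vv: "x \<in> verts A" "y \<in> verts A" using v by auto
      then have "adj G (f x) (f y) \<and> col G (f x) = c \<and> col G (f y) = c" "f z \<in> verts G" using a * by auto
      then have "(col G (f z) = c \<longrightarrow> \<not> (adj G (f x) (f z) \<and> adj G (f y) (f z))) \<and> (col G (f z) \<noteq> c \<longrightarrow> adj G (f x) (f z) \<noteq> adj G (f y) (f z))"
        using b unfolding Two bound.simps by blast
      then show "(col A z = c \<longrightarrow> \<not> (adj A x z \<and> adj A y z)) \<and> (col A z \<noteq> c \<longrightarrow> adj A x z \<noteq> adj A y z)"
        using a vv *(2) by simp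
    qed
  qed simp
  moreover have "indep_le n A"
    unfolding indep_le_def
  proof (intro allI impI, elim conjE)
    fix I assume I: "finite I" "independent_set A I" "I \<subseteq> color_class A Red"
    then have Iv: "I \<subseteq> verts A" by (auto simp: independent_set_def)
    have "finite (f ` I)" using I by simp
    moreover have "independent_set G (f ` I)" "f ` I \<subseteq> color_class G Red"
      using I Iv a unfolding independent_set_def color_class_def by (auto simp: subset_iff)
    ultimately have "enat (card (f ` I)) \<le> n" using G unfolding admissible_def indep_le_def by blast
    moreover have "inj_on f I" using e Iv unfolding emb_def by (meson inj_on_subset)
    ultimately show "enat (card I) \<le> n" by (simp add: card_image)
  qed
  ultimately show ?thesis using G unfolding admissible_def by auto
qed

section \<open>Omission of the listed graphs as conditions on vertices\<close>

lemma omits_mono_clique2: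
  assumes "simple_cgraph G"
  shows "omits G (mono_clique c 2) \<longleftrightarrow> bound One c G"
proof -
  have "realized (mono_clique c 2) G \<longleftrightarrow> (\<exists>x y. adj G x y \<and> col G x = c \<and> col G y = c)"
  proof
    assume "realized (mono_clique c 2) G"
    then obtain f where "emb f (mono_clique c 2) G" using realized_iff_emb by blast
    then have "adj G (f 0) (f 1)" "col G (f 0) = c" "col G (f 1) = c" by (auto simp: emb_def mono_clique_def)
    then show "\<exists>x y. adj G x y \<and> col G x = c \<and> col G y = c" by blast
  next
    assume "\<exists>x y. adj G x y \<and> col G x = c \<and> col G y = c"
    then obtain x y where xy: "adj G x y" "col G x = c" "col G y = c" by blast
    have "emb (\<lambda>i. if i = 0 then x else y) (mono_clique c 2) G"
      using xy assms by (auto simp: emb_def mono_clique_def simple_cgraph_def inj_on_def)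
    then show "realized (mono_clique c 2) G" using realized_iff_emb by blast
  qed
  then show ?thesis by (auto simp: omits_def)
qed

lemma realized_mono_clique3:
  assumes "simple_cgraph G"
  shows "realized (mono_clique c 3) G \<longleftrightarrow> (\<exists>x y z. adj G x y \<and> adj G y z \<and> adj G x z \<and> col G x = c \<and> col G y = c \<and> col G z = c)"
proof
  assume "realized (mono_clique c 3) G"
  then obtain f where "emb f (mono_clique c 3) G" using realized_iff_emb by blast
  then have "adj G (f 0) (f 1)" "adj G (f 1) (f 2)" "adj G (f 0) (f 2)" "col G (f 0) = c" "col G (f 1) = c" "col G (f 2) = c"
    by (auto simp: emb_def mono_clique_def)
  then show "\<exists>x y z. adj G x y \<and> adj G y z \<and> adj G x z \<and> col G x = c \<and> col G y = c \<and> col G z = c" by blast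
next
  assume "\<exists>x y z. adj G x y \<and> adj G y z \<and> adj G x z \<and> col G x = c \<and> col G y = c \<and> col G z = c"
  then obtain x y z where xy: "adj G x y" "adj G y z" "adj G x z" "col G x = c" "col G y = c" "col G z = c" by blast
  have v: "x \<in> verts G" "y \<in> verts G" "z \<in> verts G" "x \<noteq> y" "y \<noteq> z" "x \<noteq> z"
    "adj G y x" "adj G z y" "adj G z x" "\<And>x. \<not> adj G x x"
    using xy assms unfolding simple_cgraph_def by blast+
  have "emb (\<lambda>i. if i = 0 then x else if i = 1 then y else z) (mono_clique c 3) G"
    using xy v by (auto simp: emb_def mono_clique_def inj_on_def)
  then show "realized (mono_clique c 3) G" using realized_iff_emb by blast
qed

text \<open>One name for the four graphs \<open>T_r\<close>, \<open>T_b\<close> and their tilde versions: two adjacent \<open>c\<close>-vertices and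
  a vertex of the other color joined to both (\<open>t\<close>) or to neither.\<close>

definition tri :: "color \<Rightarrow> bool \<Rightarrow> nat cgraph" where
  "tri c t = (if c = Red then (if t then T_r else T_r_tilde) else (if t then T_b else T_b_tilde))"

lemma realized_tri:
  assumes s: "simple_cgraph G"
  shows "realized (tri c t) G \<longleftrightarrow> (\<exists>x y z. adj G x y \<and> col G x = c \<and> col G y = c \<and> z \<in> verts G \<and> col G z \<noteq> c \<and> adj G x z = t \<and> adj G y z = t)"
proof
  assume "realized (tri c t) G"
  then obtain f where f: "emb f (tri c t) G" using realized_iff_emb by blast
  show "\<exists>x y z. adj G x y \<and> col G x = c \<and> col G y = c \<and> z \<in> verts G \<and> col G z \<noteq> c \<and> adj G x z = t \<and> adj G y z = t"
  proof (cases c)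
    case Red
    have "adj G (f 1) (f 2) \<and> col G (f 1) = c \<and> col G (f 2) = c \<and> f 3 \<in> verts G \<and> col G (f 3) \<noteq> c \<and> adj G (f 1) (f 3) = t \<and> adj G (f 2) (f 3) = t"
      using f Red by (cases t) (auto simp: emb_def tri_def T_r_def T_r_tilde_def mk_cgraph_def doubleton_eq_iff)
    then show ?thesis by blast
  next
    case Blue
    have "adj G (f 2) (f 3) \<and> col G (f 2) = c \<and> col G (f 3) = c \<and> f 1 \<in> verts G \<and> col G (f 1) \<noteq> c \<and> adj G (f 2) (f 1) = t \<and> adj G (f 3) (f 1) = t"
      using f Blue by (cases t) (auto simp: emb_def tri_def T_b_def T_b_tilde_def mk_cgraph_def doubleton_eq_iff)
    then show ?thesis by blast
  qed
next
  assume "\<exists>x y z. adj G x y \<and> col G x = c \<and> col G y = c \<and> z \<in> verts G \<and> col G z \<noteq> c \<and> adj G x z = t \<and> adj G y z = t"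
  then obtain x y z where xy: "adj G x y" "col G x = c" "col G y = c" "z \<in> verts G" "col G z \<noteq> c" "adj G x z = t" "adj G y z = t" by blast
  have v: "x \<in> verts G" "y \<in> verts G" "x \<noteq> y" "adj G y x" "adj G z x = t" "adj G z y = t" "z \<noteq> x" "z \<noteq> y" "\<And>x. \<not> adj G x x"
    using xy s by (auto simp: simple_cgraph_def)
  show "realized (tri c t) G"
  proof (cases c)
    case Red
    then have "col G z = Blue" using xy by (cases "col G z") auto
    then have "emb (\<lambda>i. if i = 1 then x else if i = 2 then y else z) (tri c t) G"
      using xy v Red by (cases t) (auto simp: emb_def tri_def T_r_def T_r_tilde_def mk_cgraph_def inj_on_def doubleton_eq_iff)
    then show ?thesis using realized_iff_emb by blast
  next
    case Blue
    then have "col G z = Red" using xy by (cases "col G z") auto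
    then have "emb (\<lambda>i. if i = 1 then z else if i = 2 then x else y) (tri c t) G"
      using xy v Blue by (cases t) (auto simp: emb_def tri_def T_b_def T_b_tilde_def mk_cgraph_def inj_on_def doubleton_eq_iff)
    then show ?thesis using realized_iff_emb by blast
  qed
qed

lemma bound_Two_iff:
  assumes "simple_cgraph G"
  shows "bound Two c G \<longleftrightarrow> omits G (mono_clique c 3) \<and> omits G (tri c True) \<and> omits G (tri c False)"
proof -
  have s: "\<And>x y. adj G x y \<Longrightarrow> x \<in> verts G \<and> y \<in> verts G" using assms by (auto simp: simple_cgraph_def)
  show ?thesis unfolding omits_def realized_mono_clique3[OF assms] realized_tri[OF assms]
  proof
    assume b: "bound Two c G"
    have b': "(col G z = c \<longrightarrow> \<not> (adj G x z \<and> adj G y z)) \<and> (col G z \<noteq> c \<longrightarrow> adj G x z \<noteq> adj G y z)"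
      if "adj G x y" "col G x = c" "col G y = c" "z \<in> verts G" for x y z
      using b that unfolding bound.simps by blast
    show "\<not> (\<exists>x y z. adj G x y \<and> adj G y z \<and> adj G x z \<and> col G x = c \<and> col G y = c \<and> col G z = c) \<and>
      \<not> (\<exists>x y z. adj G x y \<and> col G x = c \<and> col G y = c \<and> z \<in> verts G \<and> col G z \<noteq> c \<and> adj G x z = True \<and> adj G y z = True) \<and>
      \<not> (\<exists>x y z. adj G x y \<and> col G x = c \<and> col G y = c \<and> z \<in> verts G \<and> col G z \<noteq> c \<and> adj G x z = False \<and> adj G y z = False)"
      using b' s by blast
  next
    assume *: "\<not> (\<exists>x y z. adj G x y \<and> adj G y z \<and> adj G x z \<and> col G x = c \<and> col G y = c \<and> col G z = c) \<and>
      \<not> (\<exists>x y z. adj G x y \<and> col G x = c \<and> col G y = c \<and> z \<in> verts G \<and> col G z \<noteq> c \<and> adj G x z = True \<and> adj G y z = True) \<and>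
      \<not> (\<exists>x y z. adj G x y \<and> col G x = c \<and> col G y = c \<and> z \<in> verts G \<and> col G z \<noteq> c \<and> adj G x z = False \<and> adj G y z = False)"
    show "bound Two c G" unfolding bound.simps
      by (intro allI impI ballI conjI) (use * in blast)+
  qed
qed

text \<open>\<open>D_graph\<close> and \<open>D_tilde\<close> arise from each other by complementing
  the cross edges. With \<open>t\<close> for the common value of three of the four cross pairs, one
  statement covers both.\<close>

lemma realized_four:
  assumes s: "simple_cgraph G"
  shows "realized (if t then D_graph else D_tilde) G \<longleftrightarrow>
    (\<exists>x y u v. adj G x y \<and> adj G u v \<and> col G x = Red \<and> col G y = Red \<and> col G u = Blue \<and> col G v = Blue \<and>
       adj G x u = t \<and> adj G x v = t \<and> adj G y u = t \<and> adj G y v = (\<not> t))"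
proof
  assume "realized (if t then D_graph else D_tilde) G"
  then obtain f where f: "emb f (if t then D_graph else D_tilde) G" using realized_iff_emb by blast
  have "adj G (f 1) (f 2) \<and> adj G (f 3) (f 4) \<and> col G (f 1) = Red \<and> col G (f 2) = Red \<and> col G (f 3) = Blue \<and> col G (f 4) = Blue \<and>
    adj G (f 1) (f 3) = t \<and> adj G (f 1) (f 4) = t \<and> adj G (f 2) (f 3) = t \<and> adj G (f 2) (f 4) = (\<not> t)"
    using f by (cases t) (auto simp: emb_def D_graph_def D_tilde_def mk_cgraph_def doubleton_eq_iff)
  then show "\<exists>x y u v. adj G x y \<and> adj G u v \<and> col G x = Red \<and> col G y = Red \<and> col G u = Blue \<and> col G v = Blue \<and>
       adj G x u = t \<and> adj G x v = t \<and> adj G y u = t \<and> adj G y v = (\<not> t)" by blast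
next
  assume "\<exists>x y u v. adj G x y \<and> adj G u v \<and> col G x = Red \<and> col G y = Red \<and> col G u = Blue \<and> col G v = Blue \<and>
       adj G x u = t \<and> adj G x v = t \<and> adj G y u = t \<and> adj G y v = (\<not> t)"
  then obtain x y u v where xy: "adj G x y" "adj G u v" "col G x = Red" "col G y = Red" "col G u = Blue" "col G v = Blue"
       "adj G x u = t" "adj G x v = t" "adj G y u = t" "adj G y v = (\<not> t)" by blast
  have v: "x \<in> verts G" "y \<in> verts G" "u \<in> verts G" "v \<in> verts G" "x \<noteq> y" "u \<noteq> v" "adj G y x" "adj G v u"
    "adj G u x = t" "adj G v x = t" "adj G u y = t" "adj G v y = (\<not> t)" "\<And>x. \<not> adj G x x"
    using xy s by (auto simp: simple_cgraph_def)
  have ne: "x \<noteq> u" "x \<noteq> v" "y \<noteq> u" "y \<noteq> v" "u \<noteq> x" "v \<noteq> x" "u \<noteq> y" "v \<noteq> y" using xy by auto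
  have "emb (\<lambda>i. if i = 1 then x else if i = 2 then y else if i = 3 then u else v) (if t then D_graph else D_tilde) G"
    using xy v ne by (cases t) (auto simp: emb_def D_graph_def D_tilde_def mk_cgraph_def inj_on_def doubleton_eq_iff)
  then show "realized (if t then D_graph else D_tilde) G" using realized_iff_emb by blast
qed

lemma even_cross_iff:
  assumes s: "simple_cgraph G"
  shows "even_cross G \<longleftrightarrow> omits G D_graph \<and> omits G D_tilde"
proof -
  have sy: "\<And>x y. adj G x y \<Longrightarrow> adj G y x" using s by (auto simp: simple_cgraph_def)
  have *: "omits G D_graph \<longleftrightarrow> \<not> realized (if True then D_graph else D_tilde) G"
    "omits G D_tilde \<longleftrightarrow> \<not> realized (if False then D_graph else D_tilde) G"
    by (simp_all add: omits_def)
  show ?thesis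
  proof
    assume e: "even_cross G"
    have "(adj G x u = adj G y u) = (adj G x v = adj G y v)"
      if "adj G x y" "adj G u v" "col G x = Red" "col G y = Red" "col G u = Blue" "col G v = Blue" for x y u v
      using e that unfolding even_cross_def by blast
    then show "omits G D_graph \<and> omits G D_tilde" unfolding * realized_four[OF s] by blast
  next
    assume o: "omits G D_graph \<and> omits G D_tilde"
    have n: "\<not> (adj G x u = t \<and> adj G x v = t \<and> adj G y u = t \<and> adj G y v = (\<not> t))"
      if "adj G x y" "adj G u v" "col G x = Red" "col G y = Red" "col G u = Blue" "col G v = Blue" for x y u v t
      using o that unfolding * realized_four[OF s] by (cases t) blast+
    show "even_cross G" unfolding even_cross_def
    proof (intro allI impI, elim conjE)
      fix x y u v assume a: "adj G x y" "adj G u v" "col G x = Red" "col G y = Red" "col G u = Blue" "col G v = Blue"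
      note a' = sy[OF a(1)] sy[OF a(2)]
      show "(adj G x u = adj G y u) = (adj G x v = adj G y v)"
        \<comment> \<open>The exceptional pair may be any of the four; exchanging \<open>x\<close>
          with \<open>y\<close>, or \<open>u\<close> with \<open>v\<close>, brings it to
          \<open>y\<close>, \<open>v\<close>.\<close>
        using n[OF a] n[OF a'(1) a(2,4,3,5,6)] n[OF a(1) a'(2) a(3,4,6,5)] n[OF a'(1,2) a(4,3,6,5)]
        by (metis (full_types))
    qed
  qed
qed

lemma realized_mono_indep:
  "realized (mono_indep c n) G \<longleftrightarrow> (\<exists>I. finite I \<and> independent_set G I \<and> I \<subseteq> color_class G c \<and> card I = n)"
proof
  assume "realized (mono_indep c n) G"
  then obtain f where f: "emb f (mono_indep c n) G" using realized_iff_emb by blast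
  then show "\<exists>I. finite I \<and> independent_set G I \<and> I \<subseteq> color_class G c \<and> card I = n"
    by (intro exI[of _ "f ` {..<n}"])
      (auto simp: emb_def mono_indep_def independent_set_def color_class_def card_image)
next
  assume "\<exists>I. finite I \<and> independent_set G I \<and> I \<subseteq> color_class G c \<and> card I = n"
  then obtain I where I: "finite I" "independent_set G I" "I \<subseteq> color_class G c" "card I = n" by blast
  then obtain f where f: "bij_betw f {..<n} I"
    by (metis card_lessThan finite_lessThan finite_same_card_bij)
  have "f i \<in> I" if "i < n" for i using f that by (auto simp: bij_betw_def)
  then have "emb f (mono_indep c n) G"
    using f I by (auto simp: emb_def mono_indep_def independent_set_def color_class_def bij_betw_def subset_iff)
  then show "realized (mono_indep c n) G" using realized_iff_emb by blast
qed

lemma indep_le_iff: "indep_le (enat n) G \<longleftrightarrow> omits G (mono_indep Red (n + 1))"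
proof
  assume "indep_le (enat n) G"
  then show "omits G (mono_indep Red (n + 1))"
    unfolding omits_def realized_mono_indep indep_le_def by (metis add.commute enat_ord_simps(1) not_less_eq_eq order_refl plus_1_eq_Suc)
next
  assume o: "omits G (mono_indep Red (n + 1))"
  show "indep_le (enat n) G"
    unfolding indep_le_def
  proof (intro allI impI, rule ccontr, elim conjE)
    fix I assume I: "finite I" "independent_set G I" "I \<subseteq> color_class G Red" "\<not> enat (card I) \<le> enat n"
    then have "n + 1 \<le> card I" by simp
    then obtain J where J: "J \<subseteq> I" "card J = n + 1" by (meson obtain_subset_with_card_n)
    then have "finite J \<and> independent_set G J \<and> J \<subseteq> color_class G Red \<and> card J = n + 1"
      using I finite_subset[OF J(1) I(1)] unfolding independent_set_def by blast
    then show False using o unfolding omits_def realized_mono_indep by blast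
  qed
qed

lemma indep_le_infinity: "indep_le \<infinity> G"
  by (simp add: indep_le_def)

lemma class_equalities:
  shows K_w_1_fin_eq: "K_w_1_fin n = adm_class Unbounded One (enat n)"
    and K_w_2_fin_eq: "K_w_2_fin n = adm_class Unbounded Two (enat n)"
    and K_2_1_eq: "K_2_1 = adm_class Two One \<infinity>"
    and K_w_1_eq: "K_w_1 = adm_class Unbounded One \<infinity>"
    and K_2_2_eq: "K_2_2 = adm_class Two Two \<infinity>"
    and K_w_2_eq: "K_w_2 = adm_class Unbounded Two \<infinity>"
    and K_w_w_eq: "K_w_w = adm_class Unbounded Unbounded \<infinity>"
proof -
  have s: "clq A \<Longrightarrow> simple_cgraph A" for A :: "nat cgraph" by (simp add: clq_def)
  note defs = omitting_def adm_class_def admissible_def class_C_iff indep_le_iff indep_le_infinity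
  have b: "bound One c A \<longleftrightarrow> omits A (mono_clique c 2)"
    "bound Two Red A \<longleftrightarrow> omits A (mono_clique Red 3) \<and> omits A T_r \<and> omits A T_r_tilde"
    "bound Two Blue A \<longleftrightarrow> omits A (mono_clique Blue 3) \<and> omits A T_b \<and> omits A T_b_tilde"
    "even_cross A \<longleftrightarrow> omits A D_graph \<and> omits A D_tilde"
    if "clq A" for c and A :: "nat cgraph"
    using omits_mono_clique2[OF s[OF that]] bound_Two_iff[OF s[OF that]] even_cross_iff[OF s[OF that]]
    by (simp_all add: tri_def)
  have e: "even_cross A" if "clq A" "bound One Blue A \<or> bound Two Blue A" for A :: "nat cgraph"
    using even_cross_if_bound[OF s[OF that(1)]] that(2) by blast
  show "K_w_1_fin n = adm_class Unbounded One (enat n)"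
    unfolding K_w_1_fin_def using b e by (auto simp: defs simp del: bound.simps(1,2))
  show "K_w_2_fin n = adm_class Unbounded Two (enat n)"
    unfolding K_w_2_fin_def using b e by (auto simp: defs simp del: bound.simps(1,2))
  show "K_2_1 = adm_class Two One \<infinity>"
    unfolding K_2_1_def using b e by (auto simp: defs simp del: bound.simps(1,2))
  show "K_w_1 = adm_class Unbounded One \<infinity>"
    unfolding K_w_1_def using b e by (auto simp: defs simp del: bound.simps(1,2))
  show "K_2_2 = adm_class Two Two \<infinity>"
    unfolding K_2_2_def using b e by (auto simp: defs simp del: bound.simps(1,2))
  show "K_w_2 = adm_class Unbounded Two \<infinity>"
    unfolding K_w_2_def using b e by (auto simp: defs simp del: bound.simps(1,2))
  show "K_w_w = adm_class Unbounded Unbounded \<infinity>"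
    unfolding K_w_w_def using b e by (auto simp: defs simp del: bound.simps(1,2))
qed

section \<open>Amalgamation of admissible graphs\<close>

definition add_vertex :: "'a cgraph \<Rightarrow> 'a \<Rightarrow> color \<Rightarrow> 'a set \<Rightarrow> 'a cgraph" where
  "add_vertex C x c N = \<lparr>verts = insert x (verts C),
     adj = (\<lambda>u v. if u = x then v \<noteq> x \<and> v \<in> N else if v = x then u \<in> N else adj C u v),
     col = (col C)(x := c)\<rparr>"

lemma add_vertex_simps:
  assumes "x \<notin> verts C" "N \<subseteq> verts C"
  shows "verts (add_vertex C x c N) = insert x (verts C)"
    "adj (add_vertex C x c N) x v \<longleftrightarrow> v \<in> N"
    "adj (add_vertex C x c N) v x \<longleftrightarrow> v \<in> N"
    "u \<noteq> x \<Longrightarrow> v \<noteq> x \<Longrightarrow> adj (add_vertex C x c N) u v \<longleftrightarrow> adj C u v"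
    "col (add_vertex C x c N) x = c"
    "u \<noteq> x \<Longrightarrow> col (add_vertex C x c N) u = col C u"
  using assms by (auto simp: add_vertex_def)

text \<open>\<open>even_cross\<close> lists the red edge first. This form starts from either color,
  because the vertex added in the amalgamation may have either.\<close>

lemma even_crossD:
  assumes "even_cross G" "simple_cgraph G" "adj G x y" "adj G u v" "col G x = c" "col G y = c" "col G u \<noteq> c" "col G v \<noteq> c"
  shows "(adj G x u = adj G y u) = (adj G x v = adj G y v)"
proof -
  have s: "adj G a b = adj G b a" for a b using assms(2) by (auto simp: simple_cgraph_def)
  have e: "(adj G x u = adj G y u) = (adj G x v = adj G y v)"
    if "adj G x y" "adj G u v" "col G x = Red" "col G y = Red" "col G u = Blue" "col G v = Blue" for x y u v
    using assms(1) that unfolding even_cross_def by blast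
  show ?thesis
  proof (cases c)
    case Red
    then have "col G u = Blue" "col G v = Blue" using assms(7,8) by (metis color.exhaust)+
    then show ?thesis using e[OF assms(3,4)] assms(5,6) Red by simp
  next
    case Blue
    then have "col G u = Red" "col G v = Red" using assms(7,8) by (metis color.exhaust)+
    then have "(adj G u x = adj G v x) = (adj G u y = adj G v y)"
      using e[OF assms(4,3)] assms(5,6) Blue by simp
    then show ?thesis using s[of x u] s[of x v] s[of y u] s[of y v] by argo
  qed
qed

lemma even_crossI:
  assumes "\<And>x y u v. adj G x y \<Longrightarrow> adj G u v \<Longrightarrow> col G x = c \<Longrightarrow> col G y = c \<Longrightarrow> col G u \<noteq> c \<Longrightarrow> col G v \<noteq> c \<Longrightarrow>
     (adj G x u = adj G y u) = (adj G x v = adj G y v)" and sc: "simple_cgraph G"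
  shows "even_cross G"
  unfolding even_cross_def
proof (intro allI impI, elim conjE)
  fix x y u v assume *: "adj G x y" "adj G u v" "col G x = Red" "col G y = Red" "col G u = Blue" "col G v = Blue"
  have s: "adj G a b = adj G b a" for a b using sc by (auto simp: simple_cgraph_def)
  show "(adj G x u = adj G y u) = (adj G x v = adj G y v)"
  proof (cases c)
    case Red then show ?thesis using assms(1)[OF *(1,2)] * by simp
  next
    case Blue
    have "(adj G u x = adj G v x) = (adj G u y = adj G v y)"
      by (rule assms(1)[OF *(2,1)]) (use * Blue in simp_all)
    then show ?thesis using s[of x u] s[of x v] s[of y u] s[of y v] by argo
  qed
qed

abbreviation bound_of :: "clique_bound \<Rightarrow> clique_bound \<Rightarrow> color \<Rightarrow> clique_bound" where
  "bound_of kR kB c \<equiv> (case c of Red \<Rightarrow> kR | Blue \<Rightarrow> kB)"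

lemma admissible_bound: "admissible kR kB n G \<Longrightarrow> bound (bound_of kR kB c) c G"
  by (cases c) (simp_all add: admissible_def)

lemma admissible_parts:
  assumes "admissible kR kB n G"
  shows "simple_cgraph G" "even_cross G" "indep_le n G"
    "\<And>x y z. adj G x y \<Longrightarrow> adj G y z \<Longrightarrow> x \<noteq> z \<Longrightarrow> col G x = col G y \<Longrightarrow> col G y = col G z \<Longrightarrow> adj G x z"
  using assms unfolding admissible_def clq_def by blast+

text \<open>The hypotheses are the ways in which the new vertex can spoil a condition.
  \<open>closed\<close> and \<open>clique\<close> make its neighbors of its own color empty or a
  full clique. Only red vertices affect the sets counted by \<open>n\<close>, hence the guard of
  \<open>ind\<close>.\<close>

lemma admissible_add_vertex:
  assumes C: "admissible kR kB n C" and x: "x \<notin> verts C" and N: "N \<subseteq> verts C"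
    and closed: "\<And>u v. u \<in> N \<Longrightarrow> adj C u v \<Longrightarrow> col C u = c \<Longrightarrow> col C v = c \<Longrightarrow> v \<in> N"
    and clique: "\<And>u v. u \<in> N \<Longrightarrow> v \<in> N \<Longrightarrow> u \<noteq> v \<Longrightarrow> col C u = c \<Longrightarrow> col C v = c \<Longrightarrow> adj C u v"
    and one: "\<And>u. bound_of kR kB c = One \<Longrightarrow> u \<in> N \<Longrightarrow> col C u \<noteq> c"
    and two: "\<And>u z. bound_of kR kB c = Two \<Longrightarrow> u \<in> N \<Longrightarrow> col C u = c \<Longrightarrow> z \<in> verts C \<Longrightarrow>
        (col C z = c \<longrightarrow> \<not> adj C u z) \<and> (col C z \<noteq> c \<longrightarrow> adj C u z \<noteq> (z \<in> N))"
    and two': "\<And>u v. bound_of kR kB (other c) = Two \<Longrightarrow> adj C u v \<Longrightarrow> col C u \<noteq> c \<Longrightarrow> col C v \<noteq> c \<Longrightarrow> u \<in> N \<longleftrightarrow> v \<notin> N"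
    and par: "\<And>r b b'. r \<in> N \<Longrightarrow> col C r = c \<Longrightarrow> adj C b b' \<Longrightarrow> col C b \<noteq> c \<Longrightarrow> col C b' \<noteq> c \<Longrightarrow>
        ((b \<in> N) = adj C r b) = ((b' \<in> N) = adj C r b')"
    and ind: "c = Red \<Longrightarrow> indep_le n (add_vertex C x c N)"
  shows "admissible kR kB n (add_vertex C x c N)"
proof -
  let ?D = "add_vertex C x c N"
  note D = add_vertex_simps[OF x N, where c = c]
  note C' = admissible_parts[OF C]
  have s: "adj C u v \<Longrightarrow> u \<in> verts C \<and> v \<in> verts C \<and> u \<noteq> v \<and> adj C v u" for u v
    using C'(1) by (auto simp: simple_cgraph_def)
  have Nx: "u \<in> N \<Longrightarrow> u \<in> verts C \<and> u \<noteq> x" for u using N x by blast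
  have sD: "simple_cgraph ?D"
    unfolding simple_cgraph_def
  proof (intro allI impI)
    fix u v assume a: "adj ?D u v"
    show "u \<in> verts ?D \<and> v \<in> verts ?D \<and> u \<noteq> v \<and> adj ?D v u"
    proof (cases "u = x")
      case True then show ?thesis using a D Nx[of v] by auto
    next
      case u: False
      show ?thesis
      proof (cases "v = x")
        case True then show ?thesis using a D Nx[of u] by auto
      next
        case False then show ?thesis using a u s[of u v] D by auto
      qed
    qed
  qed
  have sym: "adj ?D u v \<Longrightarrow> adj ?D v u" for u v using sD unfolding simple_cgraph_def by blast
  have "clq ?D" unfolding clq_def
  proof (intro conjI sD allI impI, elim conjE)
    fix u v w assume a: "adj ?D u v" "adj ?D v w" "u \<noteq> w" "col ?D u = col ?D v" "col ?D v = col ?D w"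
    consider "u = x" | "v = x" | "w = x" | "u \<noteq> x" "v \<noteq> x" "w \<noteq> x" by blast
    then show "adj ?D u w"
    proof cases
      case 1
      then have v: "v \<in> N" "v \<noteq> x" "w \<noteq> x" using a D Nx[of v] by auto
      then have "adj C v w" "col C v = c" "col C w = c" using a D 1 by auto
      then show ?thesis using closed[of v w] v D 1 by auto
    next
      case 2
      then have v: "u \<in> N" "w \<in> N" "u \<noteq> x" "w \<noteq> x" using a D Nx[of u] Nx[of w] by auto
      then have "col C u = c" "col C w = c" using a D 2 by auto
      then show ?thesis using clique[of u w] v D 2 a(3) by auto
    next
      case 3
      then have v: "v \<in> N" "v \<noteq> x" "u \<noteq> x" using a D Nx[of v] by auto
      then have "adj C v u" "col C v = c" "col C u = c" using a D 3 s by auto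
      then show ?thesis using closed[of v u] v D 3 by auto
    next
      case 4 then show ?thesis using a D C'(4)[of u v w] by auto
    qed
  qed
  moreover have "even_cross ?D"
  proof (rule even_crossI[OF _ sD])
    fix u v b b' assume a: "adj ?D u v" "adj ?D b b'" "col ?D u = c" "col ?D v = c" "col ?D b \<noteq> c" "col ?D b' \<noteq> c"
    have bx: "b \<noteq> x" "b' \<noteq> x" using a D by auto
    then have b: "adj C b b'" "col C b \<noteq> c" "col C b' \<noteq> c" using a D by auto
    consider "u = x" | "v = x" | "u \<noteq> x" "v \<noteq> x" by blast
    then show "(adj ?D u b = adj ?D v b) = (adj ?D u b' = adj ?D v b')"
    proof cases
      case 1
      then have v: "v \<in> N" "v \<noteq> x" using a D Nx[of v] by auto
      then have "col C v = c" using a D by auto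
      then show ?thesis using par[of v b b'] v b bx 1 D by auto
    next
      case 2
      then have v: "u \<in> N" "u \<noteq> x" using a D Nx[of u] by auto
      then have "col C u = c" using a D by auto
      then show ?thesis using par[of u b b'] v b bx 2 D by auto
    next
      case 3
      then have "adj C u v" "col C u = c" "col C v = c" using a D by auto
      then show ?thesis using even_crossD[OF C'(2,1) _ b(1), of u v c] b 3 bx D by auto
    qed
  qed
  moreover have "bound (bound_of kR kB c) c ?D"
  proof (cases "bound_of kR kB c")
    case One
    have "\<not> (col ?D u = c \<and> col ?D v = c)" if a: "adj ?D u v" for u v
    proof
      assume c: "col ?D u = c \<and> col ?D v = c"
      consider "u = x" | "v = x" | "u \<noteq> x" "v \<noteq> x" by blast
      then show False
      proof cases
        case 1 then show ?thesis using a c D Nx[of v] one[OF One, of v] by auto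
      next
        case 2 then show ?thesis using a c D Nx[of u] one[OF One, of u] by auto
      next
        case 3 then show ?thesis using a c D admissible_bound[OF C, of c] One by auto
      qed
    qed
    then show ?thesis using One by simp
  next
    case Two
    have bC: "(col C z = c \<longrightarrow> \<not> (adj C u z \<and> adj C v z)) \<and> (col C z \<noteq> c \<longrightarrow> adj C u z \<noteq> adj C v z)"
      if "adj C u v" "col C u = c" "col C v = c" "z \<in> verts C" for u v z
      using admissible_bound[OF C, of c] that unfolding Two bound.simps by blast
    have *: "(col ?D z = c \<longrightarrow> \<not> (adj ?D x z \<and> adj ?D v z)) \<and> (col ?D z \<noteq> c \<longrightarrow> adj ?D x z \<noteq> adj ?D v z)"
      if v: "v \<in> N" "col C v = c" and z: "z \<in> verts ?D" for v z
    proof (cases "z = x")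
      case True then show ?thesis using D x N by auto
    next
      case False
      then have "z \<in> verts C" using z D by simp
      then show ?thesis using two[OF Two v, of z] False D Nx[OF v(1)] clique[of v z] v by auto
    qed
    show ?thesis unfolding Two bound.simps
    proof (intro allI impI ballI, elim conjE)
      fix u v z assume a: "adj ?D u v" "col ?D u = c" "col ?D v = c" and z: "z \<in> verts ?D"
      consider "u = x" | "v = x" | "u \<noteq> x" "v \<noteq> x" by blast
      then show "(col ?D z = c \<longrightarrow> \<not> (adj ?D u z \<and> adj ?D v z)) \<and> (col ?D z \<noteq> c \<longrightarrow> adj ?D u z \<noteq> adj ?D v z)"
      proof cases
        case 1
        then have "v \<in> N" "col C v = c" using a D Nx[of v] by auto
        then show ?thesis using *[of v z] z 1 by auto
      next
        case 2
        then have "u \<in> N" "col C u = c" using a D Nx[of u] by auto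
        then show ?thesis using *[of u z] z 2 by auto
      next
        case 3
        then have a': "adj C u v" "col C u = c" "col C v = c" using a D by auto
        show ?thesis
        proof (cases "z = x")
          case True
          have "\<not> (u \<in> N \<and> v \<in> N)" using two[OF Two, of u v] a' s[OF a'(1)] by blast
          then show ?thesis using True D by auto
        next
          case False
          then have "z \<in> verts C" using z D by simp
          then show ?thesis using bC[OF a'] False 3 D by auto
        qed
      qed
    qed
  next
    case Unbounded then show ?thesis by simp
  qed
  moreover have "bound (bound_of kR kB (other c)) (other c) ?D"
  proof -
    have oc: "d = other c \<longleftrightarrow> d \<noteq> c" for d by (cases c; cases d) auto
    have xo: "col ?D u = other c \<Longrightarrow> u \<noteq> x" for u using D oc by auto
    show ?thesis
    proof (cases "bound_of kR kB (other c)")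
      case One
      have "\<not> (col ?D u = other c \<and> col ?D v = other c)" if a: "adj ?D u v" for u v
      proof
        assume c: "col ?D u = other c \<and> col ?D v = other c"
        then have "u \<noteq> x" "v \<noteq> x" using xo by blast+
        then show False using a c D admissible_bound[OF C, of "other c"] One by auto
      qed
      then show ?thesis using One by simp
    next
      case Two
      have bC: "(col C z = other c \<longrightarrow> \<not> (adj C u z \<and> adj C v z)) \<and> (col C z \<noteq> other c \<longrightarrow> adj C u z \<noteq> adj C v z)"
        if "adj C u v" "col C u = other c" "col C v = other c" "z \<in> verts C" for u v z
        using admissible_bound[OF C, of "other c"] that unfolding Two bound.simps by blast
      show ?thesis unfolding Two bound.simps
      proof (intro allI impI ballI, elim conjE)
        fix u v z assume a: "adj ?D u v" "col ?D u = other c" "col ?D v = other c" and z: "z \<in> verts ?D"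
        have ux: "u \<noteq> x" "v \<noteq> x" using xo a by auto
        then have a': "adj C u v" "col C u = other c" "col C v = other c" using a D by auto
        show "(col ?D z = other c \<longrightarrow> \<not> (adj ?D u z \<and> adj ?D v z)) \<and> (col ?D z \<noteq> other c \<longrightarrow> adj ?D u z \<noteq> adj ?D v z)"
        proof (cases "z = x")
          case True
          then show ?thesis using two'[OF Two a'(1)] a' oc D ux by auto
        next
          case False
          then have "z \<in> verts C" using z D by simp
          then show ?thesis using bC[OF a'] False ux D by auto
        qed
      qed
    qed simp
  qed
  moreover have "indep_le n ?D"
  proof (cases c)
    case Red then show ?thesis using ind by simp
  next
    case Blue
    show ?thesis unfolding indep_le_def
    proof (intro allI impI, elim conjE)
      fix I assume I: "finite I" "independent_set ?D I" "I \<subseteq> color_class ?D Red"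
      have nx: "u \<in> I \<Longrightarrow> u \<noteq> x" for u using I(3) D Blue by (auto simp: color_class_def)
      have "u \<in> verts C \<and> col C u = Red" if "u \<in> I" for u
        using I(3) nx[OF that] that D unfolding color_class_def by auto
      moreover have "\<not> adj C u v" if "u \<in> I" "v \<in> I" for u v
        using I(2) nx that D unfolding independent_set_def by metis
      ultimately have "independent_set C I" "I \<subseteq> color_class C Red"
        unfolding independent_set_def color_class_def by blast+
      then show "enat (card I) \<le> n" using C'(3) I(1) unfolding indep_le_def by blast
    qed
  qed
  ultimately show ?thesis unfolding admissible_def by (cases c) simp_all
qed


text \<open>The new vertex \<open>x\<close> joins the clique of \<open>r0\<close>. On every clique of the other color it must then be
  equal or opposite to \<open>r0\<close>; if that clique does not meet \<open>S\<close>, it is made opposite.\<close>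

lemma one_point_join:
  assumes C: "admissible kR kB n C" and S: "S \<subseteq> verts C" and x: "x \<notin> verts C" and M: "M \<subseteq> S"
    and r0: "r0 \<in> verts C" "col C r0 = c"
    and same: "\<And>s. s \<in> S \<Longrightarrow> col C s = c \<Longrightarrow> s \<in> M \<longleftrightarrow> s = r0 \<or> adj C r0 s"
    and cross: "\<And>s t. s \<in> S \<Longrightarrow> t \<in> S \<Longrightarrow> adj C s t \<Longrightarrow> col C s \<noteq> c \<Longrightarrow> col C t \<noteq> c \<Longrightarrow>
       ((s \<in> M) = adj C r0 s) = ((t \<in> M) = adj C r0 t)"
    and one: "bound_of kR kB c \<noteq> One"
    and two: "bound_of kR kB c = Two \<Longrightarrow> (\<forall>z. adj C r0 z \<longrightarrow> col C z \<noteq> c) \<and>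
       (\<forall>s\<in>S. col C s \<noteq> c \<longrightarrow> (s \<in> M) \<noteq> adj C r0 s)"
  shows "\<exists>N\<subseteq>verts C. N \<inter> S = M \<and> admissible kR kB n (add_vertex C x c N)"
proof -
  note C' = admissible_parts[OF C]
  have s: "adj C u v \<Longrightarrow> u \<in> verts C \<and> v \<in> verts C \<and> u \<noteq> v \<and> adj C v u" for u v
    using C'(1) by (auto simp: simple_cgraph_def)
  \<comment> \<open>Vacuous truth of \<open>h b\<close> on cliques that miss \<open>S\<close>
    produces the default value.\<close>
  define h where "h b \<longleftrightarrow> (\<forall>t\<in>S. col C t \<noteq> c \<and> (t = b \<or> adj C b t) \<longrightarrow> (t \<in> M) \<noteq> adj C r0 t)" for b
  define N where "N = {v \<in> verts C. if col C v = c then v = r0 \<or> adj C r0 v else adj C r0 v \<noteq> h v}"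
  \<comment> \<open>By \<open>cross\<close>, vertices of \<open>S\<close> in one clique pass or fail
    the test together, so the vertex itself decides it.\<close>
  have hS: "h b \<longleftrightarrow> (b \<in> M) \<noteq> adj C r0 b" if "b \<in> S" "col C b \<noteq> c" for b
    using cross[OF that(1)] that unfolding h_def by blast
  have hconst: "h b = h b'" if b: "adj C b b'" "col C b \<noteq> c" "col C b' \<noteq> c" for b b'
  proof -
    have cb: "col C b = col C b'" using b by (cases "col C b"; cases "col C b'"; cases c) auto
    have "(t = b \<or> adj C b t) \<longleftrightarrow> (t = b' \<or> adj C b' t)" if "col C t \<noteq> c" for t
    proof -
      have "col C t = col C b" using that b by (cases "col C b"; cases "col C t"; cases c) auto
      then show ?thesis
        using s[OF b(1)] C'(4)[of b' b t] C'(4)[of b b' t] b(1) cb by metis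
    qed
    then show ?thesis unfolding h_def by blast
  qed
  have N: "N \<subseteq> verts C" unfolding N_def by auto
  have Nc: "u \<in> N \<longleftrightarrow> u = r0 \<or> adj C r0 u" if "col C u = c" for u
    using that r0 s unfolding N_def by auto
  have Nb: "u \<in> N \<longleftrightarrow> adj C r0 u \<noteq> h u" if "col C u \<noteq> c" "u \<in> verts C" for u
    using that unfolding N_def by auto
  have "v \<in> N \<longleftrightarrow> v \<in> M" if v: "v \<in> S" for v
  proof (cases "col C v = c")
    case True
    then show ?thesis using Nc[OF True] same[OF v True] by simp
  next
    case False
    have "v \<in> verts C" using v S by blast
    then show ?thesis using Nb[OF False] hS[OF v False] by argo
  qed
  then have NS: "N \<inter> S = M" using M by blast
  have "admissible kR kB n (add_vertex C x c N)"
  proof (rule admissible_add_vertex[OF C x N])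
    show "v \<in> N" if "u \<in> N" "adj C u v" "col C u = c" "col C v = c" for u v
      using that Nc[of u] Nc[of v] C'(4)[of r0 u v] r0 by auto
    show "adj C u v" if "u \<in> N" "v \<in> N" "u \<noteq> v" "col C u = c" "col C v = c" for u v
      using that Nc[of u] Nc[of v] C'(4)[of u r0 v] s[of r0 u] r0 by auto
    show "col C u \<noteq> c" if "bound_of kR kB c = One" "u \<in> N" for u using that one by simp
    show "(col C z = c \<longrightarrow> \<not> adj C u z) \<and> (col C z \<noteq> c \<longrightarrow> adj C u z \<noteq> (z \<in> N))"
      if t: "bound_of kR kB c = Two" and u: "u \<in> N" "col C u = c" and z: "z \<in> verts C" for u z
    proof -
      \<comment> \<open>Under \<open>Two\<close> the new vertex forms a pair with \<open>r0\<close>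
        alone, and \<open>h\<close> is true everywhere, so it is opposite to \<open>r0\<close> on
        the whole other color.\<close>
      have "u = r0" using two[OF t] Nc[of u] u by auto
      moreover have "h z" using two[OF t] unfolding h_def by auto
      ultimately show ?thesis using two[OF t] Nb[of z] z by auto
    qed
    show "u \<in> N \<longleftrightarrow> v \<notin> N" if t: "bound_of kR kB (other c) = Two" and u: "adj C u v" "col C u \<noteq> c" "col C v \<noteq> c" for u v
    proof -
      have "col C u = other c" "col C v = other c" "c \<noteq> other c"
        using u by (cases "col C u"; cases "col C v"; cases c; simp)+
      then have "adj C u r0 \<noteq> adj C v r0"
        using admissible_bound[OF C, of "other c"] u(1) r0 unfolding t bound.simps by blast
      then have "adj C r0 u \<noteq> adj C r0 v" using s[of u r0] s[of r0 u] s[of v r0] s[of r0 v] by blast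
      then show ?thesis using Nb[of u] Nb[of v] u s[OF u(1)] hconst[OF u] by auto
    qed
    show "((b \<in> N) = adj C r b) = ((b' \<in> N) = adj C r b')"
      if r: "r \<in> N" "col C r = c" and b: "adj C b b'" "col C b \<noteq> c" "col C b' \<noteq> c" for r b b'
    proof -
      have "(adj C r0 b = adj C r b) = (adj C r0 b' = adj C r b')"
      proof (cases "r = r0")
        case False
        then have "adj C r0 r" using r Nc[of r] by auto
        then show ?thesis using even_crossD[OF C'(2,1) _ b(1), of r0 r c] r r0 b by simp
      qed simp
      then show ?thesis using Nb[of b] Nb[of b'] b s[OF b(1)] hconst[OF b] by auto
    qed
    show "indep_le n (add_vertex C x c N)" if c: "c = Red"
      unfolding indep_le_def
    proof (intro allI impI, elim conjE)
      note D = add_vertex_simps[OF x N, where c = c]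
      fix I assume I: "finite I" "independent_set (add_vertex C x c N) I" "I \<subseteq> color_class (add_vertex C x c N) Red"
      have r0x: "r0 \<noteq> x" using r0 x by auto
      let ?J = "I - {x}"
      have J: "u \<in> verts C" "u \<noteq> x" "col C u = c" if "u \<in> ?J" for u
        using that I(3) D c unfolding color_class_def by auto
      have JJ: "\<not> adj C u v" if "u \<in> ?J" "v \<in> ?J" for u v
        using that I(2) D(4)[of u v] unfolding independent_set_def by blast
      show "enat (card I) \<le> n"
      proof (cases "x \<in> I")
        case False
        then have "independent_set C I" "I \<subseteq> color_class C Red"
          using J JJ c unfolding independent_set_def color_class_def by auto
        then show ?thesis using C'(3) I(1) unfolding indep_le_def by blast
      next
        case True
        have n: "u \<noteq> r0" "\<not> adj C r0 u" "\<not> adj C u r0" if u: "u \<in> ?J" for u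
        proof -
          have "u \<notin> N" using I(2) True u D(2)[of u] unfolding independent_set_def by blast
          then show "u \<noteq> r0" "\<not> adj C r0 u" "\<not> adj C u r0" using Nc[OF J(3)[OF u]] s[of u r0] by auto
        qed
        \<comment> \<open>In an independent set \<open>x\<close> can be traded for its clique mate
          \<open>r0\<close> without changing the size, so the bound for \<open>C\<close>
          applies.\<close>
        have "independent_set C (insert r0 ?J)" "insert r0 ?J \<subseteq> color_class C Red"
          using J JJ n c r0 s[of r0 r0] unfolding independent_set_def color_class_def by auto
        moreover have "finite (insert r0 ?J)" using I by simp
        ultimately have "enat (card (insert r0 ?J)) \<le> n" using C'(3) unfolding indep_le_def by blast
        moreover have "card (insert r0 ?J) = card I"
        proof -
          have "r0 \<notin> ?J" using n by blast
          then show ?thesis using card_Suc_Diff1[OF I(1) True] I(1) by simp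
        qed
        ultimately show ?thesis by simp
      qed
    qed
  qed
  then show ?thesis using N NS by blast
qed

text \<open>The new vertex \<open>x\<close> forms a clique of its own. The linear order on the vertices only serves to choose
  one vertex of each pair of adjacent vertices of the other color outside \<open>S\<close>.\<close>

lemma one_point_new:
  fixes C :: "'a::linorder cgraph"
  assumes C: "admissible kR kB n C" and S: "S \<subseteq> verts C" and x: "x \<notin> verts C" and M: "M \<subseteq> S"
    and B: "admissible kR kB n (add_vertex (induced C S) x c M)"
    and none: "\<And>s. s \<in> M \<Longrightarrow> col C s \<noteq> c"
    and fin: "\<And>v. c = Red \<Longrightarrow> n \<noteq> \<infinity> \<Longrightarrow> v \<in> verts C \<Longrightarrow> col C v = Red \<Longrightarrow> v \<notin> S \<Longrightarrow> \<exists>s\<in>S. col C s = Red \<and> adj C v s"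
  shows "\<exists>N\<subseteq>verts C. N \<inter> S = M \<and> admissible kR kB n (add_vertex C x c N)"
proof -
  note C' = admissible_parts[OF C]
  have s: "adj C u v \<Longrightarrow> u \<in> verts C \<and> v \<in> verts C \<and> u \<noteq> v \<and> adj C v u" for u v
    using C'(1) by (auto simp: simple_cgraph_def)
  let ?B = "add_vertex (induced C S) x c M"
  have iS: "verts (induced C S) = S" "\<And>u v. adj (induced C S) u v \<longleftrightarrow> u \<in> S \<and> v \<in> S \<and> adj C u v" "col (induced C S) = col C"
    using S by (auto simp: induced_def)
  have xS: "x \<notin> verts (induced C S)" "M \<subseteq> verts (induced C S)" using iS x S M by auto
  note DB = add_vertex_simps[OF xS, where c = c, unfolded iS]
  have sx: "u \<in> S \<Longrightarrow> u \<noteq> x" for u using x S by blast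
  \<comment> \<open>If the bound for the other color is \<open>Two\<close>, each of its pairs must
    contain exactly one neighbor of \<open>x\<close>. A vertex with its partner in \<open>S\<close>
    takes the value opposite to the partner, and a pair outside \<open>S\<close> is divided by the
    order.\<close>
  define N where "N = {v \<in> verts C. col C v \<noteq> c \<and>
    (if v \<in> S then v \<in> M else if \<exists>t\<in>S. col C t \<noteq> c \<and> adj C v t then \<exists>t\<in>S. col C t \<noteq> c \<and> adj C v t \<and> t \<notin> M
     else \<forall>t. adj C v t \<and> col C t \<noteq> c \<longrightarrow> v < t)}"
  have N: "N \<subseteq> verts C" unfolding N_def by auto
  have NS: "N \<inter> S = M" using M S none unfolding N_def by auto
  have Nc: "u \<in> N \<Longrightarrow> col C u \<noteq> c" for u unfolding N_def by simp
  have Nt: "v \<in> N \<longleftrightarrow> (\<exists>t\<in>S. col C t \<noteq> c \<and> adj C v t \<and> t \<notin> M)"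
    if "v \<in> verts C" "col C v \<noteq> c" "v \<notin> S" "\<exists>t\<in>S. col C t \<noteq> c \<and> adj C v t" for v
    unfolding N_def mem_Collect_eq if_not_P[OF that(3)] if_P[OF that(4)] using that(1,2) by blast
  have Nn: "v \<in> N \<longleftrightarrow> (\<forall>t. adj C v t \<and> col C t \<noteq> c \<longrightarrow> v < t)"
    if "v \<in> verts C" "col C v \<noteq> c" "v \<notin> S" "\<not> (\<exists>t\<in>S. col C t \<noteq> c \<and> adj C v t)" for v
    unfolding N_def mem_Collect_eq if_not_P[OF that(3)] if_not_P[OF that(4)] using that(1,2) by blast
  have "admissible kR kB n (add_vertex C x c N)"
  proof (rule admissible_add_vertex[OF C x N])
    show "u \<in> N \<longleftrightarrow> v \<notin> N" if t: "bound_of kR kB (other c) = Two" and u: "adj C u v" "col C u \<noteq> c" "col C v \<noteq> c" for u v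
    proof -
      have oc: "d = other c \<longleftrightarrow> d \<noteq> c" for d by (cases c; cases d) auto
      have tri: "t = v" if "adj C u v" "adj C u t" "col C u \<noteq> c" "col C v \<noteq> c" "col C t \<noteq> c" for u v t
      proof (rule ccontr)
        assume ne: "t \<noteq> v"
        have cc: "col C t = other c" "col C u = other c" "col C v = other c" using that oc by auto
        have "\<not> (adj C u t \<and> adj C v t)"
          using admissible_bound[OF C, of "other c"] that(1) cc s[OF that(2)] unfolding t bound.simps by blast
        moreover have "adj C v t" using C'(4)[of v u t] s[OF that(1)] that(2) ne cc by auto
        ultimately show False using that(2) by blast
      qed
      note su = s[OF u(1)]
      have one: "u \<in> N \<longleftrightarrow> v \<notin> N" if u: "adj C u v" "adj C v u" "col C u \<noteq> c" "col C v \<noteq> c" "u \<in> S" "v \<notin> S" for u v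
      proof -
        have "t = u" if "t \<in> S" "col C t \<noteq> c" "adj C v t" for t using tri[of v u t] u that by auto
        then have "v \<in> N \<longleftrightarrow> u \<notin> M" using Nt[of v] u s[OF u(1)] by blast
        moreover have "u \<in> N \<longleftrightarrow> u \<in> M" using u NS by blast
        ultimately show ?thesis by simp
      qed
      consider "u \<in> S" "v \<in> S" | "u \<in> S" "v \<notin> S" | "u \<notin> S" "v \<in> S" | "u \<notin> S" "v \<notin> S" by blast
      then show ?thesis
      proof cases
        case 1
        have "adj ?B u v" "col ?B u = other c" "col ?B v = other c" "x \<in> verts ?B" "col ?B x \<noteq> other c"
          using DB 1 u sx oc by auto
        then have "adj ?B u x \<noteq> adj ?B v x"
          using admissible_bound[OF B, of "other c"] unfolding t bound.simps by blast
        then have "u \<in> M \<longleftrightarrow> v \<notin> M" using DB by simp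
        then show ?thesis using NS 1 by blast
      next
        case 2 then show ?thesis using one[of u v] u su by blast
      next
        case 3 then show ?thesis using one[of v u] u su by blast
      next
        case 4
        have tv: "t = v" if "adj C u t" "col C t \<noteq> c" for t using tri[of u v t] u that by auto
        have nu: "u \<in> N \<longleftrightarrow> u < v" using Nn[of u] tv 4 u su by blast
        have tu: "t = u" if "adj C v t" "col C t \<noteq> c" for t using tri[of v u t] u su that by auto
        have "v \<in> N \<longleftrightarrow> v < u" using Nn[of v] tu 4 u su by blast
        then show ?thesis using nu su by auto
      qed
    qed
    show "indep_le n (add_vertex C x c N)" if c: "c = Red"
    proof (cases "n = \<infinity>")
      case True then show ?thesis using indep_le_infinity by simp
    next
      case nf: False
      show ?thesis unfolding indep_le_def
      proof (intro allI impI, elim conjE)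
        note D = add_vertex_simps[OF x N, where c = c]
        fix I assume I: "finite I" "independent_set (add_vertex C x c N) I" "I \<subseteq> color_class (add_vertex C x c N) Red"
        let ?J = "I - {x}"
        have J: "u \<in> verts C" "u \<noteq> x" "col C u = Red" if "u \<in> ?J" for u
          using that I(3) D c unfolding color_class_def by auto
        have JJ: "\<not> adj C u v" if "u \<in> ?J" "v \<in> ?J" for u v
          using that I(2) D(4)[of u v] unfolding independent_set_def by blast
        show "enat (card I) \<le> n"
        proof (cases "x \<in> I")
          case False
          then have "independent_set C I" "I \<subseteq> color_class C Red"
            using J JJ c unfolding independent_set_def color_class_def by auto
          then show ?thesis using C'(3) I(1) unfolding indep_le_def by blast
        next
          case True
          have "\<exists>t\<in>S. col C t = Red \<and> (t = u \<or> adj C u t)" if "u \<in> ?J" for u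
            using fin[OF c nf, of u] J[OF that] by blast
          \<comment> \<open>When \<open>n\<close> is finite, \<open>fin\<close> allows each red
            vertex to be replaced by a clique mate in \<open>S\<close> unless it is there already.
            The independent set thus moves into the given extension of \<open>S\<close>, where the
            bound holds.\<close>
          then obtain \<phi> where \<phi>: "\<And>u. u \<in> ?J \<Longrightarrow> \<phi> u \<in> S \<and> col C (\<phi> u) = Red \<and> (\<phi> u = u \<or> adj C u (\<phi> u))"
            by metis
          have nadj: "\<phi> u \<noteq> \<phi> v \<and> \<not> adj C (\<phi> u) (\<phi> v)" if uv: "u \<in> ?J" "v \<in> ?J" "u \<noteq> v" for u v
          proof -
            have tr: "adj C a d" if "adj C a b" "adj C b d" "a \<noteq> d" "col C a = Red" "col C b = Red" "col C d = Red" for a b d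
              using C'(4)[OF that(1-3)] that(4-6) by simp
            note f = \<phi>[OF uv(1)] \<phi>[OF uv(2)] J(3)[OF uv(1)] J(3)[OF uv(2)]
            have A: "\<not> adj C u (\<phi> v)" "u \<noteq> \<phi> v"
              using f tr[of u "\<phi> v" v] s[of v "\<phi> v"] JJ[OF uv(1,2)] JJ[OF uv(2,1)] uv(3) by auto
            then show ?thesis
              using f tr[of u "\<phi> u" "\<phi> v"] by auto
          qed
          have inj: "inj_on \<phi> ?J" using nadj unfolding inj_on_def by blast
          let ?K = "insert x (\<phi> ` ?J)"
          have xK: "x \<notin> \<phi> ` ?J" using \<phi> sx by auto
          have K1: "?K \<subseteq> color_class ?B Red" using \<phi> DB c sx unfolding color_class_def by auto
          have irr: "\<not> adj C a a" for a using s by blast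
          have "\<not> adj ?B (\<phi> u) (\<phi> v)" if "u \<in> ?J" "v \<in> ?J" for u v
          proof -
            have "\<not> adj C (\<phi> u) (\<phi> v)" using nadj[OF that] irr by (cases "u = v") auto
            then show ?thesis using DB(4)[of "\<phi> u" "\<phi> v"] sx \<phi> that by auto
          qed
          moreover have "\<not> adj ?B x (\<phi> u)" "\<not> adj ?B (\<phi> u) x" if "u \<in> ?J" for u
            using DB(2,3)[of "\<phi> u"] none[of "\<phi> u"] \<phi>[OF that] c by auto
          moreover have "\<not> adj ?B x x" using DB(2)[of x] M sx by blast
          ultimately have K2: "independent_set ?B ?K"
            using K1 unfolding independent_set_def color_class_def by auto
          have "finite ?K" using I by simp
          then have "enat (card ?K) \<le> n" using admissible_parts(3)[OF B] K1 K2 unfolding indep_le_def by blast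
          moreover have "card ?K = card I"
            using card_Suc_Diff1[OF I(1) True] I(1) xK card_image[OF inj] by simp
          ultimately show ?thesis by simp
        qed
      qed
    qed
  qed (use Nc in blast)+
  then show ?thesis using N NS by blast
qed


lemma simple_add_vertex:
  assumes "simple_cgraph C" "x \<notin> verts C" "N \<subseteq> verts C"
  shows "simple_cgraph (add_vertex C x c N)"
  using assms unfolding simple_cgraph_def add_vertex_def by (auto split: if_splits)

text \<open>If \<open>x\<close> has a neighbor of its own color, its clique is determined. Otherwise
  it opens a clique, which is safe for finite \<open>n\<close> when every red clique of
  \<open>C\<close> meets \<open>S\<close>; a red clique that misses \<open>S\<close> is joined
  instead. Such a join needs room in the clique and control over blue edges, which explains the form
  of \<open>k\<close>. The first alternative of the conclusion occurs when the pair that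
  \<open>x\<close> would complete is complete in \<open>C\<close>.\<close>

lemma one_point_extension:
  fixes C :: "'a::linorder cgraph"
  assumes k: "n = \<infinity> \<or> kR = Unbounded \<and> kB \<noteq> Unbounded"
    and C: "admissible kR kB n C" and S: "S \<subseteq> verts C" and x: "x \<notin> verts C" and M: "M \<subseteq> S"
    and B: "admissible kR kB n (add_vertex (induced C S) x c M)"
  shows "(\<exists>y\<in>verts C. y \<notin> S \<and> col C y = c \<and> (\<forall>s\<in>S. adj C y s \<longleftrightarrow> s \<in> M)) \<or>
    (\<exists>N\<subseteq>verts C. N \<inter> S = M \<and> admissible kR kB n (add_vertex C x c N))"
proof -
  note C' = admissible_parts[OF C]
  note B' = admissible_parts[OF B]
  have s: "adj C u v \<Longrightarrow> u \<in> verts C \<and> v \<in> verts C \<and> u \<noteq> v \<and> adj C v u" for u v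
    using C'(1) by (auto simp: simple_cgraph_def)
  let ?B = "add_vertex (induced C S) x c M"
  have iS: "verts (induced C S) = S" "\<And>u v. adj (induced C S) u v \<longleftrightarrow> u \<in> S \<and> v \<in> S \<and> adj C u v" "col (induced C S) = col C"
    using S by (auto simp: induced_def)
  have xS: "x \<notin> verts (induced C S)" "M \<subseteq> verts (induced C S)" using iS x S M by auto
  note DB = add_vertex_simps[OF xS, where c = c, unfolded iS]
  have sx: "u \<in> S \<Longrightarrow> u \<noteq> x" for u using x S by blast
  have aB: "adj ?B u v \<longleftrightarrow> adj C u v" "col ?B u = col C u" if "u \<in> S" "v \<in> S" for u v
    using DB(4)[of u v] DB(6)[of u] sx that by auto
  consider r0 where "r0 \<in> M" "col C r0 = c"
    | r0 where "\<forall>s\<in>M. col C s \<noteq> c" "c = Red" "n \<noteq> \<infinity>" "r0 \<in> verts C" "col C r0 = Red" "r0 \<notin> S"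
        "\<forall>s\<in>S. col C s = Red \<longrightarrow> \<not> adj C r0 s"
    | "\<forall>s\<in>M. col C s \<noteq> c" "\<forall>v\<in>verts C. c = Red \<and> n \<noteq> \<infinity> \<and> col C v = Red \<and> v \<notin> S \<longrightarrow> (\<exists>s\<in>S. col C s = Red \<and> adj C v s)"
    by blast
  then show ?thesis
  proof cases
    case (1 r0)
    then have r0S: "r0 \<in> S" and r0C: "r0 \<in> verts C" using M S by auto
    have xr: "adj ?B x r0" "adj ?B r0 x" "col ?B x = c" "col ?B r0 = c" using DB(2,3)[of r0] DB(5) 1 aB(2)[OF r0S r0S] by auto
    have same: "t \<in> M \<longleftrightarrow> t = r0 \<or> adj C r0 t" if t: "t \<in> S" "col C t = c" for t
    proof
      assume tM: "t \<in> M"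
      show "t = r0 \<or> adj C r0 t"
      proof (cases "t = r0")
        case False
        have "adj ?B r0 t"
          using B'(4)[OF xr(2), of t] DB(2)[of t] tM False xr aB(2)[OF t(1) t(1)] t(2) by simp
        then show ?thesis using aB(1)[OF r0S t(1)] by simp
      qed simp
    next
      assume a: "t = r0 \<or> adj C r0 t"
      show "t \<in> M"
      proof (cases "t = r0")
        case False
        then have "adj ?B r0 t" using a aB(1)[OF r0S t(1)] by simp
        then have "adj ?B x t"
          using B'(4)[OF xr(1), of t] xr aB(2)[OF t(1) t(1)] t sx[OF t(1)] by simp
        then show ?thesis using DB(2) by simp
      qed (use 1 in simp)
    qed
    have cross: "((s \<in> M) = adj C r0 s) = ((t \<in> M) = adj C r0 t)"
      if "s \<in> S" "t \<in> S" "adj C s t" "col C s \<noteq> c" "col C t \<noteq> c" for s t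
    proof -
      have "(adj ?B x s = adj ?B r0 s) = (adj ?B x t = adj ?B r0 t)"
        by (rule even_crossD[OF B'(2,1) xr(1) _ xr(3,4)]) (use aB that in auto)
      then show ?thesis using DB(2) aB(1)[OF r0S that(1)] aB(1)[OF r0S that(2)] by simp
    qed
    have one: "bound_of kR kB c \<noteq> One"
    proof
      assume "bound_of kR kB c = One"
      then have "bound One c ?B" using admissible_bound[OF B, of c] by simp
      then show False using xr by auto
    qed
    have bT: "(s \<in> M) \<noteq> adj C r0 s" if t: "bound_of kR kB c = Two" and s: "s \<in> S" "col C s \<noteq> c" for s
    proof -
      have "s \<in> verts ?B" "col ?B s \<noteq> c" using DB(1) s aB(2)[OF s(1) s(1)] by auto
      then have "adj ?B x s \<noteq> adj ?B r0 s"
        using admissible_bound[OF B, of c] xr unfolding t bound.simps by blast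
      then show ?thesis using DB(2) aB(1)[OF r0S s(1)] by simp
    qed
    show ?thesis
    proof (cases "bound_of kR kB c = Two \<and> (\<exists>r1. adj C r0 r1 \<and> col C r1 = c)")
      case False
      have "\<exists>N\<subseteq>verts C. N \<inter> S = M \<and> admissible kR kB n (add_vertex C x c N)"
        by (rule one_point_join[OF C S x M r0C 1(2) same cross one]) (use False bT in blast)+
      then show ?thesis by blast
    next
      \<comment> \<open>A third vertex would not fit next to \<open>r0\<close> and
        \<open>r1\<close>. But \<open>r1\<close> is opposite to \<open>r0\<close>, just as
        \<open>x\<close> is, so it has the trace \<open>M\<close> and can stand for
        \<open>x\<close>.\<close>
      case True
      then obtain r1 where T: "bound_of kR kB c = Two" and r1: "adj C r0 r1" "col C r1 = c" by blast
      note sr = s[OF r1(1)]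
      have bC: "(col C z = c \<longrightarrow> \<not> (adj C r0 z \<and> adj C r1 z)) \<and> (col C z \<noteq> c \<longrightarrow> adj C r0 z \<noteq> adj C r1 z)"
        if "z \<in> verts C" for z
        using admissible_bound[OF C, of c] r1 1(2) that unfolding T bound.simps by blast
      have r1S: "r1 \<notin> S"
      proof
        assume r1S: "r1 \<in> S"
        then have m: "r1 \<in> M" using same r1 by blast
        have "r1 \<in> verts ?B" "col ?B r1 = c" "adj ?B x r1" "adj ?B r0 r1"
          using r1S r1 DB(1) aB(2)[OF r1S r1S] DB(2)[of r1] m aB(1)[OF r0S r1S] by auto
        then show False using admissible_bound[OF B, of c] xr unfolding T bound.simps by blast
      qed
      have "adj C r1 t \<longleftrightarrow> t \<in> M" if t: "t \<in> S" for t
      proof -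
        have tC: "t \<in> verts C" using t S by blast
        show ?thesis
        proof (cases "col C t = c")
          case True
          have "\<not> adj C r0 t" using bC[OF tC] True C'(4)[of r1 r0 t] sr r1 1(2) t r1S by metis
          moreover have "adj C r1 t \<longleftrightarrow> t = r0"
            using calculation sr C'(4)[of r0 r1 t] True r1 1(2) by metis
          ultimately show ?thesis using same[OF t True] by blast
        next
          case False
          then show ?thesis using bC[OF tC] bT[OF T t False] by blast
        qed
      qed
      then show ?thesis using sr r1 r1S by blast
    qed
  next
    case (2 r0)
    have u: "kR = Unbounded" "kB \<noteq> Unbounded" using k 2 by auto
    have "\<exists>N\<subseteq>verts C. N \<inter> S = M \<and> admissible kR kB n (add_vertex C x c N)"
    proof (rule one_point_join[OF C S x M 2(4)])
      show "col C r0 = c" using 2 by simp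
      show "s \<in> M \<longleftrightarrow> s = r0 \<or> adj C r0 s" if "s \<in> S" "col C s = c" for s
        using that 2 by blast
      show "bound_of kR kB c \<noteq> One" using u 2 by simp
      show "(\<forall>z. adj C r0 z \<longrightarrow> col C z \<noteq> c) \<and> (\<forall>s\<in>S. col C s \<noteq> c \<longrightarrow> (s \<in> M) \<noteq> adj C r0 s)"
        if "bound_of kR kB c = Two" using that u 2 by simp
      show "((s \<in> M) = adj C r0 s) = ((t \<in> M) = adj C r0 t)"
        if st: "s \<in> S" "t \<in> S" "adj C s t" "col C s \<noteq> c" "col C t \<noteq> c" for s t
      proof -
        have b: "col C s = Blue" "col C t = Blue" using st 2(2) by (metis color.exhaust)+
        \<comment> \<open>A blue edge can only occur with the bound \<open>Two\<close>, and then it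
          is separated both by \<open>r0\<close> in \<open>C\<close> and by \<open>x\<close> in
          \<open>?B\<close>; both comparisons change along it.\<close>
        have "kB \<noteq> One"
        proof
          assume "kB = One"
          then have "bound One Blue C" using C by (simp add: admissible_def)
          then show False using st(3) b by auto
        qed
        then have kB: "kB = Two" using u by (cases kB) auto
        then have bC: "bound Two Blue C" and bB: "bound Two Blue ?B"
          using C B by (auto simp: admissible_def simp del: bound.simps)
        have rb: "col C r0 \<noteq> Blue" using 2 by simp
        have "adj C s r0 \<noteq> adj C t r0" using bC st(3) b 2(4) rb unfolding bound.simps by blast
        then have 1: "adj C r0 s \<noteq> adj C r0 t" using s[of s r0] s[of r0 s] s[of t r0] s[of r0 t] by blast
        have xb: "x \<in> verts ?B" "col ?B x \<noteq> Blue" "adj ?B s t" "col ?B s = Blue" "col ?B t = Blue"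
          using DB(1,5) 2(2) aB(1)[OF st(1,2)] aB(2)[OF st(1,1)] aB(2)[OF st(2,2)] st(3) b by auto
        have "adj ?B s x \<noteq> adj ?B t x" using bB xb unfolding bound.simps by blast
        then show ?thesis using 1 DB(3) by blast
      qed
    qed
    then show ?thesis by blast
  next
    case 3
    have "\<exists>N\<subseteq>verts C. N \<inter> S = M \<and> admissible kR kB n (add_vertex C x c N)"
      by (rule one_point_new[OF C S x M B]) (use 3 in blast)+
    then show ?thesis by blast
  qed
qed

text \<open>\<open>B1\<close> is enlarged until it accommodates \<open>B2\<close>: each vertex of
  \<open>B2\<close> outside the image of \<open>A\<close> is either adjoined or identified with a
  vertex already present.\<close>

lemma amalgamation_property_adm_class:
  assumes k: "n = \<infinity> \<or> kR = Unbounded \<and> kB \<noteq> Unbounded"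
  shows "amalgamation_property (adm_class kR kB n)"
  unfolding amalgamation_property_def is_embedding_iff_emb
proof (intro ballI allI impI, elim conjE)
  fix A B1 B2 :: "nat cgraph" and f1 f2
  assume K: "A \<in> adm_class kR kB n" "B1 \<in> adm_class kR kB n" "B2 \<in> adm_class kR kB n"
    and f1: "emb f1 A B1" and f2: "emb f2 A B2"
  have fB2: "finite (verts B2)" "admissible kR kB n B2" using K by (auto simp: adm_class_def)
  have sB2: "adj B2 u v \<Longrightarrow> u \<in> verts B2 \<and> v \<in> verts B2 \<and> u \<noteq> v \<and> adj B2 v u" for u v
    using admissible_parts(1)[OF fB2(2)] by (auto simp: simple_cgraph_def)
  let ?A2 = "f2 ` verts A"
  have A2: "?A2 \<subseteq> verts B2" using f2 by (auto simp: emb_def)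
  have main: "\<exists>C g1 g2. C \<in> adm_class kR kB n \<and> emb g1 B1 C \<and> emb g2 (induced B2 (?A2 \<union> U)) C \<and>
      (\<forall>x\<in>verts A. g1 (f1 x) = g2 (f2 x))" if "finite U" "U \<subseteq> verts B2 - ?A2" for U
    using that
  proof (induction U)
    case empty
    let ?i = "inv_into (verts A) f2"
    have i: "?i (f2 a) = a" if "a \<in> verts A" for a using f2 that by (auto simp: emb_def)
    have "emb (\<lambda>x. x) B1 B1" by (simp add: emb_def)
    moreover have "emb (\<lambda>y. f1 (?i y)) (induced B2 (?A2 \<union> {})) B1"
    proof -
      have "is_iso f2 A (induced B2 ?A2)" using f2 is_embedding_iff_emb is_embedding_def by metis
      then have "emb ?i (induced B2 ?A2) A" by (rule is_iso_emb[OF is_iso_inv])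
      then show ?thesis using emb_comp[OF _ f1] by (simp add: comp_def)
    qed
    moreover have "\<forall>x\<in>verts A. f1 x = f1 (?i (f2 x))" using i by simp
    ultimately show ?case using K(2) by (intro exI[of _ B1] exI[of _ "\<lambda>x. x"] exI[of _ "\<lambda>y. f1 (?i y)"]) auto
  next
    case (insert v U)
    then obtain C g1 g2 where C: "C \<in> adm_class kR kB n" "emb g1 B1 C" "emb g2 (induced B2 (?A2 \<union> U)) C"
      "\<forall>x\<in>verts A. g1 (f1 x) = g2 (f2 x)" by auto
    let ?T = "?A2 \<union> U"
    have T: "?T \<subseteq> verts B2" "v \<in> verts B2" "v \<notin> ?T" using A2 insert by auto
    have Tv: "verts (induced B2 ?T) = ?T" using T by (auto simp: induced_def)
    have g2: "g2 t \<in> verts C" "col C (g2 t) = col B2 t" if "t \<in> ?T" for t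
      using C(3) that Tv unfolding emb_def by (auto simp: induced_def)
    have g2a: "adj C (g2 t) (g2 u) \<longleftrightarrow> adj B2 t u" "g2 t = g2 u \<longleftrightarrow> t = u" if "t \<in> ?T" "u \<in> ?T" for t u
      using C(3) that Tv unfolding emb_def by (auto simp: induced_def inj_on_eq_iff)
    have fC: "finite (verts C)" "admissible kR kB n C" using C by (auto simp: adm_class_def)
    obtain x where x: "x \<notin> verts C" using fC(1) by (metis ex_new_if_finite infinite_UNIV_nat)
    define S where "S = g2 ` ?T"
    define M where "M = g2 ` {t \<in> ?T. adj B2 v t}"
    define c where "c = col B2 v"
    have S: "S \<subseteq> verts C" "M \<subseteq> S" using g2 by (auto simp: S_def M_def)
    have mM: "g2 t \<in> M \<longleftrightarrow> adj B2 v t" if "t \<in> ?T" for t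
    proof
      assume "g2 t \<in> M"
      then obtain u where u: "u \<in> ?T" "adj B2 v u" "g2 t = g2 u" unfolding M_def by blast
      then show "adj B2 v t" using g2a(2)[OF that u(1)] by simp
    next
      assume "adj B2 v t"
      then show "g2 t \<in> M" using that unfolding M_def by blast
    qed
    let ?B = "add_vertex (induced C S) x c M"
    have iS: "verts (induced C S) = S" "\<And>u v. adj (induced C S) u v \<longleftrightarrow> u \<in> S \<and> v \<in> S \<and> adj C u v" "col (induced C S) = col C"
      using S by (auto simp: induced_def)
    have xS: "x \<notin> verts (induced C S)" "M \<subseteq> verts (induced C S)" using iS x S by auto
    note DB = add_vertex_simps[OF xS, where c = c, unfolded iS]
    have sx: "g2 t \<noteq> x" if "t \<in> ?T" for t using g2[OF that] x by auto
    \<comment> \<open>The prescribed extension of \<open>S\<close> is a copy of an induced subgraph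
      of \<open>B2\<close>, from which it inherits admissibility.\<close>
    have adB: "admissible kR kB n ?B"
    proof (rule admissible_emb[OF _ _ fB2(2)])
      show "simple_cgraph ?B"
        by (rule simple_add_vertex[OF simple_induced[OF admissible_parts(1)[OF fC(2)]] xS])
      define kf where "kf w = (if w = x then v else inv_into ?T g2 w)" for w
      have kx: "kf x = v" by (simp add: kf_def)
      have kk: "kf (g2 t) = t" if "t \<in> ?T" for t
      proof -
        have "inj_on g2 ?T" using g2a unfolding inj_on_def by blast
        then show ?thesis using that sx[OF that] by (simp add: kf_def)
      qed
      have vB: "w \<in> verts ?B \<longleftrightarrow> w = x \<or> (\<exists>t\<in>?T. w = g2 t)" for w using DB(1) unfolding S_def by auto
      show "emb kf ?B B2" unfolding emb_def
      proof (intro conjI ballI)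
        show "kf ` verts ?B \<subseteq> verts B2"
        proof
          fix y assume "y \<in> kf ` verts ?B"
          then obtain w where w: "w \<in> verts ?B" "y = kf w" by blast
          then show "y \<in> verts B2" using vB[of w] kk kx T by (metis subsetD)
        qed
        show "inj_on kf (verts ?B)"
        proof (rule inj_onI)
          fix w w' assume w: "w \<in> verts ?B" "w' \<in> verts ?B" "kf w = kf w'"
          then show "w = w'" using vB[of w] vB[of w'] kk kx T(3) by metis
        qed
        fix w assume w: "w \<in> verts ?B"
        show "col B2 (kf w) = col ?B w"
        proof (cases "w = x")
          case True then show ?thesis using DB(5) c_def kx by simp
        next
          case False
          then obtain t where t: "t \<in> ?T" "w = g2 t" using vB[of w] w by blast
          then show ?thesis using kk[OF t(1)] g2(2)[OF t(1)] DB(6)[of w] False by simp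
        qed
        fix w' assume w': "w' \<in> verts ?B"
        consider "w = x" "w' = x" | "w = x" "w' \<noteq> x" | "w \<noteq> x" "w' = x" | "w \<noteq> x" "w' \<noteq> x" by blast
        then show "adj B2 (kf w) (kf w') = adj ?B w w'"
        proof cases
          case 1
          have "\<not> adj B2 v v" using sB2[of v v] by blast
          moreover have "\<not> adj ?B x x" using DB(2)[of x] xS by blast
          ultimately show ?thesis unfolding 1 kx by blast
        next
          case 2
          then obtain t where t: "t \<in> ?T" "w' = g2 t" using vB[of w'] w' by blast
          show ?thesis unfolding 2(1) t(2) kx kk[OF t(1)] DB(2) mM[OF t(1)] ..
        next
          case 3
          then obtain t where t: "t \<in> ?T" "w = g2 t" using vB[of w] w by blast
          show ?thesis unfolding 3(2) t(2) kx kk[OF t(1)] DB(3) mM[OF t(1)] using sB2[of v t] sB2[of t v] by blast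
        next
          case 4
          then obtain t t' where t: "t \<in> ?T" "w = g2 t" "t' \<in> ?T" "w' = g2 t'" using vB[of w] vB[of w'] w w' by blast
          then have "w \<in> S" "w' \<in> S" unfolding S_def by blast+
          then have "adj ?B w w' = adj C w w'" using DB(4)[OF 4] by blast
          then show ?thesis unfolding t(2,4) kk[OF t(1)] kk[OF t(3)] g2a(1)[OF t(1,3)] by blast
        qed
      qed
    qed
    have iT: "verts (induced B2 (?A2 \<union> insert v U)) = insert v ?T" using T by (auto simp: induced_def)
    \<comment> \<open>Formulated for an arbitrary \<open>D\<close> over \<open>C\<close>, so that it
      serves identification, where \<open>D = C\<close>, as well as an adjoined vertex.\<close>
    have ext: "emb (g2(v := y)) (induced B2 (?A2 \<union> insert v U)) D"
      if D: "y \<in> verts D" "col D y = c" "\<forall>s\<in>S. (adj D y s \<longleftrightarrow> s \<in> M) \<and> (adj D s y \<longleftrightarrow> s \<in> M)" "y \<notin> S" "\<not> adj D y y"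
        "emb (\<lambda>x. x) C D" for D y
    proof -
      have DC: "z \<in> verts D" "col D z = col C z" if "z \<in> verts C" for z using D(6) that by (auto simp: emb_def)
      have DA: "adj D z w \<longleftrightarrow> adj C z w" if "z \<in> verts C" "w \<in> verts C" for z w using D(6) that by (auto simp: emb_def)
      have gS: "g2 t \<in> S" if "t \<in> ?T" for t using that unfolding S_def by blast
      have yv: "g2 t \<noteq> y" if "t \<in> ?T" for t using gS[OF that] D(4) by auto
      have nv: "t \<noteq> v" if "t \<in> ?T" for t using that T(3) by auto
      have aD: "adj D y (g2 t) \<longleftrightarrow> adj B2 v t" "adj D (g2 t) y \<longleftrightarrow> adj B2 t v" if "t \<in> ?T" for t
        using D(3) gS[OF that] mM[OF that] sB2[of v t] sB2[of t v] by auto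
      have vv: "\<not> adj B2 v v" using sB2[of v v] by blast
      have aI: "adj (induced B2 (?A2 \<union> insert v U)) t u \<longleftrightarrow> adj B2 t u" if "t \<in> insert v ?T" "u \<in> insert v ?T" for t u
        using that by (auto simp: induced_def)
      have cI: "col (induced B2 (?A2 \<union> insert v U)) = col B2" by (simp add: induced_def)
      show ?thesis unfolding emb_def iT cI
      proof (intro conjI ballI)
        show "(g2(v := y)) ` insert v ?T \<subseteq> verts D" using D(1) g2(1) DC(1) nv by auto
        show "inj_on (g2(v := y)) (insert v ?T)"
        proof (rule inj_onI)
          fix t u assume "t \<in> insert v ?T" "u \<in> insert v ?T" "(g2(v := y)) t = (g2(v := y)) u"
          then show "t = u" using yv[of t] yv[of u] g2a(2)[of t u] by (metis fun_upd_apply insertE)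
        qed
        fix t assume t: "t \<in> insert v ?T"
        show "col D ((g2(v := y)) t) = col B2 t"
        proof (cases "t = v")
          case True then show ?thesis using D(2) c_def by simp
        next
          case False
          then have "t \<in> ?T" using t by blast
          then show ?thesis using False g2[of t] DC[of "g2 t"] by simp
        qed
        fix u assume u: "u \<in> insert v ?T"
        consider "t = v" "u = v" | "t = v" "u \<noteq> v" "u \<in> ?T" | "t \<noteq> v" "u = v" "t \<in> ?T" | "t \<noteq> v" "u \<noteq> v" "t \<in> ?T" "u \<in> ?T"
          using t u by blast
        then have "adj D ((g2(v := y)) t) ((g2(v := y)) u) = adj B2 t u"
        proof cases
          case 1 then show ?thesis using D(5) vv by simp
        next
          case 2 then show ?thesis using aD(1)[OF 2(3)] by simp
        next
          case 3 then show ?thesis using aD(2)[OF 3(3)] by simp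
        next
          case 4 then show ?thesis using g2a(1)[OF 4(3,4)] DA[of "g2 t" "g2 u"] g2(1)[OF 4(3)] g2(1)[OF 4(4)] by simp
        qed
        then show "adj D ((g2(v := y)) t) ((g2(v := y)) u) = adj (induced B2 (?A2 \<union> insert v U)) t u"
          using aI[OF t u] by simp
      qed
    qed
    have agree: "\<forall>x\<in>verts A. g1 (f1 x) = (g2(v := y)) (f2 x)" for y
    proof
      fix a assume a: "a \<in> verts A"
      then have "f2 a \<noteq> v" using T(3) by auto
      then show "g1 (f1 a) = (g2(v := y)) (f2 a)" using C(4) a by simp
    qed
    have sC: "adj C u v \<Longrightarrow> u \<noteq> v \<and> adj C v u" for u v
      using admissible_parts(1)[OF fC(2)] by (auto simp: simple_cgraph_def)
    from one_point_extension[OF k fC(2) S(1) x S(2) adB] show ?case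
    proof (elim disjE bexE exE conjE)
      fix y assume y: "y \<in> verts C" "y \<notin> S" "col C y = c" "\<forall>s\<in>S. adj C y s \<longleftrightarrow> s \<in> M"
      have "emb (g2(v := y)) (induced B2 (?A2 \<union> insert v U)) C"
      proof (rule ext[OF y(1,3) _ y(2)])
        show "\<forall>s\<in>S. (adj C y s \<longleftrightarrow> s \<in> M) \<and> (adj C s y \<longleftrightarrow> s \<in> M)" using y(4) sC[of y] sC[of _ y] by blast
        show "\<not> adj C y y" using sC[of y y] by blast
        show "emb (\<lambda>x. x) C C" by (simp add: emb_def)
      qed
      then show ?case using C(1,2) agree by blast
    next
      fix N assume N: "N \<subseteq> verts C" "N \<inter> S = M" "admissible kR kB n (add_vertex C x c N)"
      let ?D = "add_vertex C x c N"
      note D = add_vertex_simps[OF x N(1), where c = c]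
      have e: "emb (\<lambda>x. x) C ?D"
        unfolding emb_def add_vertex_def using x by (auto simp: inj_on_def)
      have DK: "?D \<in> adm_class kR kB n" using N(3) fC(1) D(1) by (simp add: adm_class_def)
      have xS: "x \<notin> S" using x S by blast
      have "emb (g2(v := x)) (induced B2 (?A2 \<union> insert v U)) ?D"
      proof (rule ext[OF _ _ _ xS _ e])
        show "x \<in> verts ?D" "col ?D x = c" using D by auto
        show "\<forall>s\<in>S. (adj ?D x s \<longleftrightarrow> s \<in> M) \<and> (adj ?D s x \<longleftrightarrow> s \<in> M)" using D(2,3) N(2) by blast
        show "\<not> adj ?D x x" using D(2) N(1) x by blast
      qed
      moreover have "emb g1 B1 ?D" using emb_comp[OF C(2) e] by (simp add: comp_def)
      ultimately show ?case using DK agree by blast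
    qed
  qed
  have eq: "?A2 \<union> (verts B2 - ?A2) = verts B2" using A2 by blast
  obtain C g1 g2 where C: "C \<in> adm_class kR kB n" "emb g1 B1 C" "emb g2 (induced B2 (verts B2)) C"
    "\<forall>x\<in>verts A. g1 (f1 x) = g2 (f2 x)"
    using main[of "verts B2 - ?A2"] fB2(1) unfolding eq by auto
  have "emb g2 B2 C" using C(3) sB2 unfolding emb_def by (auto simp: induced_def)
  then show "\<exists>C\<in>adm_class kR kB n. \<exists>g1 g2. emb g1 B1 C \<and> emb g2 B2 C \<and> (\<forall>x\<in>verts A. g1 (f1 x) = g2 (f2 x))"
    using C by blast
qed

theorem amalgamation_class_adm_class:
  assumes k: "n = \<infinity> \<or> kR = Unbounded \<and> kB \<noteq> Unbounded"
  shows "amalgamation_class (adm_class kR kB n)"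
  unfolding amalgamation_class_def
proof (intro conjI ballI allI impI)
  show "finite_cgraph A" if "A \<in> adm_class kR kB n" for A
    using that admissible_parts(1) by (auto simp: adm_class_def finite_cgraph_def)
  show "B \<in> adm_class kR kB n" if A: "A \<in> adm_class kR kB n" and B: "finite_cgraph B \<and> isomorphic A B" for A B
  proof -
    obtain f where "is_iso f A B" using B by (auto simp: isomorphic_def)
    then have "emb (inv_into (verts A) f) B A" using is_iso_inv is_iso_emb by blast
    then show ?thesis using A B admissible_emb by (auto simp: adm_class_def finite_cgraph_def)
  qed
  show "induced A S \<in> adm_class kR kB n" if A: "A \<in> adm_class kR kB n" and S: "S \<subseteq> verts A" for A S
  proof -
    have a: "admissible kR kB n A" "finite (verts A)" using A by (auto simp: adm_class_def)
    have "admissible kR kB n (induced A S)"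
      using admissible_emb[OF emb_induced[OF S] simple_induced[OF admissible_parts(1)[OF a(1)]] a(1)] .
    then show ?thesis using a by (simp add: adm_class_def induced_def)
  qed
  show "amalgamation_property (adm_class kR kB n)" by (rule amalgamation_property_adm_class[OF k])
qed

section \<open>Uniqueness of Fraisse limits\<close>

text \<open>Partial isomorphisms are relations here, so that extending the range is extending the
  domain of the converse, see \<open>piso_converse\<close>.\<close>

definition piso :: "'a cgraph \<Rightarrow> 'b cgraph \<Rightarrow> ('a \<times> 'b) set \<Rightarrow> bool" where
  "piso G H p \<longleftrightarrow> p \<subseteq> verts G \<times> verts H \<and> (\<forall>x y x' y'. (x, y) \<in> p \<longrightarrow> (x', y') \<in> p \<longrightarrow>
     (x = x' \<longleftrightarrow> y = y') \<and> (adj G x x' \<longleftrightarrow> adj H y y') \<and> col G x = col H y)"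

lemma pisoD:
  assumes "piso G H p" "(x, y) \<in> p"
  shows "x \<in> verts G" "y \<in> verts H" "col H y = col G x"
    "(x', y') \<in> p \<Longrightarrow> x = x' \<longleftrightarrow> y = y'" "(x', y') \<in> p \<Longrightarrow> adj G x x' \<longleftrightarrow> adj H y y'"
proof -
  show "x \<in> verts G" "y \<in> verts H" using assms unfolding piso_def by blast+
  show "col H y = col G x" using assms unfolding piso_def by metis
  show "(x', y') \<in> p \<Longrightarrow> x = x' \<longleftrightarrow> y = y'" "(x', y') \<in> p \<Longrightarrow> adj G x x' \<longleftrightarrow> adj H y y'"
    using assms unfolding piso_def by blast+
qed

lemma pisoI:
  assumes "p \<subseteq> verts G \<times> verts H"
    "\<And>x y x' y'. (x, y) \<in> p \<Longrightarrow> (x', y') \<in> p \<Longrightarrow>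
     (x = x' \<longleftrightarrow> y = y') \<and> (adj G x x' \<longleftrightarrow> adj H y y') \<and> col G x = col H y"
  shows "piso G H p"
  using assms unfolding piso_def by blast

lemma piso_function:
  assumes "piso G H p"
  obtains f where "\<And>x y. (x, y) \<in> p \<longleftrightarrow> x \<in> fst ` p \<and> y = f x"
proof
  fix x y
  have ex: "(x, SOME y. (x, y) \<in> p) \<in> p" if "x \<in> fst ` p" using that by (metis fst_conv imageE prod.collapse someI)
  show "(x, y) \<in> p \<longleftrightarrow> x \<in> fst ` p \<and> y = (SOME y. (x, y) \<in> p)"
  proof
    assume xy: "(x, y) \<in> p"
    then have x: "x \<in> fst ` p" by force
    show "x \<in> fst ` p \<and> y = (SOME y. (x, y) \<in> p)"
      using pisoD(4)[OF assms xy ex[OF x]] x by simp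
  next
    assume "x \<in> fst ` p \<and> y = (SOME y. (x, y) \<in> p)"
    then show "(x, y) \<in> p" using ex by simp
  qed
qed

lemma piso_iso:
  assumes p: "piso G H p" and f: "\<And>x y. (x, y) \<in> p \<longleftrightarrow> x \<in> fst ` p \<and> y = f x"
  shows "is_iso f (induced G (fst ` p)) (induced H (snd ` p))"
proof -
  have S: "fst ` p \<subseteq> verts G" "snd ` p \<subseteq> verts H" using p unfolding piso_def by auto
  have fp: "(x, f x) \<in> p" if "x \<in> fst ` p" for x using f that by simp
  have img: "f ` fst ` p = snd ` p"
  proof (intro set_eqI iffI)
    fix y assume "y \<in> f ` fst ` p" then show "y \<in> snd ` p" using fp by force
  next
    fix y assume "y \<in> snd ` p"
    then obtain x where "(x, y) \<in> p" by force
    then show "y \<in> f ` fst ` p" using f by blast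
  qed
  have inj: "inj_on f (fst ` p)"
  proof (rule inj_onI)
    fix x x' assume "x \<in> fst ` p" "x' \<in> fst ` p" "f x = f x'"
    then show "x = x'" using pisoD(4)[OF p fp fp] by simp
  qed
  have V: "verts (induced G (fst ` p)) = fst ` p" "verts (induced H (snd ` p)) = snd ` p"
    using S by (auto simp: induced_def)
  show ?thesis unfolding is_iso_def V
  proof (intro conjI ballI)
    show "bij_betw f (fst ` p) (snd ` p)" using img inj by (simp add: bij_betw_def)
    fix x assume x: "x \<in> fst ` p"
    show "col (induced H (snd ` p)) (f x) = col (induced G (fst ` p)) x"
      using pisoD(3)[OF p fp[OF x]] by (simp add: induced_def)
    fix x' assume x': "x' \<in> fst ` p"
    have "f x \<in> snd ` p" "f x' \<in> snd ` p" using img x x' by blast+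
    then show "adj (induced H (snd ` p)) (f x) (f x') = adj (induced G (fst ` p)) x x'"
      using pisoD(5)[OF p fp[OF x] fp[OF x']] x x' by (simp add: induced_def)
  qed
qed

lemma ultrahomogeneous_iff:
  "ultrahomogeneous G \<longleftrightarrow> (\<forall>p. finite p \<and> piso G G p \<longrightarrow> (\<exists>g. is_iso g G G \<and> (\<forall>x y. (x, y) \<in> p \<longrightarrow> g x = y)))"
proof
  assume u: "ultrahomogeneous G"
  show "\<forall>p. finite p \<and> piso G G p \<longrightarrow> (\<exists>g. is_iso g G G \<and> (\<forall>x y. (x, y) \<in> p \<longrightarrow> g x = y))"
  proof (intro allI impI, elim conjE)
    fix p assume p: "finite p" "piso G G p"
    obtain f where f: "\<And>x y. (x, y) \<in> p \<longleftrightarrow> x \<in> fst ` p \<and> y = f x" using piso_function[OF p(2)] by blast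
    have S: "fst ` p \<subseteq> verts G" "snd ` p \<subseteq> verts G" using p(2) unfolding piso_def by auto
    have "\<exists>g. is_iso g G G \<and> (\<forall>x\<in>fst ` p. g x = f x)"
      by (rule mp[OF spec[OF spec[OF spec[OF u[unfolded ultrahomogeneous_def]]]], of "fst ` p" "snd ` p" f])
        (use S p(1) piso_iso[OF p(2) f] in blast)
    then show "\<exists>g. is_iso g G G \<and> (\<forall>x y. (x, y) \<in> p \<longrightarrow> g x = y)" using f by metis
  qed
next
  assume h: "\<forall>p. finite p \<and> piso G G p \<longrightarrow> (\<exists>g. is_iso g G G \<and> (\<forall>x y. (x, y) \<in> p \<longrightarrow> g x = y))"
  show "ultrahomogeneous G" unfolding ultrahomogeneous_def
  proof (intro allI impI, elim conjE)
    fix S T f assume a: "finite S" "S \<subseteq> verts G" "finite T" "T \<subseteq> verts G" "is_iso f (induced G S) (induced G T)"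
    have V: "verts (induced G S) = S" "verts (induced G T) = T" using a by (auto simp: induced_def)
    have f: "f x \<in> T" "col G (f x) = col G x" if "x \<in> S" for x
      using a(5) that unfolding is_iso_def V by (auto simp: induced_def bij_betw_def)
    have f2: "f x = f y \<longleftrightarrow> x = y" "adj G (f x) (f y) \<longleftrightarrow> adj G x y" if "x \<in> S" "y \<in> S" for x y
    proof -
      show "f x = f y \<longleftrightarrow> x = y" using a(5) that unfolding is_iso_def V bij_betw_def by (auto dest: inj_onD)
      have "adj (induced G T) (f x) (f y) \<longleftrightarrow> adj (induced G S) x y" using a(5) that unfolding is_iso_def V by blast
      then show "adj G (f x) (f y) \<longleftrightarrow> adj G x y" using f(1) that by (simp add: induced_def)
    qed
    let ?p = "(\<lambda>x. (x, f x)) ` S"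
    have "piso G G ?p"
    proof (rule pisoI)
      show "?p \<subseteq> verts G \<times> verts G" using a f by auto
      fix x y x' y' assume "(x, y) \<in> ?p" "(x', y') \<in> ?p"
      then have "x \<in> S" "x' \<in> S" "y = f x" "y' = f x'" by auto
      then show "(x = x' \<longleftrightarrow> y = y') \<and> (adj G x x' \<longleftrightarrow> adj G y y') \<and> col G x = col G y" using f f2 by simp
    qed
    moreover have "finite ?p" using a by simp
    ultimately obtain g where "is_iso g G G" "\<forall>x y. (x, y) \<in> ?p \<longrightarrow> g x = y" using h by blast
    then show "\<exists>g. is_iso g G G \<and> (\<forall>x\<in>S. g x = f x)" by blast
  qed
qed

definition copy :: "('a \<Rightarrow> 'b) \<Rightarrow> 'a cgraph \<Rightarrow> 'b cgraph" where
  "copy f G = \<lparr>verts = f ` verts G,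
     adj = (\<lambda>u v. \<exists>x\<in>verts G. \<exists>y\<in>verts G. u = f x \<and> v = f y \<and> adj G x y),
     col = (\<lambda>u. col G (inv_into (verts G) f u))\<rparr>"

lemma is_iso_copy: "inj_on f (verts G) \<Longrightarrow> is_iso f G (copy f G)"
  unfolding is_iso_def copy_def by (auto simp: bij_betw_def inj_on_eq_iff)

lemma simple_copy: "inj_on f (verts G) \<Longrightarrow> simple_cgraph G \<Longrightarrow> simple_cgraph (copy f G)"
  unfolding simple_cgraph_def copy_def by (auto simp: inj_on_eq_iff)

text \<open>The age consists of graphs on natural numbers, so the finite subgraph of
  \<open>G\<close> is first copied there.\<close>

lemma embeds_if_age_subset:
  assumes age: "\<And>A :: nat cgraph. finite_cgraph A \<Longrightarrow> realized A G \<Longrightarrow> realized A F"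
    and G: "simple_cgraph G" and S: "finite S" "S \<subseteq> verts G"
  shows "\<exists>e. emb e (induced G S) F"
proof -
  let ?I = "induced G S"
  have V: "verts ?I = S" using S by (auto simp: induced_def)
  obtain f :: "'a \<Rightarrow> nat" where f: "inj_on f S" using S(1) finite_imp_inj_to_nat_seg by metis
  let ?A = "copy f ?I"
  have iso: "is_iso f ?I ?A" using is_iso_copy f V by metis
  have "finite_cgraph ?A"
    unfolding finite_cgraph_def using simple_copy[of f ?I] f V simple_induced[OF G] S by (simp add: copy_def)
  moreover have "realized ?A G"
    unfolding realized_iff_emb using emb_comp[OF is_iso_emb[OF is_iso_inv[OF iso]] emb_induced[OF S(2)]] by blast
  ultimately obtain e where "emb e ?A F" using age realized_iff_emb by blast
  then show ?thesis using emb_comp[OF is_iso_emb[OF iso]] by blast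
qed

text \<open>The domain together with \<open>x\<close> embeds somewhere in \<open>F\<close>.
  Homogeneity of \<open>F\<close> moves this copy onto the given partial map and carries the image
  of \<open>x\<close> along.\<close>

lemma piso_extend:
  assumes age: "\<And>A :: nat cgraph. finite_cgraph A \<Longrightarrow> realized A G \<Longrightarrow> realized A F"
    and G: "simple_cgraph G" and F: "ultrahomogeneous F" and p: "finite p" "piso G F p" and x: "x \<in> verts G"
  shows "\<exists>y. piso G F (insert (x, y) p)"
proof -
  let ?S = "insert x (fst ` p)"
  have S: "finite ?S" "?S \<subseteq> verts G" using p x unfolding piso_def by auto
  have V: "verts (induced G ?S) = ?S" using S by (auto simp: induced_def)
  obtain e where e: "emb e (induced G ?S) F" using embeds_if_age_subset[OF age G S] by blast
  have e1: "e a \<in> verts F" "col F (e a) = col G a" if "a \<in> ?S" for a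
    using e that unfolding emb_def V by (auto simp: induced_def)
  have e2: "e a = e b \<longleftrightarrow> a = b" "adj F (e a) (e b) \<longleftrightarrow> adj G a b" if "a \<in> ?S" "b \<in> ?S" for a b
  proof -
    have "inj_on e ?S" using e unfolding emb_def V by blast
    then show "e a = e b \<longleftrightarrow> a = b" using inj_on_eq_iff that by metis
    have "adj F (e a) (e b) \<longleftrightarrow> adj (induced G ?S) a b" using e that unfolding emb_def V by blast
    then show "adj F (e a) (e b) \<longleftrightarrow> adj G a b" using that by (simp add: induced_def)
  qed
  let ?q = "(\<lambda>(a, b). (e a, b)) ` p"
  have inS: "a \<in> ?S" if "(a, b) \<in> p" for a b using that by force
  have "piso F F ?q"
  proof (rule pisoI)
    show "?q \<subseteq> verts F \<times> verts F" using e1(1) inS pisoD(2)[OF p(2)] by auto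
    fix u v u' v' assume "(u, v) \<in> ?q" "(u', v') \<in> ?q"
    then obtain a a' where a: "(a, v) \<in> p" "u = e a" "(a', v') \<in> p" "u' = e a'" by auto
    then show "(u = u' \<longleftrightarrow> v = v') \<and> (adj F u u' \<longleftrightarrow> adj F v v') \<and> col F u = col F v"
      using e2[OF inS[OF a(1)] inS[OF a(3)]] e1(2)[OF inS[OF a(1)]] pisoD[OF p(2) a(1)] a(3) by simp
  qed
  moreover have "finite ?q" using p by simp
  ultimately obtain g where g: "is_iso g F F" "\<forall>u v. (u, v) \<in> ?q \<longrightarrow> g u = v"
    using F unfolding ultrahomogeneous_iff by blast
  have gp: "g (e a) = b" if "(a, b) \<in> p" for a b
  proof -
    have "(e a, b) \<in> ?q" using that by force
    then show ?thesis using g(2) by blast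
  qed
  have gi: "g u \<in> verts F" "col F (g u) = col F u" if "u \<in> verts F" for u
    using g(1) that unfolding is_iso_def bij_betw_def by auto
  have gi2: "adj F (g u) (g v) \<longleftrightarrow> adj F u v" "g u = g v \<longleftrightarrow> u = v" if "u \<in> verts F" "v \<in> verts F" for u v
  proof -
    show "adj F (g u) (g v) \<longleftrightarrow> adj F u v" using g(1) that unfolding is_iso_def by blast
    have "inj_on g (verts F)" using g(1) unfolding is_iso_def bij_betw_def by blast
    then show "g u = g v \<longleftrightarrow> u = v" using inj_on_eq_iff that by metis
  qed
  let ?r = "insert (x, g (e x)) p"
  have r: "a \<in> ?S \<and> b = g (e a)" if "(a, b) \<in> ?r" for a b
    using that gp inS by auto
  have "piso G F ?r"
  proof (rule pisoI)
    show "?r \<subseteq> verts G \<times> verts F" using x gi(1)[OF e1(1)] p(2) unfolding piso_def by auto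
    fix a b a' b' assume "(a, b) \<in> ?r" "(a', b') \<in> ?r"
    then have a: "a \<in> ?S" "b = g (e a)" "a' \<in> ?S" "b' = g (e a')" using r by blast+
    then show "(a = a' \<longleftrightarrow> b = b') \<and> (adj G a a' \<longleftrightarrow> adj F b b') \<and> col G a = col F b"
      using e1[OF a(1)] e1[OF a(3)] e2[OF a(1,3)] gi gi2[of "e a" "e a'"] by simp
  qed
  then show ?thesis by blast
qed

lemma piso_converse: "piso G H p \<Longrightarrow> piso H G (p\<inverse>)"
  unfolding piso_def by auto

lemma fraisse_limit_unique:
  fixes G :: "'a cgraph" and F :: "'b cgraph"
  assumes G: "is_fraisse_limit K G" and F: "is_fraisse_limit K F"
  shows "isomorphic G F"
proof -
  have g: "simple_cgraph G" "countable (verts G)" "ultrahomogeneous G"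
    and f: "simple_cgraph F" "countable (verts F)" "ultrahomogeneous F"
    using assms unfolding is_fraisse_limit_def by auto
  have age: "finite_cgraph A \<Longrightarrow> realized A G \<longleftrightarrow> realized A F" for A :: "nat cgraph"
    using assms unfolding is_fraisse_limit_def by blast
  define P where "P = (\<lambda>(_::nat) p. finite p \<and> piso G F p)"
  \<comment> \<open>Stage \<open>n\<close> takes care of the \<open>n\<close>-th vertex of each
    graph. The membership guards cover an empty vertex set, where \<open>from_nat_into\<close> has
    an arbitrary value.\<close>
  define Q where "Q = (\<lambda>n p p'. p \<subseteq> p' \<and> (from_nat_into (verts G) n \<in> verts G \<longrightarrow> from_nat_into (verts G) n \<in> fst ` p') \<and>
     (from_nat_into (verts F) n \<in> verts F \<longrightarrow> from_nat_into (verts F) n \<in> snd ` p'))"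
  have "\<exists>s. \<forall>n. P n (s n) \<and> Q n (s n) (s (Suc n))"
  proof (rule dependent_nat_choice)
    show "\<exists>p. P 0 p" by (rule exI[of _ "{}"]) (simp add: P_def piso_def)
    fix p n assume "P n p"
    then have p: "finite p" "piso G F p" by (auto simp: P_def)
    have ex1: "\<exists>p'. finite p' \<and> piso G F p' \<and> p \<subseteq> p' \<and> (x \<in> verts G \<longrightarrow> x \<in> fst ` p')" for x
    proof (cases "x \<in> verts G")
      case True
      then obtain y where "piso G F (insert (x, y) p)" using piso_extend[OF _ g(1) f(3) p] age by blast
      then show ?thesis using p by (intro exI[of _ "insert (x, y) p"]) auto
    qed (use p in blast)
    obtain p' where p': "finite p'" "piso G F p'" "p \<subseteq> p'"
      "from_nat_into (verts G) n \<in> verts G \<longrightarrow> from_nat_into (verts G) n \<in> fst ` p'"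
      using ex1[of "from_nat_into (verts G) n"] by (elim exE conjE)
    have ex2: "\<exists>q. finite q \<and> piso G F q \<and> p' \<subseteq> q \<and> (y \<in> verts F \<longrightarrow> y \<in> snd ` q)" for y
    proof (cases "y \<in> verts F")
      case True
      have "finite (p'\<inverse>)" using p' by simp
      then obtain x where "piso F G (insert (y, x) (p'\<inverse>))"
        using piso_extend[OF _ f(1) g(3) _ piso_converse[OF p'(2)] True] age by blast
      then have "piso G F ((insert (y, x) (p'\<inverse>))\<inverse>)" by (rule piso_converse)
      moreover have "(insert (y, x) (p'\<inverse>))\<inverse> = insert (x, y) p'" by auto
      ultimately have "piso G F (insert (x, y) p')" by simp
      then show ?thesis using p' by (intro exI[of _ "insert (x, y) p'"]) auto
    qed (use p' in blast)
    obtain q where q: "finite q" "piso G F q" "p' \<subseteq> q"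
      "from_nat_into (verts F) n \<in> verts F \<longrightarrow> from_nat_into (verts F) n \<in> snd ` q"
      using ex2[of "from_nat_into (verts F) n"] by (elim exE conjE)
    have "fst ` p' \<subseteq> fst ` q" using q(3) by (rule image_mono)
    then have "Q n p q" unfolding Q_def using p'(3,4) q(3,4) by blast
    moreover have "P (Suc n) q" unfolding P_def using q by blast
    ultimately show "\<exists>q. P (Suc n) q \<and> Q n p q" by blast
  qed
  then obtain s where s: "\<And>n. piso G F (s n)" "\<And>n. Q n (s n) (s (Suc n))" unfolding P_def by blast
  have mono: "m \<le> n \<Longrightarrow> s m \<subseteq> s n" for m n
    by (rule lift_Suc_mono_le[of s]) (use s(2) in \<open>auto simp: Q_def\<close>)
  let ?r = "\<Union>n. s n"
  have r: "piso G F ?r"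
  proof (rule pisoI)
    show "?r \<subseteq> verts G \<times> verts F" using s(1) unfolding piso_def by blast
    fix x y x' y' assume "(x, y) \<in> ?r" "(x', y') \<in> ?r"
    then obtain m n where "(x, y) \<in> s m" "(x', y') \<in> s n" by blast
    then have i: "(x, y) \<in> s (max m n)" "(x', y') \<in> s (max m n)" using mono[of m "max m n"] mono[of n "max m n"] by auto
    show "(x = x' \<longleftrightarrow> y = y') \<and> (adj G x x' \<longleftrightarrow> adj F y y') \<and> col G x = col F y"
      using pisoD[OF s(1) i(1)] i(2) by auto
  qed
  have dom: "fst ` ?r = verts G"
  proof
    show "fst ` ?r \<subseteq> verts G" using r unfolding piso_def by auto
    show "verts G \<subseteq> fst ` ?r"
    proof
      fix x assume x: "x \<in> verts G"
      then obtain n where "from_nat_into (verts G) n = x" using from_nat_into_surj[OF g(2)] by blast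
      then have "x \<in> fst ` s (Suc n)" using s(2)[of n] x unfolding Q_def by auto
      then show "x \<in> fst ` ?r" by blast
    qed
  qed
  have ran: "snd ` ?r = verts F"
  proof
    show "snd ` ?r \<subseteq> verts F" using r unfolding piso_def by auto
    show "verts F \<subseteq> snd ` ?r"
    proof
      fix x assume x: "x \<in> verts F"
      then obtain n where "from_nat_into (verts F) n = x" using from_nat_into_surj[OF f(2)] by blast
      then have "x \<in> snd ` s (Suc n)" using s(2)[of n] x unfolding Q_def by auto
      then show "x \<in> snd ` ?r" by blast
    qed
  qed
  obtain h where h: "\<And>x y. (x, y) \<in> ?r \<longleftrightarrow> x \<in> fst ` ?r \<and> y = h x" using piso_function[OF r] by blast
  have "is_iso h (induced G (fst ` ?r)) (induced F (snd ` ?r))" by (rule piso_iso[OF r h])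
  then have i: "is_iso h (induced G (verts G)) (induced F (verts F))" unfolding dom ran .
  have hv: "h x \<in> verts F" if "x \<in> verts G" for x using i that unfolding is_iso_def bij_betw_def by (auto simp: induced_def)
  have "is_iso h G F" using i hv unfolding is_iso_def by (simp add: induced_def)
  then show ?thesis unfolding isomorphic_def by blast
qed

lemma is_fraisse_limit_iso:
  assumes i: "is_iso f G H" and sH: "simple_cgraph H" and G: "is_fraisse_limit K G"
  shows "is_fraisse_limit K H"
proof -
  let ?k = "inv_into (verts G) f"
  have k: "is_iso ?k H G" by (rule is_iso_inv[OF i])
  have f1: "f x \<in> verts H" "col H (f x) = col G x" "?k (f x) = x" if "x \<in> verts G" for x
    using i that unfolding is_iso_def bij_betw_def by auto
  have f2: "adj H (f x) (f y) \<longleftrightarrow> adj G x y" "f x = f y \<longleftrightarrow> x = y" if "x \<in> verts G" "y \<in> verts G" for x y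
  proof -
    show "adj H (f x) (f y) \<longleftrightarrow> adj G x y" using i that unfolding is_iso_def by blast
    have "inj_on f (verts G)" using i unfolding is_iso_def bij_betw_def by blast
    then show "f x = f y \<longleftrightarrow> x = y" using inj_on_eq_iff that by metis
  qed
  have k1: "?k u \<in> verts G" "f (?k u) = u" if "u \<in> verts H" for u
    using i that unfolding is_iso_def bij_betw_def by (auto simp: inv_into_into f_inv_into_f)
  have "ultrahomogeneous H" unfolding ultrahomogeneous_iff
  proof (intro allI impI, elim conjE)
    fix p assume p: "finite p" "piso H H p"
    let ?q = "(\<lambda>(u, v). (?k u, ?k v)) ` p"
    have "piso G G ?q"
    proof (rule pisoI)
      show "?q \<subseteq> verts G \<times> verts G" using k1 p(2) unfolding piso_def by auto
      fix x y x' y' assume "(x, y) \<in> ?q" "(x', y') \<in> ?q"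
      then obtain u v u' v' where u: "(u, v) \<in> p" "(u', v') \<in> p" "x = ?k u" "y = ?k v" "x' = ?k u'" "y' = ?k v'" by auto
      note d = pisoD[OF p(2) u(1)] pisoD(1,2)[OF p(2) u(2)]
      have "x = x' \<longleftrightarrow> u = u'" "y = y' \<longleftrightarrow> v = v'" "adj G x x' \<longleftrightarrow> adj H u u'" "adj G y y' \<longleftrightarrow> adj H v v'"
        "col G x = col H u" "col G y = col H v"
        using u k1 d f2 f1(2) by metis+
      then show "(x = x' \<longleftrightarrow> y = y') \<and> (adj G x x' \<longleftrightarrow> adj G y y') \<and> col G x = col G y"
        using d(3) d(4)[OF u(2)] d(5)[OF u(2)] by simp
    qed
    moreover have "finite ?q" using p by simp
    ultimately obtain g where g: "is_iso g G G" "\<forall>x y. (x, y) \<in> ?q \<longrightarrow> g x = y"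
      using G unfolding is_fraisse_limit_def ultrahomogeneous_iff by blast
    let ?h = "\<lambda>u. f (g (?k u))"
    have "is_iso ?h H H"
    proof -
      have "bij_betw (f \<circ> (g \<circ> ?k)) (verts H) (verts H)"
        using k g(1) i unfolding is_iso_def by (meson bij_betw_trans)
      moreover have gv: "g x \<in> verts G" if "x \<in> verts G" for x using g(1) that unfolding is_iso_def bij_betw_def by auto
      moreover have "adj H (?h u) (?h v) \<longleftrightarrow> adj H u v" if "u \<in> verts H" "v \<in> verts H" for u v
      proof -
        have "adj G (g (?k u)) (g (?k v)) \<longleftrightarrow> adj G (?k u) (?k v)" using g(1) k1 that unfolding is_iso_def by blast
        moreover have "adj H u v \<longleftrightarrow> adj G (?k u) (?k v)" using f2(1)[of "?k u" "?k v"] k1 that by simp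
        ultimately show ?thesis using f2(1)[of "g (?k u)" "g (?k v)"] gv k1 that by simp
      qed
      moreover have "col H (?h u) = col H u" if "u \<in> verts H" for u
      proof -
        have "col G (g (?k u)) = col G (?k u)" using g(1) k1 that unfolding is_iso_def by blast
        then show ?thesis using f1(2)[of "g (?k u)"] f1(2)[of "?k u"] gv k1 that by simp
      qed
      ultimately show ?thesis unfolding is_iso_def by (simp add: comp_def)
    qed
    moreover have "?h u = v" if "(u, v) \<in> p" for u v
    proof -
      have "(?k u, ?k v) \<in> ?q" using that by force
      then have "g (?k u) = ?k v" using g(2) by blast
      then show ?thesis using k1(2) pisoD(2)[OF p(2) that] by simp
    qed
    ultimately show "\<exists>g. is_iso g H H \<and> (\<forall>x y. (x, y) \<in> p \<longrightarrow> g x = y)" by blast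
  qed
  moreover have "countable (verts H)"
  proof -
    have "verts H = f ` verts G" using i unfolding is_iso_def bij_betw_def by simp
    then show ?thesis using G unfolding is_fraisse_limit_def by simp
  qed
  moreover have "realized A G \<longleftrightarrow> realized A H" for A :: "nat cgraph"
    unfolding realized_iff_emb using emb_comp[OF _ is_iso_emb[OF i]] emb_comp[OF _ is_iso_emb[OF k]] by blast
  ultimately show ?thesis using G sH unfolding is_fraisse_limit_def by simp
qed

text \<open>A copy of the countable graph \<open>G\<close> on natural numbers witnesses the choice
  in \<open>fraisse_limit\<close>; uniqueness then identifies \<open>G\<close> with the chosen
  graph.\<close>

lemma isomorphic_fraisse_limit:
  assumes G: "is_fraisse_limit K G"
  shows "isomorphic G (fraisse_limit K)"
proof -
  have c: "countable (verts G)" "simple_cgraph G" using G unfolding is_fraisse_limit_def by auto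
  have inj: "inj_on (to_nat_on (verts G)) (verts G)" by (rule inj_on_to_nat_on[OF c(1)])
  have "is_fraisse_limit K (copy (to_nat_on (verts G)) G)"
    by (rule is_fraisse_limit_iso[OF is_iso_copy[OF inj] simple_copy[OF inj c(2)] G])
  then have "is_fraisse_limit K (fraisse_limit K)" unfolding fraisse_limit_def by (rule someI)
  then show ?thesis using fraisse_limit_unique[OF G] by blast
qed

section \<open>Blow-ups\<close>

text \<open>If clique mates of color \<open>c\<close> are never separated, each of their cliques can
  be collapsed to one representative. Homogeneity makes all these cliques equally large, which
  supplies the constant \<open>i\<close>.\<close>

lemma blow_up_if_uniform:
  fixes G :: "'a cgraph"
  assumes q: "clq G" and cnt: "countable (verts G)" and u: "ultrahomogeneous G"
    and e: "adj G x0 y0" "col G x0 = c" "col G y0 = c"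
    and same: "\<And>x y z. adj G x y \<Longrightarrow> col G x = c \<Longrightarrow> col G y = c \<Longrightarrow> z \<in> verts G \<Longrightarrow> col G z \<noteq> c \<Longrightarrow> adj G x z = adj G y z"
  shows "is_blow_up G"
proof -
  have simp: "simple_cgraph G" using q by (simp add: clq_def)
  have s: "adj G x y \<Longrightarrow> x \<in> verts G \<and> y \<in> verts G \<and> x \<noteq> y \<and> adj G y x" for x y
    using simp by (auto simp: simple_cgraph_def)
  have tr: "adj G x z" if "adj G x y" "adj G y z" "x \<noteq> z" "col G x = c" "col G y = c" "col G z = c" for x y z
  proof -
    have "col G x = col G y \<and> col G y = col G z" using that by simp
    then show ?thesis using q that(1-3) unfolding clq_def by blast
  qed
  define V where "V = {x \<in> verts G. col G x = c}"
  define cl where "cl x = {y \<in> V. y = x \<or> adj G x y}" for x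
  \<comment> \<open>Both \<open>rep\<close> and the later \<open>hh\<close> depend on the class as a
    set, so that all its members share one representative and one numbering.\<close>
  define rep where "rep x = (SOME y. y \<in> cl x)" for x
  have clI: "x \<in> cl x" if "x \<in> V" for x using that by (simp add: cl_def)
  have cl_sub: "cl y \<subseteq> cl x" if "x \<in> V" "y \<in> V" "adj G x y" for x y
  proof
    fix z assume z: "z \<in> cl y"
    then have zV: "z \<in> V" by (simp add: cl_def)
    show "z \<in> cl x"
    proof (cases "z = x \<or> z = y")
      case True then show ?thesis using that zV by (auto simp: cl_def)
    next
      case False
      then have "adj G y z" using z by (simp add: cl_def)
      then have "adj G x z" using tr[OF that(3)] False that zV by (auto simp: V_def)
      then show ?thesis using zV by (simp add: cl_def)
    qed
  qed
  have cl_eq: "cl x = cl y \<longleftrightarrow> x = y \<or> adj G x y" if "x \<in> V" "y \<in> V" for x y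
  proof
    assume "cl x = cl y"
    then have "y \<in> cl x" using clI[OF that(2)] by simp
    then show "x = y \<or> adj G x y" by (auto simp: cl_def)
  next
    assume "x = y \<or> adj G x y"
    then show "cl x = cl y" using cl_sub[OF that] cl_sub[OF that(2,1)] s[of x y] by auto
  qed
  have rep: "rep x \<in> V" "cl (rep x) = cl x" if "x \<in> V" for x
  proof -
    have r: "rep x \<in> cl x" unfolding rep_def by (rule someI, rule clI[OF that])
    then show rV: "rep x \<in> V" by (simp add: cl_def)
    have "x = rep x \<or> adj G x (rep x)" using r unfolding cl_def by auto
    then show "cl (rep x) = cl x" using cl_eq[OF that rV] by blast
  qed
  have rep_cong: "rep x = rep y" if "cl x = cl y" for x y using that by (simp add: rep_def)
  have rep_eq: "rep x = rep y \<longleftrightarrow> cl x = cl y" if "x \<in> V" "y \<in> V" for x y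
    using rep(2)[OF that(1)] rep(2)[OF that(2)] rep_cong by metis
  have x0: "x0 \<in> V" "y0 \<in> V" using s[OF e(1)] e by (auto simp: V_def)
  define i where "i = (if finite (cl x0) then enat (card (cl x0)) else \<infinity>)"
  have ex: "\<exists>h. bij_betw h (cl x) {k. enat k < i}" if x: "x \<in> V" for x
  proof -
    have I: "verts (induced G {z}) = {z}" if "z \<in> V" for z using that by (auto simp: induced_def V_def)
    have nx: "\<not> adj G z z" for z using s[of z z] by blast
    \<comment> \<open>One-vertex subgraphs of color \<open>c\<close> are all isomorphic, so some
      automorphism takes \<open>x0\<close> to \<open>x\<close>, and with it the clique of
      \<open>x0\<close> to that of \<open>x\<close>.\<close>
    have "is_iso (\<lambda>_. x) (induced G {x0}) (induced G {x})"
      unfolding is_iso_def I[OF x] I[OF x0(1)] using x x0 nx by (auto simp: induced_def V_def bij_betw_def)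
    moreover have "{x0} \<subseteq> verts G" "{x} \<subseteq> verts G" using x x0 by (auto simp: V_def)
    ultimately have "\<exists>g. is_iso g G G \<and> (\<forall>z\<in>{x0}. g z = x)"
      by (intro mp[OF spec[OF spec[OF spec[OF u[unfolded ultrahomogeneous_def]]]], of "{x0}" "{x}" "\<lambda>_. x"]) blast
    then obtain g where g: "is_iso g G G" "g x0 = x" by blast
    have gc: "g z \<in> V \<longleftrightarrow> z \<in> V" "adj G x (g z) \<longleftrightarrow> adj G x0 z" if "z \<in> verts G" for z
    proof -
      have "g z \<in> verts G" "col G (g z) = col G z" using g(1) that unfolding is_iso_def bij_betw_def by auto
      then show "g z \<in> V \<longleftrightarrow> z \<in> V" using that by (simp add: V_def)
      have "x0 \<in> verts G" using x0 by (simp add: V_def)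
      then have "adj G (g x0) (g z) \<longleftrightarrow> adj G x0 z" using g(1) that unfolding is_iso_def by blast
      then show "adj G x (g z) \<longleftrightarrow> adj G x0 z" using g(2) by simp
    qed
    have ginj: "inj_on g (verts G)" and gsurj: "g ` verts G = verts G" using g(1) unfolding is_iso_def bij_betw_def by blast+
    have sub: "cl x0 \<subseteq> verts G" by (auto simp: cl_def V_def)
    have img: "g ` cl x0 = cl x"
    proof (intro set_eqI iffI)
      fix z assume "z \<in> g ` cl x0"
      then obtain w where w: "w \<in> cl x0" "z = g w" by blast
      then have wV: "w \<in> verts G" "w \<in> V" "w = x0 \<or> adj G x0 w" using sub by (auto simp: cl_def)
      then show "z \<in> cl x" using gc[OF wV(1)] g(2) w(2) by (auto simp: cl_def)
    next
      fix z assume z: "z \<in> cl x"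
      then have zV: "z \<in> verts G" "z \<in> V" "z = x \<or> adj G x z" by (auto simp: cl_def V_def)
      obtain w where w: "w \<in> verts G" "z = g w" using zV(1) gsurj by blast
      have "w = x0 \<or> adj G x0 w"
      proof (cases "z = x")
        case True
        then have "g w = g x0" using w g(2) by simp
        then show ?thesis using ginj w(1) x0 by (auto simp: V_def dest: inj_onD)
      next
        case False then show ?thesis using zV(3) gc(2)[OF w(1)] w(2) by simp
      qed
      then show "z \<in> g ` cl x0" using gc(1)[OF w(1)] zV(2) w by (auto simp: cl_def)
    qed
    have bij: "bij_betw g (cl x0) (cl x)" using img ginj sub unfolding bij_betw_def by (meson inj_on_subset)
    show ?thesis
    proof (cases "finite (cl x0)")
      case True
      then have "finite (cl x)" "card (cl x) = card (cl x0)" using bij bij_betw_finite bij_betw_same_card by metis+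
      then obtain h where "bij_betw h (cl x) {0..<card (cl x0)}" using ex_bij_betw_finite_nat by metis
      moreover have "{0..<card (cl x0)} = {k. enat k < i}" using True by (auto simp: i_def)
      ultimately show ?thesis by auto
    next
      case False
      then have inf: "infinite (cl x)" using bij bij_betw_finite by blast
      have "cl x \<subseteq> verts G" by (auto simp: cl_def V_def)
      then have "countable (cl x)" using cnt countable_subset by blast
      then have "bij_betw (to_nat_on (cl x)) (cl x) UNIV" using inf by (rule to_nat_on_infinite)
      moreover have "{k. enat k < i} = UNIV" using False by (auto simp: i_def)
      ultimately show ?thesis by auto
    qed
  qed
  define hh where "hh K = (SOME h. bij_betw h K {k. enat k < i})" for K :: "'a set"
  have hh: "bij_betw (hh (cl x)) (cl x) {k. enat k < i}" if "x \<in> V" for x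
    unfolding hh_def by (rule someI_ex[OF ex[OF that]])
  define W where "W = rep ` V \<union> {x \<in> verts G. col G x \<noteq> c}"
  have WG: "W \<subseteq> verts G" using rep(1) by (auto simp: W_def V_def)
  define H where "H = induced G W"
  have H: "verts H = W" "\<And>x y. adj H x y \<longleftrightarrow> x \<in> W \<and> y \<in> W \<and> adj G x y" "col H = col G"
    using WG by (auto simp: H_def induced_def)
  have Wc: "x \<in> W \<longleftrightarrow> x \<in> rep ` V" if "col G x = c" for x using that by (auto simp: W_def)
  have repn: "\<not> adj G (rep x) (rep y)" if "x \<in> V" "y \<in> V" for x y
  proof
    assume a: "adj G (rep x) (rep y)"
    then have "cl (rep x) = cl (rep y)" using cl_eq[OF rep(1)[OF that(1)] rep(1)[OF that(2)]] by simp
    then have "rep x = rep y" using rep(2) that rep_cong by metis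
    then show False using s[OF a] by simp
  qed
  let ?U = "blow_up c i H"
  have Uv: "(v, k) \<in> verts ?U \<longleftrightarrow> v \<in> W \<and> (if col G v = c then enat k < i else k = 0)" for v k
    by (simp add: blow_up_def Let_def H)
  have Ua: "adj ?U a b \<longleftrightarrow> a \<in> verts ?U \<and> b \<in> verts ?U \<and> (fst a = fst b \<and> snd a \<noteq> snd b \<or> adj H (fst a) (fst b))" for a b
    by (simp add: blow_up_def Let_def)
  have Uc: "col ?U a = col G (fst a)" for a by (simp add: blow_up_def Let_def H)
  define f where "f v = (if col G v = c then (rep v, hh (cl v) v) else (v, 0))" for v
  have fV: "f v = (rep v, hh (cl v) v)" if "v \<in> V" for v using that by (simp add: f_def V_def)
  have fN: "f v = (v, 0)" if "col G v \<noteq> c" for v using that by (simp add: f_def)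
  have repc: "col G (rep v) = c" "rep v \<in> W" if "v \<in> V" for v using rep(1)[OF that] that by (auto simp: V_def W_def)
  have hlt: "enat (hh (cl v) v) < i" if "v \<in> V" for v
    using hh[OF that] clI[OF that] unfolding bij_betw_def by blast
  have fU: "f v \<in> verts ?U" if "v \<in> verts G" for v
  proof (cases "col G v = c")
    case True
    then have v: "v \<in> V" using that by (simp add: V_def)
    show ?thesis unfolding fV[OF v] Uv using repc[OF v] hlt[OF v] by simp
  next
    case False then show ?thesis unfolding fN[OF False] Uv using that by (simp add: W_def)
  qed
  have inj: "inj_on f (verts G)"
  proof (rule inj_onI)
    fix v w assume vw: "v \<in> verts G" "w \<in> verts G" "f v = f w"
    consider "v \<in> V" "w \<in> V" | "v \<in> V" "col G w \<noteq> c" | "col G v \<noteq> c" "w \<in> V" | "col G v \<noteq> c" "col G w \<noteq> c"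
      using vw by (auto simp: V_def)
    then show "v = w"
    proof cases
      case 1
      then have r: "rep v = rep w" "hh (cl v) v = hh (cl w) w" using vw fV by auto
      then have c: "cl v = cl w" using rep_eq 1 by simp
      have "inj_on (hh (cl v)) (cl v)" using hh[OF 1(1)] by (simp add: bij_betw_def)
      then show ?thesis using r(2) c clI[OF 1(1)] clI[OF 1(2)] by (auto dest: inj_onD)
    next
      case 2 then show ?thesis using vw fV fN repc by auto
    next
      case 3 then show ?thesis using vw fV fN repc by auto
    next
      case 4 then show ?thesis using vw fN by simp
    qed
  qed
  have surj: "f ` verts G = verts ?U"
  proof
    show "f ` verts G \<subseteq> verts ?U" using fU by blast
    show "verts ?U \<subseteq> f ` verts G"
    proof
      fix a assume a: "a \<in> verts ?U"
      obtain v k where vk: "a = (v, k)" by (cases a)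
      have v: "v \<in> W" "if col G v = c then enat k < i else k = 0" using a Uv vk by auto
      show "a \<in> f ` verts G"
      proof (cases "col G v = c")
        case True
        then obtain x where x: "x \<in> V" "v = rep x" using v(1) Wc by blast
        have "k \<in> hh (cl x) ` cl x" using hh[OF x(1)] v(2) True unfolding bij_betw_def by simp
        then obtain w where w: "w \<in> cl x" "k = hh (cl x) w" by blast
        then have wV: "w \<in> V" "x = w \<or> adj G x w" by (auto simp: cl_def)
        then have cxw: "cl x = cl w" using cl_eq[OF x(1) wV(1)] by blast
        have "f w = a" unfolding fV[OF wV(1)] cxw[symmetric] rep_cong[OF cxw, symmetric] vk x(2) w(2) ..
        moreover have "w \<in> verts G" using wV by (simp add: V_def)
        ultimately show ?thesis by blast
      next
        case False
        then have "f v = a" using fN v(2) vk by simp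
        then show ?thesis using v(1) WG by blast
      qed
    qed
  qed
  have iso: "is_iso f G ?U"
    unfolding is_iso_def
  proof (intro conjI ballI)
    show "bij_betw f (verts G) (verts ?U)" using inj surj by (simp add: bij_betw_def)
    fix v assume v: "v \<in> verts G"
    show "col ?U (f v) = col G v"
    proof (cases "col G v = c")
      case True
      then have "v \<in> V" using v by (simp add: V_def)
      then show ?thesis unfolding Uc using fV repc True by simp
    next
      case False then show ?thesis unfolding Uc using fN by simp
    qed
    fix w assume w: "w \<in> verts G"
    have A: "adj ?U (f v) (f w) \<longleftrightarrow> fst (f v) = fst (f w) \<and> snd (f v) \<noteq> snd (f w) \<or> adj H (fst (f v)) (fst (f w))"
      using Ua fU[OF v] fU[OF w] by blast
    have cross: "adj H (rep a) b \<longleftrightarrow> adj G a b" if a: "a \<in> V" and b: "b \<in> verts G" "col G b \<noteq> c" for a b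
    proof -
      have "a = rep a \<or> adj G a (rep a)" using cl_eq[OF a rep(1)[OF a]] rep(2)[OF a] by simp
      moreover have "col G a = c" using a by (simp add: V_def)
      ultimately have "adj G a b = adj G (rep a) b" using same[of a "rep a" b] repc[OF a] b by metis
      moreover have "b \<in> W" using b by (simp add: W_def)
      ultimately show ?thesis using H(2) repc[OF a] by simp
    qed
    have symH: "adj H a b = adj H b a" for a b using H(2) s[of a b] s[of b a] by blast
    have symG: "adj G a b = adj G b a" for a b using s[of a b] s[of b a] by blast
    consider "v \<in> V" "w \<in> V" | "v \<in> V" "col G w \<noteq> c" | "col G v \<noteq> c" "w \<in> V" | "col G v \<noteq> c" "col G w \<noteq> c"
      using v w by (auto simp: V_def)
    then show "adj ?U (f v) (f w) = adj G v w"
    proof cases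
      case 1
      have "adj ?U (f v) (f w) \<longleftrightarrow> cl v = cl w \<and> hh (cl v) v \<noteq> hh (cl w) w"
        using A repn[OF 1] H(2)[of "rep v" "rep w"] rep_eq[OF 1] unfolding fV[OF 1(1)] fV[OF 1(2)] fst_conv snd_conv by blast
      moreover have "hh (cl v) v = hh (cl w) w \<longleftrightarrow> v = w" if c: "cl v = cl w"
      proof -
        have "inj_on (hh (cl v)) (cl v)" using hh[OF 1(1)] by (simp add: bij_betw_def)
        then show ?thesis using c clI[OF 1(1)] clI[OF 1(2)] by (auto dest: inj_onD)
      qed
      ultimately show ?thesis using cl_eq[OF 1] s[of v w] by metis
    next
      case 2
      have "rep v \<noteq> w" using repc[OF 2(1)] 2(2) by auto
      then show ?thesis using A cross[OF 2(1) w 2(2)] unfolding fV[OF 2(1)] fN[OF 2(2)] fst_conv snd_conv by blast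
    next
      case 3
      have "rep w \<noteq> v" using repc[OF 3(2)] 3(1) by auto
      then show ?thesis using A cross[OF 3(2) v 3(1)] symH[of v "rep w"] symG[of v w]
        unfolding fV[OF 3(2)] fN[OF 3(1)] fst_conv snd_conv by blast
    next
      case 4
      have "v \<in> W" "w \<in> W" using 4 v w by (auto simp: W_def)
      then show ?thesis using A H(2)[of v w] unfolding fN[OF 4(1)] fN[OF 4(2)] fst_conv snd_conv by blast
    qed
  qed
  have "2 \<le> i"
  proof (cases "finite (cl x0)")
    case True
    have "{x0, y0} \<subseteq> cl x0" using x0 e by (auto simp: cl_def)
    then have "card {x0, y0} \<le> card (cl x0)" using True by (rule card_mono[rotated])
    moreover have "card {x0, y0} = 2" using s[OF e(1)] by simp
    ultimately have "enat 2 \<le> i" using True by (simp add: i_def)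
    then show ?thesis by (simp add: numeral_eq_enat)
  next
    case False then show ?thesis by (simp add: i_def)
  qed
  moreover have "simple_cgraph H" unfolding H_def by (rule simple_induced[OF simp])
  moreover have "independent_set H (color_class H c)"
    unfolding independent_set_def color_class_def H(1) H(3)
  proof (intro conjI ballI)
    fix a b assume "a \<in> {x \<in> W. col G x = c}" "b \<in> {x \<in> W. col G x = c}"
    then obtain x y where "x \<in> V" "a = rep x" "y \<in> V" "b = rep y" using Wc by blast
    then show "\<not> adj H a b" using repn H(2) by simp
  qed blast
  ultimately show ?thesis unfolding is_blow_up_def isomorphic_def using iso by blast
qed

section \<open>From graphs to the bipartite setting\<close>

text \<open>Finite thresholds are used because an infinite \<open>alpha\<close> may come from
  arbitrarily large finite sets as well as from an infinite one.\<close>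

lemma alpha_ge_iff:
  "enat k \<le> alpha c G \<longleftrightarrow> (\<exists>I. finite I \<and> card I = k \<and> I \<subseteq> color_class G c \<and> independent_set G I)"
proof -
  let ?H = "induced G (color_class G c)"
  have V: "verts ?H = color_class G c" by (auto simp: induced_def color_class_def)
  have ind: "independent_set ?H I \<longleftrightarrow> I \<subseteq> color_class G c \<and> independent_set G I" for I
    by (auto simp: independent_set_def V) (auto simp: induced_def color_class_def)
  show ?thesis
  proof
    assume a: "enat k \<le> alpha c G"
    show "\<exists>I. finite I \<and> card I = k \<and> I \<subseteq> color_class G c \<and> independent_set G I"
    proof (cases k)
      case 0
      have "finite {} \<and> card {} = k \<and> {} \<subseteq> color_class G c \<and> independent_set G {}"
        by (simp add: 0 independent_set_def)
      then show ?thesis by (rule exI)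
    next
      case (Suc m)
      show ?thesis
      proof (rule ccontr)
        assume n: "\<not> ?thesis"
        \<comment> \<open>With \<open>k = Suc m\<close>, the lack of a set of size \<open>k\<close>
          bounds every independent set by \<open>m\<close>, and hence the supremum.\<close>
        have "(if finite I then enat (card I) else \<infinity>) \<le> enat m" if I: "independent_set ?H I" for I
        proof -
          have I': "I \<subseteq> color_class G c" "independent_set G I" using I ind[of I] by blast+
          have sub: "\<not> (J \<subseteq> I \<and> finite J \<and> card J = k)" for J
          proof
            assume J: "J \<subseteq> I \<and> finite J \<and> card J = k"
            then have "independent_set G J" using I'(2) unfolding independent_set_def by (meson subsetD subset_trans)
            moreover have "J \<subseteq> color_class G c" using J I'(1) by (meson subset_trans)
            ultimately show False using n J by blast
          qed
          have f: "finite I"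
          proof (rule ccontr)
            assume "infinite I"
            then obtain J where "finite J" "card J = k" "J \<subseteq> I" using infinite_arbitrarily_large[of I k] by auto
            then show False using sub[of J] by simp
          qed
          have "\<not> k \<le> card I"
          proof
            assume "k \<le> card I"
            then obtain J where J: "J \<subseteq> I" "card J = k" by (meson obtain_subset_with_card_n)
            then show False using sub[of J] finite_subset[OF J(1) f] by simp
          qed
          then show ?thesis using f Suc by simp
        qed
        then have "alpha c G \<le> enat m"
          unfolding alpha_def independence_number_def by (intro SUP_least) blast
        then show False using a Suc by (meson Suc_n_not_le_n enat_ord_simps(1) order_trans)
      qed
    qed
  next
    assume "\<exists>I. finite I \<and> card I = k \<and> I \<subseteq> color_class G c \<and> independent_set G I"
    then obtain I where I: "finite I" "card I = k" "independent_set ?H I" using ind by blast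
    have "(if finite I then enat (card I) else \<infinity>) \<le> alpha c G"
      unfolding alpha_def independence_number_def using I(3) by (intro SUP_upper) blast
    then show "enat k \<le> alpha c G" using I by simp
  qed
qed

definition mono_adj :: "'a cgraph \<Rightarrow> 'a \<Rightarrow> 'a \<Rightarrow> bool" where
  "mono_adj G x y \<longleftrightarrow> adj G x y \<and> col G x = col G y"

text \<open>Not being a blow-up enters through the contrapositive of
  \<open>blow_up_if_uniform\<close>: in each color that has an edge, some edge is separated. The
  lower bounds on \<open>alpha\<close> supply two nonadjacent vertices of each color.\<close>

lemma bicol_of_basic_CUH:
  fixes G :: "'a cgraph"
  assumes G: "basic_CUH G"
  shows "bicol (color_class G Red) (color_class G Blue) (mono_adj G) (adj G)"
proof -
  have u: "ultrahomogeneous G" and q: "clq G" and cnt: "countable (verts G)" and inf: "infinite (verts G)"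
    and nb: "\<not> is_blow_up G" and al: "2 \<le> alpha Red G" "2 \<le> alpha Blue G"
    using G unfolding basic_CUH_def CUH_def clq_iff by auto
  have s: "adj G x y \<Longrightarrow> x \<in> verts G \<and> y \<in> verts G \<and> x \<noteq> y \<and> adj G y x" for x y
    using q unfolding clq_def simple_cgraph_def by blast
  have cc: "x \<in> color_class G c \<longleftrightarrow> x \<in> verts G \<and> col G x = c" for x c by (simp add: color_class_def)
  have two: "\<exists>x\<in>color_class G c. \<exists>y\<in>color_class G c. x \<noteq> y \<and> \<not> mono_adj G x y" for c
  proof -
    have "enat 2 \<le> alpha c G" using al by (cases c) (auto simp: numeral_eq_enat)
    then obtain I where I: "finite I" "card I = 2" "I \<subseteq> color_class G c" "independent_set G I"
      unfolding alpha_ge_iff by blast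
    then obtain x y where xy: "I = {x, y}" "x \<noteq> y" by (meson card_2_iff)
    have "x \<in> color_class G c" "y \<in> color_class G c" "\<not> mono_adj G x y"
      using I(3,4) unfolding xy(1) independent_set_def mono_adj_def by simp_all
    then show ?thesis using xy(2) by blast
  qed
  have split: "\<exists>x\<in>color_class G c. \<exists>y\<in>color_class G c. \<exists>z\<in>color_class G d. mono_adj G x y \<and> adj G x z \<noteq> adj G y z"
    if "mono_adj G x y" "x \<in> color_class G c" "y \<in> color_class G c" "d \<noteq> c" for x y c d
  proof (rule ccontr)
    assume n: "\<not> ?thesis"
    have "is_blow_up G"
    proof (rule blow_up_if_uniform[OF q cnt u])
      show "adj G x y" "col G x = c" "col G y = c" using that unfolding mono_adj_def cc by auto
      fix x' y' z assume a: "adj G x' y'" "col G x' = c" "col G y' = c" "z \<in> verts G" "col G z \<noteq> c"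
      have "col G z = d" using a(5) that(4) by (cases "col G z"; cases c; cases d) auto
      then have "x' \<in> color_class G c" "y' \<in> color_class G c" "z \<in> color_class G d" "mono_adj G x' y'"
        using a s[OF a(1)] unfolding cc mono_adj_def by auto
      then show "adj G x' z = adj G y' z" using n by blast
    qed
    then show False using nb by blast
  qed
  have symadj: "adj G x y = adj G y x" for x y using s[of x y] s[of y x] by blast
  show ?thesis
  proof (unfold_locales, goal_cases)
    case 1 show ?case by (auto simp: color_class_def)
  next
    case (2 x y) then show ?case using s by (auto simp: mono_adj_def)
  next
    case (3 x) then show ?case using s[of x x] by (auto simp: mono_adj_def)
  next
    case (4 x y z)
    then have "adj G x y \<and> adj G y z \<and> x \<noteq> z \<and> col G x = col G y \<and> col G y = col G z" by (simp add: mono_adj_def)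
    then have "adj G x z" using q unfolding clq_def by blast
    then show ?case using 4 by (simp add: mono_adj_def)
  next
    case (5 x y)
    then have "adj G x y" "col G x = col G y" by (auto simp: mono_adj_def)
    then show ?case using s[of x y] unfolding cc by (cases "col G x") auto
  next
    case (6 p)
    have p2: "x \<in> verts G" "y \<in> verts G" "col G x = col G y" if "(x, y) \<in> p" for x y
      using 6(2) that unfolding color_class_def by auto
    have "piso G G p"
    proof (rule pisoI)
      show "p \<subseteq> verts G \<times> verts G" using p2 by auto
      fix x y x' y' assume xy: "(x, y) \<in> p" "(x', y') \<in> p"
      note p3 = p2[OF xy(1)] p2[OF xy(2)]
      have "adj G x x' \<longleftrightarrow> adj G y y'"
      proof (cases "col G x = col G x'")
        case True
        then show ?thesis using 6(3)[OF xy] p3 by (simp add: mono_adj_def)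
      next
        case False
        show ?thesis
        proof (cases "col G x")
          case Red
          then have "x \<in> color_class G Red" "x' \<in> color_class G Blue" using False p3 unfolding cc by (cases "col G x'"; simp)+
          then show ?thesis using 6(3)[OF xy] by blast
        next
          case Blue
          then have "x \<in> color_class G Blue" "x' \<in> color_class G Red" using False p3 unfolding cc by (cases "col G x'"; simp)+
          then show ?thesis using 6(3)[OF xy(2,1)] symadj[of x x'] symadj[of y y'] by blast
        qed
      qed
      then show "(x = x' \<longleftrightarrow> y = y') \<and> (adj G x x' \<longleftrightarrow> adj G y y') \<and> col G x = col G y"
        using 6(3)[OF xy] p3 by blast
    qed
    then obtain g where g: "is_iso g G G" "\<forall>x y. (x, y) \<in> p \<longrightarrow> g x = y"
      using u 6(1) unfolding ultrahomogeneous_iff by blast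
    have gv: "g x \<in> verts G" "col G (g x) = col G x" if "x \<in> verts G" for x
      using g(1) that unfolding is_iso_def bij_betw_def by auto
    have ga: "adj G (g x) (g y) \<longleftrightarrow> adj G x y" if "x \<in> verts G" "y \<in> verts G" for x y
      using g(1) that unfolding is_iso_def by blast
    have gb: "bij_betw g (color_class G c) (color_class G c)" for c
      unfolding bij_betw_def
    proof
      show "inj_on g (color_class G c)"
        using g(1) unfolding is_iso_def bij_betw_def color_class_def by (auto intro: inj_on_subset)
      show "g ` color_class G c = color_class G c"
      proof
        show "g ` color_class G c \<subseteq> color_class G c" using gv unfolding color_class_def by auto
        show "color_class G c \<subseteq> g ` color_class G c"
        proof
          fix y assume y: "y \<in> color_class G c"
          then have "y \<in> g ` verts G" using g(1) unfolding is_iso_def bij_betw_def cc by simp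
          then obtain x where "x \<in> verts G" "y = g x" by blast
          then show "y \<in> g ` color_class G c" using y gv[of x] unfolding cc by (auto simp: color_class_def)
        qed
      qed
    qed
    have "mono_adj G (g x) (g y) \<longleftrightarrow> mono_adj G x y" if "x \<in> color_class G Red \<union> color_class G Blue" "y \<in> color_class G Red \<union> color_class G Blue" for x y
    proof -
      have "x \<in> verts G" "y \<in> verts G" using that by (auto simp: color_class_def)
      then show ?thesis using ga gv by (simp add: mono_adj_def)
    qed
    moreover have "adj G (g x) (g y) \<longleftrightarrow> adj G x y" if "x \<in> color_class G Red" "y \<in> color_class G Blue" for x y
      using ga that by (simp add: color_class_def)
    ultimately show ?case using gb g(2) by (intro exI[of _ g]) blast
  next
    case 7
    have "verts G = color_class G Red \<union> color_class G Blue"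
    proof (intro set_eqI iffI)
      fix x assume "x \<in> verts G"
      then show "x \<in> color_class G Red \<union> color_class G Blue" by (cases "col G x") (auto simp: color_class_def)
    qed (auto simp: color_class_def)
    then show ?case using inf by simp
  next
    case 8 show ?case by (rule two)
  next
    case 9 show ?case by (rule two)
  next
    case (10 x y) then show ?case using split[of x y Red Blue] by auto
  next
    case (11 x y) then show ?case using split[of x y Blue Red] symadj by (auto; metis)
  qed
qed

lemma emb_extend:
  assumes sA: "simple_cgraph A" and sG: "simple_cgraph G"
    and T: "T \<subseteq> verts A" "v \<in> verts A" "v \<notin> T" and e: "emb e (induced A T) G"
    and y: "y \<in> verts G" "y \<notin> e ` T" "col G y = col A v" "\<And>t. t \<in> T \<Longrightarrow> adj G y (e t) \<longleftrightarrow> adj A v t"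
  shows "emb (e(v := y)) (induced A (insert v T)) G"
proof -
  have V: "verts (induced A T) = T" "verts (induced A (insert v T)) = insert v T" using T by (auto simp: induced_def)
  have e1: "e t \<in> verts G" "col G (e t) = col A t" if "t \<in> T" for t
    using e that unfolding emb_def V by (auto simp: induced_def)
  have e2: "adj G (e t) (e u) \<longleftrightarrow> adj A t u" "e t = e u \<longleftrightarrow> t = u" if "t \<in> T" "u \<in> T" for t u
  proof -
    have "adj G (e t) (e u) \<longleftrightarrow> adj (induced A T) t u" using e that unfolding emb_def V by blast
    then show "adj G (e t) (e u) \<longleftrightarrow> adj A t u" using that by (simp add: induced_def)
    have "inj_on e T" using e unfolding emb_def V by blast
    then show "e t = e u \<longleftrightarrow> t = u" using inj_on_eq_iff that by metis
  qed
  have symA: "adj A a b = adj A b a" "\<not> adj A a a" for a b using sA unfolding simple_cgraph_def by blast+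
  have symG: "adj G a b = adj G b a" "\<not> adj G a a" for a b using sG unfolding simple_cgraph_def by blast+
  have nv: "t \<noteq> v" "e t \<noteq> y" if "t \<in> T" for t using that T y by auto
  show ?thesis unfolding emb_def V
  proof (intro conjI ballI)
    show "(e(v := y)) ` insert v T \<subseteq> verts G" using y(1) e1(1) nv by auto
    show "inj_on (e(v := y)) (insert v T)"
    proof (rule inj_onI)
      fix t u assume "t \<in> insert v T" "u \<in> insert v T" "(e(v := y)) t = (e(v := y)) u"
      then show "t = u" using nv[of t] nv[of u] e2(2)[of t u] by (metis fun_upd_apply insertE)
    qed
    fix t assume t: "t \<in> insert v T"
    show "col G ((e(v := y)) t) = col (induced A (insert v T)) t"
      using t e1(2)[of t] y(3) by (auto simp: induced_def)
    fix u assume u: "u \<in> insert v T"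
    have I: "adj (induced A (insert v T)) t u \<longleftrightarrow> adj A t u" using t u by (simp add: induced_def)
    consider "t = v" "u = v" | "t = v" "u \<noteq> v" "u \<in> T" | "t \<noteq> v" "u = v" "t \<in> T" | "t \<noteq> v" "u \<noteq> v" "t \<in> T" "u \<in> T"
      using t u by blast
    then show "adj G ((e(v := y)) t) ((e(v := y)) u) = adj (induced A (insert v T)) t u"
      unfolding I
    proof cases
      case 1 then show "adj G ((e(v := y)) t) ((e(v := y)) u) = adj A t u" using symA(2)[of v] symG(2)[of y] by simp
    next
      case 2 then show "adj G ((e(v := y)) t) ((e(v := y)) u) = adj A t u" using y(4)[OF 2(3)] by simp
    next
      case 3 then show "adj G ((e(v := y)) t) ((e(v := y)) u) = adj A t u"
        using y(4)[OF 3(3)] symA(1)[of t v] symG(1)[of "e t" y] by simp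
    next
      case 4 then show "adj G ((e(v := y)) t) ((e(v := y)) u) = adj A t u" using e2(1)[OF 4(3,4)] by simp
    qed
  qed
qed

text \<open>Traces are prescribed on one vertex per clique; parity or a clique bound then fixes the
  remaining ones.\<close>

lemma (in bicol) transversal:
  assumes "finite C"
  shows "\<exists>D\<subseteq>C. (\<forall>c\<in>D. \<forall>d\<in>D. \<not> A c d) \<and> (\<forall>c\<in>C. \<exists>d\<in>D. d = c \<or> A c d)"
  using assms
proof (induction C)
  case (insert c C)
  then obtain D where D: "D \<subseteq> C" "\<forall>c\<in>D. \<forall>d\<in>D. \<not> A c d" "\<forall>c\<in>C. \<exists>d\<in>D. d = c \<or> A c d" by blast
  show ?case
  proof (cases "\<exists>d\<in>D. A c d")
    case True then show ?thesis using D by (intro exI[of _ D]) blast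
  next
    case False
    then have "\<forall>d\<in>D. \<not> A d c" using A_sym by blast
    then show ?thesis using D False A_irr by (intro exI[of _ "insert c D"]) auto
  qed
qed simp

lemma (in bicol) spread_indep:
  assumes "spread X" shows "\<exists>I. finite I \<and> card I = k \<and> I \<subseteq> X \<and> (\<forall>c\<in>I. \<forall>d\<in>I. \<not> A c d)"
proof (induction k)
  case (Suc k)
  then obtain I where I: "finite I" "card I = k" "I \<subseteq> X" "\<forall>c\<in>I. \<forall>d\<in>I. \<not> A c d" by blast
  obtain b where b: "b \<in> X" "b \<notin> I" "\<forall>d\<in>I. \<not> A b d" using spreadD[OF assms I(1)] by blast
  then have "\<forall>d\<in>I. \<not> A d b" using A_sym by blast
  then show ?case using I b A_irr by (intro exI[of _ "insert b I"]) auto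
qed auto

section \<open>The age of a homogeneous graph\<close>

text \<open>These are the properties that the classification works with, in a form that
  \<open>swap_colors\<close> preserves.\<close>

locale cuh =
  fixes G :: "'a cgraph"
  assumes cliques: "clq G" and homog: "ultrahomogeneous G" and count: "countable (verts G)"
    and bicol_G: "bicol (color_class G Red) (color_class G Blue) (mono_adj G) (adj G)"
begin

abbreviation "R \<equiv> color_class G Red"
abbreviation "B \<equiv> color_class G Blue"

sublocale b: bicol R B "mono_adj G" "adj G" by (rule bicol_G)

lemma simple: "simple_cgraph G"
  using cliques unfolding clq_def by blast

lemma adj_sym: "adj G x y = adj G y x"
  using simple unfolding simple_cgraph_def by blast

lemma adj_verts: "adj G x y \<Longrightarrow> x \<in> verts G \<and> y \<in> verts G \<and> x \<noteq> y"
  using simple unfolding simple_cgraph_def by blast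

lemma mem_R: "x \<in> R \<longleftrightarrow> x \<in> verts G \<and> col G x = Red"
  and mem_B: "x \<in> B \<longleftrightarrow> x \<in> verts G \<and> col G x = Blue"
  by (simp_all add: color_class_def)

lemma indep_le_alpha: "indep_le (alpha Red G) G"
  unfolding indep_le_def alpha_ge_iff by blast

lemma alpha_infinite:
  assumes "b.spread R" shows "alpha Red G = \<infinity>"
proof (rule ccontr)
  assume "alpha Red G \<noteq> \<infinity>"
  then obtain n where n: "alpha Red G = enat n" by blast
  obtain I where I: "finite I" "card I = Suc n" "I \<subseteq> R" "\<forall>c\<in>I. \<forall>d\<in>I. \<not> mono_adj G c d"
    using b.spread_indep[OF assms, of "Suc n"] by blast
  have "\<not> adj G c d" if "c \<in> I" "d \<in> I" for c d
  proof -
    have "c \<in> R" "d \<in> R" using that I(3) by blast+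
    then have "col G c = col G d" using mem_R[of c] mem_R[of d] by simp
    then show ?thesis using I(4) that unfolding mono_adj_def by blast
  qed
  then have "independent_set G I" using I(3) mem_R unfolding independent_set_def by blast
  then have "enat (Suc n) \<le> alpha Red G" using I unfolding alpha_ge_iff by blast
  then show False using n by simp
qed

lemma fraisse_limitI:
  assumes adm: "admissible kR kB (alpha Red G) G"
    and blue_inf: "b.spread B"
    and blue_two: "\<And>b. kB = Two \<Longrightarrow> b \<in> B \<Longrightarrow> \<exists>b'. mono_adj G b b'"
    and blue_unb: "\<And>b F. kB = Unbounded \<Longrightarrow> b \<in> B \<Longrightarrow> finite F \<Longrightarrow> \<exists>b'. mono_adj G b b' \<and> b' \<notin> F"
    and red_two: "\<And>r. kR = Two \<Longrightarrow> r \<in> R \<Longrightarrow> \<exists>r'. mono_adj G r r'"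
    and red_unb: "kR = Unbounded \<Longrightarrow> b.ext_same"
    and red_new: "\<And>X C U r1. finite X \<Longrightarrow> X \<subseteq> R \<Longrightarrow> finite C \<Longrightarrow> C \<subseteq> B \<Longrightarrow>
       (kB = Two \<Longrightarrow> \<forall>c\<in>C. \<forall>d\<in>C. mono_adj G c d \<longrightarrow> (c \<in> U \<longleftrightarrow> d \<notin> U)) \<Longrightarrow>
       r1 \<in> R \<Longrightarrow> r1 \<notin> X \<Longrightarrow> (\<forall>s\<in>X. \<not> mono_adj G s r1) \<Longrightarrow>
       \<exists>r\<in>R. r \<notin> X \<and> (\<forall>s\<in>X. \<not> mono_adj G s r) \<and> (\<forall>c\<in>C. adj G r c \<longleftrightarrow> c \<in> U)"
  shows "is_fraisse_limit (adm_class kR kB (alpha Red G)) G"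
proof -
  have realize: "realized A G" if "A \<in> adm_class kR kB (alpha Red G)" for A
  proof -
    have fA: "finite (verts A)" and aA: "admissible kR kB (alpha Red G) A" using that by (auto simp: adm_class_def)
    note A' = admissible_parts[OF aA]
    note G' = admissible_parts[OF adm]
    have symA: "adj A x y = adj A y x" for x y using A'(1) unfolding simple_cgraph_def by blast
    have vA: "adj A x y \<Longrightarrow> x \<in> verts A \<and> y \<in> verts A \<and> x \<noteq> y" for x y using A'(1) unfolding simple_cgraph_def by blast
    have embD: "e t \<in> verts G \<and> col G (e t) = col A t" "t' \<in> T \<Longrightarrow> adj G (e t) (e t') \<longleftrightarrow> adj A t t'"
      "t' \<in> T \<Longrightarrow> e t = e t' \<longleftrightarrow> t = t'"
      if T: "T \<subseteq> verts A" "emb e (induced A T) G" "t \<in> T" for T e t t'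
    proof -
      have V: "verts (induced A T) = T" using T(1) by (auto simp: induced_def)
      show "e t \<in> verts G \<and> col G (e t) = col A t"
        using T(2,3) unfolding emb_def V by (auto simp: induced_def)
      assume t': "t' \<in> T"
      have "adj G (e t) (e t') \<longleftrightarrow> adj (induced A T) t t'" using T(2,3) t' unfolding emb_def V by blast
      then show "adj G (e t) (e t') \<longleftrightarrow> adj A t t'" using T(3) t' by (simp add: induced_def)
      have "inj_on e T" using T(2) unfolding emb_def V by blast
      then show "e t = e t' \<longleftrightarrow> t = t'" using inj_on_eq_iff T(3) t' by metis
    qed
    \<comment> \<open>Within one color, a single neighbor \<open>t0\<close> settles the adjacency to
      all other vertices.\<close>
    have join: "adj G y (e t) \<longleftrightarrow> adj A v t"
      if T: "T \<subseteq> verts A" "emb e (induced A T) G" "t0 \<in> T" "t \<in> T" "v \<notin> T" "adj A v t0" "col A t0 = col A v" "col A t = col A v"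
        and y: "adj G (e t0) y" "col G y = col A v" "y \<notin> e ` T" for T e t0 t v y
    proof -
      note e = embD(1)[OF T(1,2,3)] embD(1)[OF T(1,2,4)] embD(2)[OF T(1,2,3,4)] embD(3)[OF T(1,2,3,4)]
      have yt: "y \<noteq> e t" "v \<noteq> t" using y T by auto
      have "adj A v t \<longleftrightarrow> t0 = t \<or> adj A t0 t"
        using T(6,7,8) yt(2) symA[of v t0] A'(4)[of v t0 t] A'(4)[of t0 v t] by metis
      moreover have "adj G y (e t) \<longleftrightarrow> e t0 = e t \<or> adj G (e t0) (e t)"
        using y(1,2) yt(1) adj_sym[of y "e t0"] G'(4)[of y "e t0" "e t"] G'(4)[of "e t0" y "e t"] e T(7,8) by metis
      ultimately show ?thesis using e by simp
    qed
    \<comment> \<open>Under \<open>Two\<close> a mate of \<open>e t0\<close> cannot be in use yet: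
      its preimage would form a triangle with \<open>v\<close> and \<open>t0\<close> in
      \<open>A\<close>.\<close>
    have fresh: "y \<notin> e ` T"
      if two: "bound Two c A" and T: "T \<subseteq> verts A" "emb e (induced A T) G" "t0 \<in> T" "v \<notin> T" "adj A v t0" "col A t0 = c" "col A v = c"
        and y: "adj G (e t0) y" "col G y = c" for c T e t0 v y
    proof
      assume "y \<in> e ` T"
      then obtain t where t: "t \<in> T" "y = e t" by blast
      then have a: "adj A t0 t" "col A t = c" using embD(2)[OF T(1,2,3) t(1)] embD(1)[OF T(1,2) t(1)] y by auto
      have "v \<noteq> t" using t T by auto
      then have "adj A v t" using A'(4)[OF T(5) a(1)] a(2) T(6,7) by simp
      moreover have "\<not> (adj A v t \<and> adj A t0 t)"
        using two T(5,6,7) a vA[OF a(1)] unfolding bound.simps by blast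
      ultimately show False using a by blast
    qed
    let ?BA = "{x \<in> verts A. col A x = Blue}"
    let ?RA = "{x \<in> verts A. col A x = Red}"
    have blue: "\<exists>e. emb e (induced A T) G" if "finite T" "T \<subseteq> ?BA" for T
      using that
    proof (induction T)
      case empty then show ?case by (auto simp: emb_def induced_def)
    next
      case (insert v T)
      then obtain e where e: "emb e (induced A T) G" by auto
      have T: "T \<subseteq> verts A" "v \<in> verts A" "v \<notin> T" "col A v = Blue" "\<And>t. t \<in> T \<Longrightarrow> col A t = Blue" using insert by auto
      have eB: "e t \<in> B" if "t \<in> T" for t using embD(1)[OF T(1) e that] T(5)[OF that] mem_B by simp
      have fin: "finite (e ` T)" using insert by simp
      have "\<exists>y\<in>B. y \<notin> e ` T \<and> (\<forall>t\<in>T. adj G y (e t) \<longleftrightarrow> adj A v t)"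
      proof (cases "\<exists>t0\<in>T. adj A v t0")
        case True
        then obtain t0 where t0: "t0 \<in> T" "adj A v t0" by blast
        have "kB \<noteq> One"
        proof
          assume "kB = One"
          then have "bound One Blue A" using aA unfolding admissible_def by blast
          then show False using t0(2) T(4) T(5)[OF t0(1)] unfolding bound.simps by blast
        qed
        then consider "kB = Two" | "kB = Unbounded" by (cases kB) auto
        then obtain y where y: "mono_adj G (e t0) y" "y \<notin> e ` T"
        proof cases
          case 1
          then obtain y where y: "mono_adj G (e t0) y" using blue_two[OF _ eB[OF t0(1)]] by blast
          have "bound Two Blue A" using aA 1 unfolding admissible_def by blast
          then have "y \<notin> e ` T"
            using fresh[OF _ T(1) e t0(1) T(3) t0(2) T(5)[OF t0(1)] T(4)] y eB[OF t0(1)] mem_B unfolding mono_adj_def by metis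
          then show ?thesis using that y by blast
        next
          case 2
          then show ?thesis using that blue_unb[OF _ eB[OF t0(1)] fin] by blast
        qed
        have yB: "y \<in> B" using b.A_memB(1)[OF y(1) eB[OF t0(1)]] .
        have "adj G y (e t) \<longleftrightarrow> adj A v t" if "t \<in> T" for t
          by (rule join[OF T(1) e t0(1) that T(3) t0(2)])
            (use T(4) T(5)[OF t0(1)] T(5)[OF that] y yB mem_B in \<open>auto simp: mono_adj_def\<close>)
        then show ?thesis using yB y by blast
      next
        case False
        obtain y where y: "y \<in> B" "y \<notin> e ` T" "\<forall>d\<in>e ` T. \<not> mono_adj G y d" using b.spreadD[OF blue_inf fin] by blast
        have "\<not> adj G y (e t)" if "t \<in> T" for t
          using y(1,3) eB[OF that] that mem_B unfolding mono_adj_def by auto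
        then show ?thesis using y False by blast
      qed
      then obtain y where y: "y \<in> B" "y \<notin> e ` T" "\<forall>t\<in>T. adj G y (e t) \<longleftrightarrow> adj A v t" by blast
      have "emb (e(v := y)) (induced A (insert v T)) G"
        by (rule emb_extend[OF A'(1) simple T(1,2,3) e]) (use y T(4) mem_B in auto)
      then show ?case by blast
    qed
    have red: "\<exists>e. emb e (induced A (?BA \<union> U)) G" if "finite U" "U \<subseteq> ?RA" for U
      using that
    proof (induction U)
      case empty then show ?case using blue[of ?BA] fA by simp
    next
      case (insert v U)
      let ?T = "?BA \<union> U"
      obtain e where e: "emb e (induced A ?T) G" using insert by auto
      have T: "?T \<subseteq> verts A" "v \<in> verts A" "v \<notin> ?T" "col A v = Red" using insert by auto
      have TU: "t \<in> U" if "t \<in> ?T" "col A t = Red" for t using that by auto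
      have Uc: "t \<in> ?T" "col A t = Red" if "t \<in> U" for t using that insert by auto
      have Bc: "t \<in> ?T" "col A t = Blue" if "t \<in> ?BA" for t using that by auto
      have eB: "e t \<in> B" if "t \<in> ?BA" for t using embD(1)[OF T(1) e Bc(1)[OF that]] Bc(2)[OF that] mem_B by simp
      have eR: "e t \<in> R" if "t \<in> U" for t using embD(1)[OF T(1) e Uc(1)[OF that]] Uc(2)[OF that] mem_R by simp
      have finT: "finite ?T" using T(1) fA finite_subset by blast
      have finB: "finite (e ` ?BA)" "e ` ?BA \<subseteq> B" and finU: "finite (e ` U)" "e ` U \<subseteq> R"
        using fA insert(1) eB eR by auto
      have eU: "e t \<in> e ` {t \<in> ?BA. adj A v t} \<longleftrightarrow> adj A v t" if "t \<in> ?BA" for t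
      proof
        assume "e t \<in> e ` {t \<in> ?BA. adj A v t}"
        then obtain u where u: "u \<in> ?BA" "adj A v u" "e t = e u" by blast
        then show "adj A v t" using embD(3)[OF T(1) e Bc(1)[OF that] Bc(1)[OF u(1)]] by simp
      next
        assume "adj A v t" then show "e t \<in> e ` {t \<in> ?BA. adj A v t}" using that by blast
      qed
      have "\<exists>y\<in>R. y \<notin> e ` U \<and> (\<forall>t\<in>U. adj G y (e t) \<longleftrightarrow> adj A v t) \<and> (\<forall>t\<in>?BA. adj G y (e t) \<longleftrightarrow> adj A v t)"
      proof (cases "\<exists>t0\<in>U. adj A v t0")
        case True
        then obtain t0 where t0: "t0 \<in> U" "adj A v t0" by blast
        note t0c = Uc[OF t0(1)]
        have "kR \<noteq> One"
        proof
          assume "kR = One"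
          then have "bound One Red A" using aA unfolding admissible_def by blast
          then show False using t0(2) T(4) t0c(2) unfolding bound.simps by blast
        qed
        then consider "kR = Two" | "kR = Unbounded" by (cases kR) auto
        then obtain y where y: "mono_adj G (e t0) y" "y \<notin> e ` ?T" "\<forall>t\<in>?BA. adj G y (e t) \<longleftrightarrow> adj A v t"
        proof cases
          case 1
          then obtain y where y: "mono_adj G (e t0) y" using red_two[OF _ eR[OF t0(1)]] by blast
          have y': "adj G (e t0) y" "col G (e t0) = Red" "col G y = Red" "y \<in> R"
            using y eR[OF t0(1)] b.A_memR(1)[OF y eR[OF t0(1)]] mem_R unfolding mono_adj_def by auto
          have bA: "bound Two Red A" and bG: "bound Two Red G" using aA adm 1 unfolding admissible_def by blast+
          have "y \<notin> e ` ?T" by (rule fresh[OF bA T(1) e t0c(1) T(3) t0(2) t0c(2) T(4) y'(1,3)])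
          \<comment> \<open>In \<open>G\<close> the mate \<open>y\<close> is opposite to
            \<open>e t0\<close>, and in \<open>A\<close> the vertex \<open>v\<close> is opposite to
            \<open>t0\<close>; so the trace of \<open>y\<close> is correct without any
            choice.\<close>
          moreover have "adj G y (e t) \<longleftrightarrow> adj A v t" if t: "t \<in> ?BA" for t
          proof -
            have tn: "col A t \<noteq> Red" "t \<in> verts A" "e t \<in> verts G" "col G (e t) \<noteq> Red" using t eB[OF t] mem_B by auto
            have "adj A v t \<noteq> adj A t0 t" using bA t0(2) T(4) t0c(2) tn(1,2) unfolding bound.simps by blast
            moreover have "adj G (e t0) (e t) \<noteq> adj G y (e t)" using bG y'(1-3) tn(3,4) unfolding bound.simps by blast
            moreover have "adj G (e t0) (e t) \<longleftrightarrow> adj A t0 t" by (rule embD(2)[OF T(1) e t0c(1) Bc(1)[OF t]])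
            ultimately show ?thesis by blast
          qed
          ultimately show ?thesis using that y by blast
        next
          case 2
          \<comment> \<open>The trace is prescribed on one vertex per blue clique. Parity relative
            to \<open>t0\<close>, in \<open>A\<close> and in \<open>G\<close>, carries it to the
            rest of the clique.\<close>
          obtain C where C: "C \<subseteq> e ` ?BA" "\<forall>c\<in>C. \<forall>d\<in>C. \<not> mono_adj G c d" "\<forall>c\<in>e ` ?BA. \<exists>d\<in>C. d = c \<or> mono_adj G c d"
            using b.transversal[OF finB(1)] by blast
          obtain y where y: "y \<in> R" "mono_adj G (e t0) y" "y \<notin> e ` ?T" "\<forall>c\<in>C. adj G y c \<longleftrightarrow> c \<in> e ` {t \<in> ?BA. adj A v t}"
          proof -
            have fC: "finite C" "C \<subseteq> B" using C(1) finB finite_subset by blast+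
            have "finite (e ` ?T)" using finT by simp
            then show ?thesis
              using that b.ext_same_avoid[OF red_unb[OF 2] blue_inf eR[OF t0(1)] fC C(2), of "e ` ?T" "e ` {t \<in> ?BA. adj A v t}"] by blast
          qed
          have "adj G y (e t) \<longleftrightarrow> adj A v t" if t: "t \<in> ?BA" for t
          proof -
            obtain d where d: "d \<in> C" "d = e t \<or> mono_adj G (e t) d" using C(3) t by blast
            obtain u where u: "u \<in> ?BA" "d = e u" using d(1) C(1) by blast
            have yu: "adj G y (e u) \<longleftrightarrow> adj A v u" using y(4) d(1) u(2) eU[OF u(1)] by simp
            show ?thesis
            proof (cases "d = e t")
              case True
              then have "u = t" using u(2) embD(3)[OF T(1) e Bc(1)[OF u(1)] Bc(1)[OF t]] by simp
              then show ?thesis using yu by simp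
            next
              case False
              then have ad: "adj G (e t) (e u)" using d(2) u(2) unfolding mono_adj_def by blast
              then have "adj A t u" using embD(2)[OF T(1) e Bc(1)[OF t] Bc(1)[OF u(1)]] by simp
              then have pA: "(adj A v t = adj A t0 t) = (adj A v u = adj A t0 u)"
                using even_crossD[OF A'(2,1) t0(2), of t u Red] T(4) t0c(2) t u(1) by simp
              have "adj G (e t0) y" "col G (e t0) = Red" "col G y = Red" "col G (e t) \<noteq> Red" "col G (e u) \<noteq> Red"
                using y(1,2) eR[OF t0(1)] eB[OF t] eB[OF u(1)] mem_R mem_B unfolding mono_adj_def by auto
              then have pG: "(adj G (e t0) (e t) = adj G y (e t)) = (adj G (e t0) (e u) = adj G y (e u))"
                using even_crossD[OF G'(2,1) _ ad, of "e t0" y Red] by blast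
              have "adj G (e t0) (e t) \<longleftrightarrow> adj A t0 t" "adj G (e t0) (e u) \<longleftrightarrow> adj A t0 u"
                using embD(2)[OF T(1) e t0c(1) Bc(1)[OF t]] embD(2)[OF T(1) e t0c(1) Bc(1)[OF u(1)]] by blast+
              then show ?thesis using pA pG yu by argo
            qed
          qed
          then show ?thesis using that y by blast
        qed
        have yR: "y \<in> R" using b.A_memR(1)[OF y(1) eR[OF t0(1)]] .
        have "adj G y (e t) \<longleftrightarrow> adj A v t" if t: "t \<in> U" for t
          by (rule join[OF T(1) e t0c(1) Uc(1)[OF t] T(3) t0(2)])
            (use T(4) t0c(2) Uc(2)[OF t] y(1,2) yR mem_R in \<open>auto simp: mono_adj_def\<close>)
        then show ?thesis using yR y by blast
      next
        case False
        obtain X0 where X0: "X0 \<subseteq> e ` U" "\<forall>c\<in>X0. \<forall>d\<in>X0. \<not> mono_adj G c d" "\<forall>c\<in>e ` U. \<exists>d\<in>X0. d = c \<or> mono_adj G c d"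
          using b.transversal[OF finU(1)] by blast
        obtain W where W: "W \<subseteq> U" "X0 = e ` W" using X0(1) subset_imageE by metis
        have injW: "inj_on e W"
        proof (rule inj_onI)
          fix a b assume "a \<in> W" "b \<in> W" "e a = e b"
          then show "a = b" using embD(3)[OF T(1) e] Uc(1) W(1) by blast
        qed
        have finW: "finite W" using W(1) insert(1) finite_subset by blast
        \<comment> \<open>In \<open>A\<close> the set \<open>insert v W\<close> is red and
          independent, so \<open>G\<close> has an independent red set \<open>I\<close> of the same
          size. If every red clique of \<open>G\<close> met the image of \<open>U\<close>, each
          member of \<open>I\<close> would share its clique with the image of a vertex of
          \<open>W\<close>. Two members would then share the same one and be adjacent.\<close>
        have "\<exists>r1\<in>R. r1 \<notin> e ` U \<and> (\<forall>s\<in>e ` U. \<not> mono_adj G s r1)"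
        proof (rule ccontr)
          assume n: "\<not> ?thesis"
          have "\<not> adj A a b" if ab: "a \<in> W" "b \<in> W" for a b
          proof -
            have U: "a \<in> U" "b \<in> U" using ab W(1) by auto
            have "\<not> mono_adj G (e a) (e b)" using X0(2) ab W(2) by blast
            moreover have "col G (e a) = col G (e b)" using eR[OF U(1)] eR[OF U(2)] mem_R by simp
            ultimately have "\<not> adj G (e a) (e b)" unfolding mono_adj_def by blast
            then show ?thesis using embD(2)[OF T(1) e Uc(1)[OF U(1)] Uc(1)[OF U(2)]] by blast
          qed
          moreover have "\<not> adj A v a" "\<not> adj A a v" if "a \<in> W" for a
            using False that W(1) symA[of a v] by blast+
          moreover have "\<not> adj A v v" using vA[of v v] by blast
          ultimately have ind: "independent_set A (insert v W)"
            unfolding independent_set_def using T(2) W(1) insert(4) by auto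
          have "insert v W \<subseteq> color_class A Red" using T(2,4) W(1) insert(4) by (auto simp: color_class_def)
          then have "enat (card (insert v W)) \<le> alpha Red G"
            using A'(3) ind finW unfolding indep_le_def by (metis finite_insert)
          then obtain I where I: "finite I" "card I = card (insert v W)" "I \<subseteq> R" "independent_set G I"
            unfolding alpha_ge_iff by blast
          have vW: "v \<notin> W" using W(1) T(3) by blast
          have "\<exists>w\<in>W. e w = i \<or> mono_adj G i (e w)" if i: "i \<in> I" for i
          proof -
            have "i \<in> R" using i I(3) by blast
            then have "i \<in> e ` U \<or> (\<exists>s\<in>e ` U. mono_adj G s i)" using n by blast
            then obtain s where s: "s \<in> e ` U" "s = i \<or> mono_adj G i s" using b.A_sym by blast
            obtain d where d: "d \<in> X0" "d = s \<or> mono_adj G s d" using X0(3) s(1) by blast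
            have "d = i \<or> mono_adj G i d" using s(2) d(2) b.A_trans[of i s d] by blast
            then show ?thesis using d(1) W(2) by blast
          qed
          then obtain \<phi> where \<phi>: "\<And>i. i \<in> I \<Longrightarrow> \<phi> i \<in> W \<and> (e (\<phi> i) = i \<or> mono_adj G i (e (\<phi> i)))" by metis
          have "\<not> inj_on \<phi> I"
          proof
            assume "inj_on \<phi> I"
            then have "card I \<le> card W" using \<phi> finW card_inj_on_le by blast
            then show False using I(2) vW finW by simp
          qed
          then obtain i j where ij: "i \<in> I" "j \<in> I" "i \<noteq> j" "\<phi> i = \<phi> j" unfolding inj_on_def by blast
          have "mono_adj G i j"
            using \<phi>[OF ij(1)] \<phi>[OF ij(2)] ij(3,4) b.A_sym[of j "e (\<phi> j)"] b.A_trans[of i "e (\<phi> j)" j] by metis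
          then show False using I(4) ij(1,2) unfolding independent_set_def mono_adj_def by blast
        qed
        then obtain r1 where r1: "r1 \<in> R" "r1 \<notin> e ` U" "\<forall>s\<in>e ` U. \<not> mono_adj G s r1" by blast
        have cU: "\<forall>c\<in>e ` ?BA. \<forall>d\<in>e ` ?BA. mono_adj G c d \<longrightarrow> (c \<in> e ` {t \<in> ?BA. adj A v t} \<longleftrightarrow> d \<notin> e ` {t \<in> ?BA. adj A v t})"
          if k: "kB = Two"
        proof (intro ballI impI)
          fix c d assume cd: "c \<in> e ` ?BA" "d \<in> e ` ?BA" "mono_adj G c d"
          then obtain t u where t: "t \<in> ?BA" "c = e t" "u \<in> ?BA" "d = e u" by blast
          have bA: "bound Two Blue A" using aA k unfolding admissible_def by blast
          have "adj G (e t) (e u)" using cd(3) t unfolding mono_adj_def by blast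
          then have tu: "adj A t u" using embD(2)[OF T(1) e Bc(1)[OF t(1)] Bc(1)[OF t(3)]] by blast
          have "col A v \<noteq> Blue" using T(4) by simp
          then have "adj A t v \<noteq> adj A u v" using bA tu Bc(2)[OF t(1)] Bc(2)[OF t(3)] T(2) unfolding bound.simps by blast
          then have "adj A v t \<noteq> adj A v u" using symA[of t v] symA[of u v] by blast
          then show "c \<in> e ` {t \<in> ?BA. adj A v t} \<longleftrightarrow> d \<notin> e ` {t \<in> ?BA. adj A v t}"
            unfolding t(2,4) eU[OF t(1)] eU[OF t(3)] by blast
        qed
        obtain y where y: "y \<in> R" "y \<notin> e ` U" "\<forall>s\<in>e ` U. \<not> mono_adj G s y" "\<forall>c\<in>e ` ?BA. adj G y c \<longleftrightarrow> c \<in> e ` {t \<in> ?BA. adj A v t}"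
          using red_new[OF finU finB cU r1] by blast
        have "\<not> adj G y (e t)" if t: "t \<in> U" for t
        proof -
          have "\<not> mono_adj G (e t) y" using y(3) t by blast
          moreover have "col G (e t) = col G y" using y(1) eR[OF t] mem_R by simp
          ultimately show ?thesis using adj_sym[of y "e t"] unfolding mono_adj_def by blast
        qed
        moreover have "adj G y (e t) \<longleftrightarrow> adj A v t" if "t \<in> ?BA" for t
          using y(4) eU[OF that] that by blast
        ultimately show ?thesis using y(1,2) False by blast
      qed
      then obtain y where y: "y \<in> R" "y \<notin> e ` U" "\<forall>t\<in>U. adj G y (e t) \<longleftrightarrow> adj A v t" "\<forall>t\<in>?BA. adj G y (e t) \<longleftrightarrow> adj A v t"
        by blast
      have "y \<notin> e ` ?T"
      proof
        assume "y \<in> e ` ?T"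
        then have "y \<in> e ` ?BA" using y(2) by blast
        then show False using finB(2) y(1) b.not_both by blast
      qed
      then have "emb (e(v := y)) (induced A (insert v ?T)) G"
        by (intro emb_extend[OF A'(1) simple T(1,2,3) e]) (use y T(4) mem_R in auto)
      moreover have "insert v ?T = ?BA \<union> insert v U" by blast
      ultimately show ?case by metis
    qed
    have "?BA \<union> ?RA = verts A"
    proof (intro set_eqI iffI)
      fix x assume "x \<in> verts A" then show "x \<in> ?BA \<union> ?RA" by (cases "col A x") auto
    qed auto
    then obtain e where e: "emb e (induced A (verts A)) G" using red[of ?RA] fA by auto
    have "adj (induced A (verts A)) x y \<longleftrightarrow> adj A x y" for x y using vA[of x y] by (auto simp: induced_def)
    then have "emb e A G" using e unfolding emb_def by (simp add: induced_def)
    then show ?thesis using realized_iff_emb by blast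
  qed
  have "{A. finite_cgraph A \<and> realized A G} = adm_class kR kB (alpha Red G)"
  proof (intro set_eqI iffI)
    fix A :: "nat cgraph" assume "A \<in> {A. finite_cgraph A \<and> realized A G}"
    then obtain f where f: "emb f A G" "simple_cgraph A" "finite (verts A)"
      unfolding finite_cgraph_def realized_iff_emb by blast
    then show "A \<in> adm_class kR kB (alpha Red G)" using admissible_emb[OF f(1,2) adm] by (simp add: adm_class_def)
  next
    fix A assume A: "A \<in> adm_class kR kB (alpha Red G)"
    then have "finite_cgraph A" unfolding finite_cgraph_def adm_class_def admissible_def clq_def by blast
    then show "A \<in> {A. finite_cgraph A \<and> realized A G}" using realize[OF A] by blast
  qed
  then show ?thesis unfolding is_fraisse_limit_def using simple count homog by blast
qed

end

section \<open>Classification\<close>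

context cuh
begin

text \<open>The limit on the clique size follows from complementarity: among three mutually adjacent
  red vertices, two agree on a given blue vertex.\<close>

lemma bound_Two_RedI:
  assumes "\<And>x y b. x \<in> R \<Longrightarrow> mono_adj G x y \<Longrightarrow> b \<in> B \<Longrightarrow> adj G x b \<noteq> adj G y b"
  shows "bound Two Red G"
  unfolding bound.simps
proof (intro allI impI ballI, elim conjE)
  fix x y z assume a: "adj G x y" "col G x = Red" "col G y = Red" "z \<in> verts G"
  have x: "x \<in> R" "y \<in> R" "mono_adj G x y" using a adj_verts[OF a(1)] mem_R by (auto simp: mono_adj_def)
  obtain b0 where b0: "b0 \<in> B" using b.two_blue by blast
  have "\<not> (adj G x z \<and> adj G y z)" if "col G z = Red"
  proof
    assume z: "adj G x z \<and> adj G y z"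
    then have "mono_adj G x z" "mono_adj G y z" using a that by (auto simp: mono_adj_def)
    then show False using assms[OF x(1) _ b0, of z] assms[OF x(2) _ b0, of z] assms[OF x(1,3) b0] by blast
  qed
  moreover have "adj G x z \<noteq> adj G y z" if "col G z \<noteq> Red"
  proof -
    have "z \<in> B" using that a(4) mem_B[of z] by (cases "col G z") auto
    then show ?thesis using assms x by blast
  qed
  ultimately show "(col G z = Red \<longrightarrow> \<not> (adj G x z \<and> adj G y z)) \<and> (col G z \<noteq> Red \<longrightarrow> adj G x z \<noteq> adj G y z)" by blast
qed

lemma bound_Two_BlueI:
  assumes "\<And>x y r. x \<in> B \<Longrightarrow> mono_adj G x y \<Longrightarrow> r \<in> R \<Longrightarrow> adj G r x \<noteq> adj G r y"
  shows "bound Two Blue G"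
  unfolding bound.simps
proof (intro allI impI ballI, elim conjE)
  fix x y z assume a: "adj G x y" "col G x = Blue" "col G y = Blue" "z \<in> verts G"
  have x: "x \<in> B" "y \<in> B" "mono_adj G x y" using a adj_verts[OF a(1)] mem_B by (auto simp: mono_adj_def)
  obtain r0 where r0: "r0 \<in> R" using b.two_red by blast
  have "\<not> (adj G x z \<and> adj G y z)" if "col G z = Blue"
  proof
    assume z: "adj G x z \<and> adj G y z"
    then have "mono_adj G x z" "mono_adj G y z" using a that by (auto simp: mono_adj_def)
    then show False using assms[OF x(1) _ r0, of z] assms[OF x(2) _ r0, of z] assms[OF x(1,3) r0] by blast
  qed
  moreover have "adj G x z \<noteq> adj G y z" if "col G z \<noteq> Blue"
  proof -
    have "z \<in> R" using that a(4) mem_R[of z] by (cases "col G z") auto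
    then have "adj G z x \<noteq> adj G z y" using assms x by blast
    then show ?thesis using adj_sym[of z x] adj_sym[of z y] by blast
  qed
  ultimately show "(col G z = Blue \<longrightarrow> \<not> (adj G x z \<and> adj G y z)) \<and> (col G z \<noteq> Blue \<longrightarrow> adj G x z \<noteq> adj G y z)" by blast
qed

lemma bound_TwoD:
  assumes "bound Two c G" "mono_adj G x y" "col G x = c" "z \<in> verts G"
  shows "col G z = c \<Longrightarrow> \<not> (adj G x z \<and> adj G y z)" "col G z \<noteq> c \<Longrightarrow> adj G x z \<noteq> adj G y z"
proof -
  have "adj G x y" "col G x = c" "col G y = c" using assms(2,3) by (auto simp: mono_adj_def)
  then have "(col G z = c \<longrightarrow> \<not> (adj G x z \<and> adj G y z)) \<and> (col G z \<noteq> c \<longrightarrow> adj G x z \<noteq> adj G y z)"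
    using assms(1,4) unfolding bound.simps by blast
  then show "col G z = c \<Longrightarrow> \<not> (adj G x z \<and> adj G y z)" "col G z \<noteq> c \<Longrightarrow> adj G x z \<noteq> adj G y z" by blast+
qed

lemma finite_mates:
  assumes "bound Two Red G" "X \<subseteq> R" "finite X"
  shows "finite {r. \<exists>s\<in>X. mono_adj G s r}"
proof -
  have "finite {r. mono_adj G s r}" if s: "s \<in> X" for s
  proof (cases "\<exists>r0. mono_adj G s r0")
    case True
    then obtain r0 where r0: "mono_adj G s r0" by blast
    have sR: "s \<in> R" using s assms(2) by blast
    have "{r. mono_adj G s r} \<subseteq> {r0}"
    proof
      fix r assume "r \<in> {r. mono_adj G s r}"
      then have r: "mono_adj G s r" by simp
      have rR: "r \<in> R" using b.A_memR(1)[OF r sR] .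
      show "r \<in> {r0}"
      proof (rule ccontr)
        assume "r \<notin> {r0}"
        then have "mono_adj G r0 r" using b.A_trans[OF b.A_sym[OF r0] r] by blast
        then have "adj G s r" "adj G r0 r" using r by (auto simp: mono_adj_def)
        then show False using bound_TwoD(1)[OF assms(1) r0, of r] sR rR mem_R by blast
      qed
    qed
    then show ?thesis using finite_subset by blast
  qed simp
  moreover have "{r. \<exists>s\<in>X. mono_adj G s r} = (\<Union>s\<in>X. {r. mono_adj G s r})" by blast
  ultimately show ?thesis using assms(3) by simp
qed

text \<open>With a blue bound below \<open>Unbounded\<close>, the value of a red vertex at one
  vertex of a blue clique determines it on the whole clique, so prescriptions on independent sets
  suffice.\<close>

lemma red_new_from_indep:
  assumes k: "kB \<noteq> Unbounded" "bound kB Blue G"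
    and P: "\<And>C. finite C \<Longrightarrow> C \<subseteq> B \<Longrightarrow> \<forall>c\<in>C. \<forall>d\<in>C. \<not> mono_adj G c d \<Longrightarrow>
      \<exists>r\<in>R. r \<notin> X \<and> (\<forall>s\<in>X. \<not> mono_adj G s r) \<and> (\<forall>c\<in>C. adj G r c \<longleftrightarrow> c \<in> U)"
    and C: "finite C" "C \<subseteq> B" "kB = Two \<Longrightarrow> \<forall>c\<in>C. \<forall>d\<in>C. mono_adj G c d \<longrightarrow> (c \<in> U \<longleftrightarrow> d \<notin> U)"
  shows "\<exists>r\<in>R. r \<notin> X \<and> (\<forall>s\<in>X. \<not> mono_adj G s r) \<and> (\<forall>c\<in>C. adj G r c \<longleftrightarrow> c \<in> U)"
proof -
  obtain D where D: "D \<subseteq> C" "\<forall>c\<in>D. \<forall>d\<in>D. \<not> mono_adj G c d" "\<forall>c\<in>C. \<exists>d\<in>D. d = c \<or> mono_adj G c d"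
    using b.transversal[OF C(1)] by blast
  have fD: "finite D" "D \<subseteq> B" using D(1) C(1,2) finite_subset by blast+
  obtain r where r: "r \<in> R" "r \<notin> X" "\<forall>s\<in>X. \<not> mono_adj G s r" "\<forall>c\<in>D. adj G r c \<longleftrightarrow> c \<in> U"
    using P[OF fD D(2)] by blast
  have "adj G r c \<longleftrightarrow> c \<in> U" if c: "c \<in> C" for c
  proof -
    obtain d where d: "d \<in> D" "d = c \<or> mono_adj G c d" using D(3) c by blast
    show ?thesis
    proof (cases "d = c")
      case True then show ?thesis using r(4) d(1) by blast
    next
      case False
      then have cd: "mono_adj G c d" using d by blast
      have cB: "c \<in> B" "col G c = Blue" using c C(2) mem_B by blast+
      have "kB \<noteq> One"
      proof
        assume "kB = One"
        then have "bound One Blue G" using k by simp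
        moreover have "adj G c d" "col G d = Blue" using cd cB by (auto simp: mono_adj_def)
        ultimately show False using cB(2) unfolding bound.simps by blast
      qed
      then have kB: "kB = Two" using k(1) by (cases kB) auto
      have rv: "r \<in> verts G" "col G r \<noteq> Blue" using r(1) mem_R by auto
      have "adj G c r \<noteq> adj G d r" using bound_TwoD(2)[OF _ cd cB(2) rv] k(2) kB by blast
      then have "adj G r c \<noteq> adj G r d" using adj_sym[of r c] adj_sym[of r d] by blast
      moreover have "c \<in> U \<longleftrightarrow> d \<notin> U" using C(3)[OF kB] c d(1) D(1) cd by blast
      moreover have "adj G r d \<longleftrightarrow> d \<in> U" using r(4) d(1) by blast
      ultimately show ?thesis by blast
    qed
  qed
  then show ?thesis using r by blast
qed

text \<open>Red cliques of size at most two give finitely many vertices only finitely many mates, so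
  avoiding cliques reduces to avoiding vertices.\<close>

lemma generic_avoid_cliques:
  assumes two: "bound Two Red G" and sp: "\<And>r t. r \<in> R \<Longrightarrow> b.spread {x \<in> B. adj G r x = t}"
    and X: "finite X" "X \<subseteq> R" and C: "finite C" "C \<subseteq> B" "\<forall>c\<in>C. \<forall>d\<in>C. \<not> mono_adj G c d"
  shows "\<exists>r\<in>R. r \<notin> X \<and> (\<forall>s\<in>X. \<not> mono_adj G s r) \<and> (\<forall>c\<in>C. adj G r c \<longleftrightarrow> c \<in> U)"
proof -
  let ?Y = "X \<union> {r. \<exists>s\<in>X. mono_adj G s r}"
  have "finite ?Y" using X finite_mates[OF two X(2,1)] by simp
  then obtain r where "r \<in> R" "r \<notin> ?Y" "\<forall>c\<in>C. adj G r c \<longleftrightarrow> c \<in> U"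
    using b.generic_red_avoid[OF sp C, of ?Y U] by blast
  then show ?thesis by blast
qed

lemma spread_red_if_Two:
  assumes two: "bound Two Red G" and sp: "\<And>r t. r \<in> R \<Longrightarrow> b.spread {x \<in> B. adj G r x = t}"
  shows "b.spread R"
  unfolding b.spread_def
proof (intro allI impI)
  fix F :: "'a set" assume F: "finite F"
  obtain r where r: "r \<in> R" "r \<notin> F \<inter> R" "\<forall>s\<in>F \<inter> R. \<not> mono_adj G s r"
    using generic_avoid_cliques[OF two sp, of "F \<inter> R" "{}" "{}"] F by auto
  have "\<not> mono_adj G r d" if "d \<in> F" for d
  proof
    assume a: "mono_adj G r d"
    then have "d \<in> R" using b.A_memR(1)[OF a r(1)] by blast
    then show False using r(3) that b.A_sym[OF a] by blast
  qed
  then show "\<exists>b\<in>R. b \<notin> F \<and> (\<forall>d\<in>F. \<not> mono_adj G b d)" using r by blast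
qed

text \<open>The search stays inside the clique of \<open>r1\<close>. That clique misses
  \<open>X\<close>, and none of its vertices is a mate of a vertex of \<open>X\<close>.\<close>

lemma ext_same_new:
  assumes ex: "b.ext_same" and r1: "r1 \<in> R" "r1 \<notin> X" "\<forall>s\<in>X. \<not> mono_adj G s r1"
    and C: "finite C" "C \<subseteq> B" "\<forall>c\<in>C. \<forall>d\<in>C. \<not> mono_adj G c d"
  shows "\<exists>r\<in>R. r \<notin> X \<and> (\<forall>s\<in>X. \<not> mono_adj G s r) \<and> (\<forall>c\<in>C. adj G r c \<longleftrightarrow> c \<in> U)"
proof -
  have "\<exists>r\<in>R. mono_adj G r1 r \<and> (\<forall>c\<in>C. adj G r c \<longleftrightarrow> c \<in> U)"
    by (rule mp[OF spec[OF spec[OF bspec[OF ex[unfolded b.ext_same_def] r1(1)]]]]) (use C in blast)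
  then obtain r where r: "r \<in> R" "mono_adj G r1 r" "\<forall>c\<in>C. adj G r c \<longleftrightarrow> c \<in> U" by blast
  have sr: "mono_adj G r r1" by (rule b.A_sym[OF r(2)])
  have "r \<notin> X" using r1(3) sr by blast
  moreover have "\<not> mono_adj G s r" if s: "s \<in> X" for s
  proof
    assume "mono_adj G s r"
    then have "mono_adj G s r1" using b.A_trans[OF _ sr, of s] s r1(2) by blast
    then show False using r1(3) s by blast
  qed
  ultimately show ?thesis using r by blast
qed

text \<open>Complementary blue neighborhoods leave red cliques of size at most two, and then
  infinitely many of them; hence the infinite \<open>alpha\<close> in the first alternative.\<close>

lemma fraisse_blue_indep:
  assumes "bicol_one R B (mono_adj G) (adj G)"
  shows "alpha Red G = \<infinity> \<and> is_fraisse_limit (adm_class Two One (alpha Red G)) G \<or>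
    is_fraisse_limit (adm_class Unbounded One (alpha Red G)) G"
proof -
  interpret o: bicol_one R B "mono_adj G" "adj G" by (rule assms)
  have b1: "bound One Blue G"
    unfolding bound.simps
  proof (intro allI impI notI)
    fix x y assume a: "adj G x y" "col G x = Blue \<and> col G y = Blue"
    then have "x \<in> B" "y \<in> B" "mono_adj G x y" using adj_verts[OF a(1)] mem_B by (auto simp: mono_adj_def)
    then show False using o.blue_indep by blast
  qed
  have e: "even_cross G" by (rule even_cross_if_bound[OF simple b1]) simp
  from o.dichotomy_one show ?thesis
  proof
    assume c: "\<forall>r\<in>R. \<forall>r'. mono_adj G r r' \<longrightarrow> (\<forall>b\<in>B. adj G r b \<noteq> adj G r' b)"
    have b2: "bound Two Red G" by (rule bound_Two_RedI) (use c in blast)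
    have "is_fraisse_limit (adm_class Two One (alpha Red G)) G"
    proof (rule fraisse_limitI)
      show "admissible Two One (alpha Red G) G"
        unfolding admissible_def using cliques e b1 b2 indep_le_alpha by blast
      show "b.spread B" by (rule o.spread_blue)
      show "\<exists>r'. mono_adj G r r'" if "r \<in> R" for r using o.edge_at[OF that] by blast
      fix X C U r1
      assume a: "finite X" "X \<subseteq> R" "finite C" "C \<subseteq> B"
      show "\<exists>r\<in>R. r \<notin> X \<and> (\<forall>s\<in>X. \<not> mono_adj G s r) \<and> (\<forall>c\<in>C. adj G r c \<longleftrightarrow> c \<in> U)"
        by (rule red_new_from_indep[OF _ b1 generic_avoid_cliques[OF b2 o.spread_half a(1,2)] a(3,4)]) auto
    qed auto
    then show ?thesis using alpha_infinite[OF spread_red_if_Two[OF b2 o.spread_half]] by blast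
  next
    assume ex: "b.ext_same"
    have "is_fraisse_limit (adm_class Unbounded One (alpha Red G)) G"
    proof (rule fraisse_limitI)
      show "admissible Unbounded One (alpha Red G) G"
        unfolding admissible_def using cliques e b1 indep_le_alpha bound.simps(3) by blast
      show "b.spread B" by (rule o.spread_blue)
      fix X C U r1
      assume a: "finite X" "X \<subseteq> R" "finite C" "C \<subseteq> B" "r1 \<in> R" "r1 \<notin> X" "\<forall>s\<in>X. \<not> mono_adj G s r1"
      show "\<exists>r\<in>R. r \<notin> X \<and> (\<forall>s\<in>X. \<not> mono_adj G s r) \<and> (\<forall>c\<in>C. adj G r c \<longleftrightarrow> c \<in> U)"
        by (rule red_new_from_indep[OF _ b1 ext_same_new[OF ex a(5-7)] a(3,4)]) auto
    qed (use ex in auto)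
    then show ?thesis by blast
  qed
qed

text \<open>The hypothesis \<open>tri\<close> fixes the orientation: if only one color has
  triangles, it is red. With equal bounds in both colors \<open>R\<close> is spread, so its
  independence number is infinite; in the mixed case it is left open.\<close>

lemma fraisse_parity:
  assumes "bicol_par R B (mono_adj G) (adj G)"
    and tri: "bicol_par.red_triangle R (mono_adj G) \<or> \<not> bicol_par.red_triangle B (mono_adj G)"
  shows "alpha Red G = \<infinity> \<and> is_fraisse_limit (adm_class Two Two (alpha Red G)) G \<or>
    is_fraisse_limit (adm_class Unbounded Two (alpha Red G)) G \<or>
    alpha Red G = \<infinity> \<and> is_fraisse_limit (adm_class Unbounded Unbounded (alpha Red G)) G"
proof -
  interpret p: bicol_par R B "mono_adj G" "adj G" by (rule assms)
  interpret f: bicol_par B R "mono_adj G" "\<lambda>b r. adj G r b" by (rule p.flip_par)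
  have e: "even_cross G"
    unfolding even_cross_def
  proof (intro allI impI, elim conjE)
    fix x y u v assume a: "adj G x y" "adj G u v" "col G x = Red" "col G y = Red" "col G u = Blue" "col G v = Blue"
    have "x \<in> R" "u \<in> B" "mono_adj G x y" "mono_adj G u v"
      using a adj_verts[OF a(1)] adj_verts[OF a(2)] mem_R mem_B by (auto simp: mono_adj_def)
    then show "(adj G x u = adj G y u) = (adj G x v = adj G y v)" by (rule p.parity)
  qed
  have blue_mate: "\<exists>b'. mono_adj G b b'" if "b \<in> B" for b
    using f.mate_exists f.red_edge that by blast
  have red_mate: "\<exists>r'. mono_adj G r r'" if "r \<in> R" for r
    using b.mate_exists p.red_edge that by blast
  show ?thesis
  proof (cases "f.red_triangle")
    case nbt: False
    have b2: "bound Two Blue G" by (rule bound_Two_BlueI) (use f.complementary_pairs[OF nbt] in blast)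
    have sB: "b.spread B" by (rule p.pairs_spread_blue[OF nbt])
    show ?thesis
    proof (cases "p.red_triangle")
      case False
      have r2: "bound Two Red G" by (rule bound_Two_RedI) (use p.complementary_pairs[OF False] in blast)
      have sp: "\<And>r t. r \<in> R \<Longrightarrow> b.spread {x \<in> B. adj G r x = t}" by (rule p.spread_half[OF sB])
      have "is_fraisse_limit (adm_class Two Two (alpha Red G)) G"
      proof (rule fraisse_limitI)
        show "admissible Two Two (alpha Red G) G"
          unfolding admissible_def using cliques e b2 r2 indep_le_alpha by blast
        show "b.spread B" by (rule sB)
        fix X C U r1
        assume a: "finite X" "X \<subseteq> R" "finite C" "C \<subseteq> B"
          "Two = Two \<Longrightarrow> \<forall>c\<in>C. \<forall>d\<in>C. mono_adj G c d \<longrightarrow> (c \<in> U \<longleftrightarrow> d \<notin> U)"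
        show "\<exists>r\<in>R. r \<notin> X \<and> (\<forall>s\<in>X. \<not> mono_adj G s r) \<and> (\<forall>c\<in>C. adj G r c \<longleftrightarrow> c \<in> U)"
          by (rule red_new_from_indep[OF _ b2 generic_avoid_cliques[OF r2 sp a(1,2)] a(3,4)]) (use a(5) in auto)
      qed (use blue_mate red_mate in auto)
      then show ?thesis using alpha_infinite[OF spread_red_if_Two[OF r2 sp]] by blast
    next
      case True
      have ex: "b.ext_same" by (rule p.triangle_ext_same[OF True])
      have "is_fraisse_limit (adm_class Unbounded Two (alpha Red G)) G"
      proof (rule fraisse_limitI)
        show "admissible Unbounded Two (alpha Red G) G"
          unfolding admissible_def using cliques e b2 indep_le_alpha bound.simps(3) by blast
        show "b.spread B" by (rule sB)
        fix X C U r1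
        assume a: "finite X" "X \<subseteq> R" "finite C" "C \<subseteq> B"
          "Two = Two \<Longrightarrow> \<forall>c\<in>C. \<forall>d\<in>C. mono_adj G c d \<longrightarrow> (c \<in> U \<longleftrightarrow> d \<notin> U)"
          "r1 \<in> R" "r1 \<notin> X" "\<forall>s\<in>X. \<not> mono_adj G s r1"
        show "\<exists>r\<in>R. r \<notin> X \<and> (\<forall>s\<in>X. \<not> mono_adj G s r) \<and> (\<forall>c\<in>C. adj G r c \<longleftrightarrow> c \<in> U)"
          by (rule red_new_from_indep[OF _ b2 ext_same_new[OF ex a(6-8)] a(3,4)]) (use a(5) in auto)
      qed (use blue_mate ex in auto)
      then show ?thesis by blast
    qed
  next
    case bt: True
    then have rt: "p.red_triangle" using tri by blast
    have ex: "b.ext_same" by (rule p.triangle_ext_same[OF rt])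
    have exB: "bicol.ext_same B R (mono_adj G) (\<lambda>b r. adj G r b)" by (rule f.triangle_ext_same[OF bt])
    have sB: "b.spread B" by (rule p.triangle_spread_blue[OF rt])
    have sR: "b.spread R" by (rule f.triangle_spread_blue[OF bt])
    have "is_fraisse_limit (adm_class Unbounded Unbounded (alpha Red G)) G"
    proof (rule fraisse_limitI)
      show "admissible Unbounded Unbounded (alpha Red G) G"
        unfolding admissible_def using cliques e indep_le_alpha bound.simps(3) by blast
      show "b.spread B" by (rule sB)
      show "\<exists>b'. mono_adj G b b' \<and> b' \<notin> F" if "b \<in> B" "finite F" for b F
      proof -
        obtain r where "r \<in> R" using b.two_red by blast
        then show ?thesis using p.infinite_blue_half[OF exB sR _ that] by blast
      qed
      fix X C U r1
      assume a: "finite X" "X \<subseteq> R" "finite C" "C \<subseteq> B"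
      show "\<exists>r\<in>R. r \<notin> X \<and> (\<forall>s\<in>X. \<not> mono_adj G s r) \<and> (\<forall>c\<in>C. adj G r c \<longleftrightarrow> c \<in> U)"
        by (rule p.generic_red_new[OF exB sR sB a])
    qed (use ex in auto)
    then show ?thesis using alpha_infinite[OF sR] by blast
  qed
qed

lemma swap: "cuh (swap_colors G)"
proof (rule cuh.intro)
  have o: "other a = other b \<longleftrightarrow> a = b" for a b by (cases a; cases b) auto
  have sw: "verts (swap_colors G) = verts G" "adj (swap_colors G) = adj G" "col (swap_colors G) = (\<lambda>x. other (col G x))"
    by (simp_all add: swap_colors_def)
  show "clq (swap_colors G)"
    using cliques unfolding clq_def simple_cgraph_def sw o .
  have iso: "is_iso g (swap_colors G) (swap_colors G) \<longleftrightarrow> is_iso g G G" for g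
    unfolding is_iso_def sw o ..
  have pi: "piso (swap_colors G) (swap_colors G) p \<longleftrightarrow> piso G G p" for p
    unfolding piso_def sw o ..
  show "ultrahomogeneous (swap_colors G)"
    using homog unfolding ultrahomogeneous_iff iso pi .
  show "countable (verts (swap_colors G))" using count sw by simp
  have c: "color_class (swap_colors G) Red = B" "color_class (swap_colors G) Blue = R"
  proof -
    have "other a = Red \<longleftrightarrow> a = Blue" "other a = Blue \<longleftrightarrow> a = Red" for a by (cases a; simp)+
    then show "color_class (swap_colors G) Red = B" "color_class (swap_colors G) Blue = R"
      by (simp_all add: color_class_def sw)
  qed
  have m: "mono_adj (swap_colors G) = mono_adj G" unfolding mono_adj_def sw o ..
  \<comment> \<open>The exchanged cross relation is \<open>adj G\<close> again, because adjacency is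
    symmetric.\<close>
  have a: "(\<lambda>b r. adj G r b) = adj G" using adj_sym by blast
  show "bicol (color_class (swap_colors G) Red) (color_class (swap_colors G) Blue) (mono_adj (swap_colors G)) (adj (swap_colors G))"
    unfolding c m sw using b.flip unfolding a .
qed

end

definition classified :: "'a cgraph \<Rightarrow> bool" where
  "classified G \<longleftrightarrow> (case alpha Red G of
         enat n \<Rightarrow>
           isomorphic G (fraisse_limit (K_w_1_fin n)) \<or>
           isomorphic G (fraisse_limit (K_w_2_fin n))
       | \<infinity> \<Rightarrow>
           isomorphic G (fraisse_limit K_2_1) \<or>
           isomorphic G (fraisse_limit K_w_1) \<or>
           isomorphic G (fraisse_limit K_2_2) \<or>
           isomorphic G (fraisse_limit K_w_2) \<or>
           isomorphic G (fraisse_limit K_w_w))"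

lemma (in cuh) classified_if_blue_indep:
  assumes "bicol_one R B (mono_adj G) (adj G)"
  shows "classified G"
proof (cases "alpha Red G")
  case (enat n)
  then show ?thesis using fraisse_blue_indep[OF assms] isomorphic_fraisse_limit
    unfolding classified_def class_equalities by auto
next
  case infinity
  then show ?thesis using fraisse_blue_indep[OF assms] isomorphic_fraisse_limit
    unfolding classified_def class_equalities by auto
qed

lemma (in cuh) classified_if_parity:
  assumes "bicol_par R B (mono_adj G) (adj G)"
    and "bicol_par.red_triangle R (mono_adj G) \<or> \<not> bicol_par.red_triangle B (mono_adj G)"
  shows "classified G"
proof (cases "alpha Red G")
  case (enat n)
  then show ?thesis using fraisse_parity[OF assms] isomorphic_fraisse_limit
    unfolding classified_def class_equalities by auto
next
  case infinity
  then show ?thesis using fraisse_parity[OF assms] isomorphic_fraisse_limit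
    unfolding classified_def class_equalities by auto
qed

text \<open>For \<open>t = True\<close> this is the hypothesis \<open>no_D\<close>, for
  \<open>t = False\<close> the same hypothesis for the complemented cross relation.\<close>

lemma (in cuh) no_D_if_omits:
  assumes "omits G (if t then D_graph else D_tilde)"
    and "r \<in> R" "b \<in> B" "mono_adj G r r'" "mono_adj G b b'" "adj G r b = t" "adj G r b' = t" "adj G r' b = t"
  shows "adj G r' b' = t"
proof (rule ccontr)
  assume "adj G r' b' \<noteq> t"
  moreover have "adj G r r'" "adj G b b'" "col G r = Red" "col G r' = Red" "col G b = Blue" "col G b' = Blue"
    using assms(2-5) mem_R mem_B by (auto simp: mono_adj_def)
  ultimately have "realized (if t then D_graph else D_tilde) G"
    unfolding realized_four[OF simple] using assms(6-8) by blast
  then show False using assms(1) unfolding omits_def by blast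
qed

lemma (in cuh) classification:
  assumes om: "omits G D_graph \<or> omits G D_tilde"
    and edge: "\<not> (independent_set G R \<and> independent_set G B)"
  shows "classified G \<or> classified (swap_colors G)"
proof -
  interpret s: cuh "swap_colors G" by (rule swap)
  have sw: "adj (swap_colors G) = adj G" by (simp add: swap_colors_def)
  have c: "color_class (swap_colors G) Red = B" "color_class (swap_colors G) Blue = R"
  proof -
    have "other a = Red \<longleftrightarrow> a = Blue" "other a = Blue \<longleftrightarrow> a = Red" for a by (cases a; simp)+
    then show "color_class (swap_colors G) Red = B" "color_class (swap_colors G) Blue = R"
      by (simp_all add: color_class_def swap_colors_def)
  qed
  have m: "mono_adj (swap_colors G) = mono_adj G"
  proof -
    have "other a = other b \<longleftrightarrow> a = b" for a b by (cases a; cases b) auto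
    then show ?thesis by (simp add: fun_eq_iff mono_adj_def swap_colors_def)
  qed
  have fl: "(\<lambda>b r. adj G r b) = adj G" using adj_sym by blast
  have ind: "independent_set G (color_class G d) \<longleftrightarrow> (\<forall>x\<in>color_class G d. \<forall>y\<in>color_class G d. \<not> mono_adj G x y)" for d
    by (auto simp: independent_set_def mono_adj_def color_class_def)
  consider "independent_set G B" "\<not> independent_set G R" | "independent_set G R" "\<not> independent_set G B"
    | "\<not> independent_set G R" "\<not> independent_set G B" using edge by blast
  then show ?thesis
  proof cases
    case 1
    have "bicol_one R B (mono_adj G) (adj G)"
      by unfold_locales (use 1 in \<open>auto simp: ind\<close>)
    then show ?thesis using classified_if_blue_indep by blast
  next
    case 2
    have "bicol_one (color_class (swap_colors G) Red) (color_class (swap_colors G) Blue) (mono_adj (swap_colors G)) (adj (swap_colors G))"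
      by unfold_locales (use 2 in \<open>auto simp: ind c m\<close>)
    then show ?thesis using s.classified_if_blue_indep by blast
  next
    case 3
    interpret e: bicol_edges R B "mono_adj G" "adj G"
      by unfold_locales (use 3 in \<open>auto simp: ind\<close>)
    have par: "bicol_par R B (mono_adj G) (adj G)"
      using om
    proof
      assume o: "omits G D_graph"
      interpret n: bicol_no_D R B "mono_adj G" "adj G"
        by unfold_locales (use no_D_if_omits[of True] o in auto)
      show ?thesis by (rule n.par)
    next
      assume o: "omits G D_tilde"
      \<comment> \<open>Complementing the cross edges turns the omission of \<open>D_tilde\<close>
        into \<open>no_D\<close>, and parity is carried back by a second complement.\<close>
      interpret ec: bicol_edges R B "mono_adj G" "\<lambda>r b. \<not> adj G r b" by (rule e.complement_edges)
      interpret n: bicol_no_D R B "mono_adj G" "\<lambda>r b. \<not> adj G r b"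
        by unfold_locales (use no_D_if_omits[of False] o in auto)
      interpret np: bicol_par R B "mono_adj G" "\<lambda>r b. \<not> adj G r b" by (rule n.par)
      show ?thesis using np.complement_par by simp
    qed
    show ?thesis
    proof (cases "bicol_par.red_triangle R (mono_adj G) \<or> \<not> bicol_par.red_triangle B (mono_adj G)")
      case True then show ?thesis using classified_if_parity[OF par] by blast
    next
      case False
      \<comment> \<open>Only blue cliques contain triangles here, so exchanging the colors reaches
        the orientation that \<open>classified_if_parity\<close> asks for.\<close>
      have "bicol_par (color_class (swap_colors G) Red) (color_class (swap_colors G) Blue) (mono_adj (swap_colors G)) (adj (swap_colors G))"
        unfolding c m sw using bicol_par.flip_par[OF par] unfolding fl .
      then show ?thesis using s.classified_if_parity False unfolding c m by blast
    qed
  qed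
qed

theorem theorem5p15:
  fixes G :: "'a cgraph"
  assumes "basic_CUH G"
    and "omits G D_graph \<or> omits G D_tilde"
    and "\<not> (independent_set G (color_class G Red) \<and> independent_set G (color_class G Blue))"
  shows "(\<forall>n\<ge>2. amalgamation_class (K_w_1_fin n) \<and> amalgamation_class (K_w_2_fin n)) \<and>
    (\<forall>K\<in>{K_2_1, K_w_1, K_2_2, K_w_2, K_w_w}. amalgamation_class K) \<and>
    (\<exists>G'\<in>{G, swap_colors G}.
       case alpha Red G' of
         enat n \<Rightarrow>
           isomorphic G' (fraisse_limit (K_w_1_fin n)) \<or>
           isomorphic G' (fraisse_limit (K_w_2_fin n))
       | \<infinity> \<Rightarrow>
           isomorphic G' (fraisse_limit K_2_1) \<or>
           isomorphic G' (fraisse_limit K_w_1) \<or>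
           isomorphic G' (fraisse_limit K_2_2) \<or>
           isomorphic G' (fraisse_limit K_w_2) \<or>
           isomorphic G' (fraisse_limit K_w_w))"
proof (intro conjI)
  show "\<forall>n\<ge>2. amalgamation_class (K_w_1_fin n) \<and> amalgamation_class (K_w_2_fin n)"
    unfolding class_equalities using amalgamation_class_adm_class by simp
  show "\<forall>K\<in>{K_2_1, K_w_1, K_2_2, K_w_2, K_w_w}. amalgamation_class K"
    unfolding class_equalities using amalgamation_class_adm_class by simp
  interpret cuh G
    by (rule cuh.intro)
      (use assms(1) bicol_of_basic_CUH[OF assms(1)] in \<open>auto simp: basic_CUH_def CUH_def clq_iff\<close>)
  have "classified G \<or> classified (swap_colors G)" by (rule classification[OF assms(2,3)])
  then show "\<exists>G'\<in>{G, swap_colors G}.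
       case alpha Red G' of
         enat n \<Rightarrow>
           isomorphic G' (fraisse_limit (K_w_1_fin n)) \<or>
           isomorphic G' (fraisse_limit (K_w_2_fin n))
       | \<infinity> \<Rightarrow>
           isomorphic G' (fraisse_limit K_2_1) \<or>
           isomorphic G' (fraisse_limit K_w_1) \<or>
           isomorphic G' (fraisse_limit K_2_2) \<or>
           isomorphic G' (fraisse_limit K_w_2) \<or>
           isomorphic G' (fraisse_limit K_w_w)"
    unfolding classified_def by blast
qed

end
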